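(* Let $T$ be a sublinear operator bounded on $L^2(\mathbb{R}^n)$. (i) Assume that there is a constant $C$ such that, for every ball $B\subset\mathbb{R}^n$ and every bounded function $f$ supported on $B$ with mean $0$ (that is, $\int_B f\,dx=0$), we have $$\int_{\mathbb{R}^n\setminus 4B}|Tf(x)|\,dx\le C\int_B|f(x)|\,dx. \qquad (\mathrm{I})$$ Then $T$ is of weak-type $(1,1)$ and consequently bounded on $L^p(\mathbb{R}^n)$ for every $1<p<2$. (ii) Assume that there is a constant $C$ such that, for every ball $B\subset\mathbb{R}^n$ and every bounded compactly supported function $f$ supported on $\mathbb{R}^n\setminus 4B$, we have $$\sup_{x\in B}|Tf(x)|\le \frac{C}{|2B|}\int_{2B}|Tf(x)|\,dx+C\inf_{x\in B}Mf(x). \qquad (\mathrm{II})$$ Then $T$ is bounded on $L^p(\mathbb{R}^n)$ for every $2<p<\infty$. (iii) If $T$ satisfies both (I) (for all $B$ and $f$ as in (i)) and (II) (for all $B$ and $f$ as in (ii)), then $T$ is bounded on $L^p(w)$ for every $1<p<\infty$ and every $w\in A_p$.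
   Context: All functions are complex-valued on $\mathbb{R}^n$, and $dx$ (or $|\cdot|$ for sets) is Lebesgue measure. For a ball $B$ with radius $r(B)$ and $\lambda>0$, $\lambda B$ is the concentric ball with radius $\lambda r(B)$. An operator $T$, mapping functions in $L^2(\mathbb{R}^n)$ to measurable functions, is sublinear if $|T(f+g)|\le|Tf|+|Tg|$ and $|T(\lambda f)|=|\lambda|\,|Tf|$ for all $f,g$ and all scalars $\lambda$. "Bounded on $L^2(\mathbb{R}^n)$" means $\|Tf\|_{L^2}\le C\|f\|_{L^2}$ for all $f\in L^2(\mathbb{R}^n)$. $L^\infty_c$ denotes the space of bounded functions with compact support. In the conclusions, "$T$ is bounded on $L^p(w)$" means that there is a constant $C$ with $\|Tf\|_{L^p(w)}\le C\|f\|_{L^p(w)}$ for all $f\in L^\infty_c$, where $\|f\|_{L^p(w)}=\big(\int_{\mathbb{R}^n}|f(x)|^p w(x)\,dx\big)^{1/p}$; "bounded on $L^p(\mathbb{R}^n)$" is the case $w\equiv1$. "Weak-type $(1,1)$" means that there is a constant $C$ with $\lambda\,|\{x:|Tf(x)|>\lambda\}|\le C\|f\|_{L^1}$ for all $\lambda>0$ and all $f\in L^\infty_c$. The supremum in (II) is understood as an essential supremum. $M$ is the Hardy-Littlewood maximal operator, $Mf(x)=\sup_{B\ni x}\frac1{|B|}\int_B|f(y)|\,dy$, the supremum being over all balls containing $x$. A weight is a non-negative locally integrable function $w$ on $\mathbb{R}^n$. For $1<p<\infty$, $w\in A_p$ means that there is a constant $C$ such that for every ball $B\subset\mathbb{R}^n$,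 $\Big(\frac1{|B|}\int_B w\,dx\Big)\Big(\frac1{|B|}\int_B w^{1-p'}\,dx\Big)^{p-1}\le C$, where $1/p+1/p'=1$. *)

theory Defs
  imports "HOL-Analysis.Analysis" "HOL-Probability.Essential_Supremum"
begin

text \<open>
  Functions are Lebesgue measurable representatives. An operator acts on representatives, and
  everything asserted about \<open>T f\<close> is insensitive to null sets; for a sublinear operator that is
  bounded on \<open>L\<^sup>2\<close>, \<open>f = g\<close> a.e. implies \<open>\<bar>T f\<bar> = \<bar>T g\<bar>\<close> a.e. Balls are open, with positive radius.
\<close>

text \<open>
  Real powers on \<open>[0, \<infinity>]\<close>, with \<open>0\<close> to a negative power being \<open>\<infinity>\<close>. The library's real \<open>powr\<close> has
  \<open>0 powr a = 0\<close> for every \<open>a\<close>, which would be wrong for the dual weight in the \<open>A\<^sub>p\<close> condition.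
\<close>

definition ennpowr :: "ennreal \<Rightarrow> real \<Rightarrow> ennreal" (infixr "ennpowr" 80) where
  "x ennpowr a =
    (if a = 0 then 1
     else if x = 0 then (if a < 0 then \<infinity> else 0)
     else if x = \<infinity> then (if a < 0 then 0 else \<infinity>)
     else ennreal (enn2real x powr a))"

definition Lp_norm :: "real \<Rightarrow> (real ^ 'n \<Rightarrow> real) \<Rightarrow> (real ^ 'n \<Rightarrow> complex) \<Rightarrow> ennreal" where
  "Lp_norm p w f = (\<integral>\<^sup>+x. ennreal (norm (f x) powr p * w x) \<partial>lebesgue) ennpowr (1 / p)"

definition L2_functions :: "(real ^ 'n \<Rightarrow> complex) set" where
  "L2_functions = {f \<in> borel_measurable lebesgue. Lp_norm 2 (\<lambda>_. 1) f < \<infinity>}"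

definition bounded_functions :: "(real ^ 'n \<Rightarrow> complex) set" where
  "bounded_functions = {f \<in> borel_measurable lebesgue. bounded (range f)}"

definition Linf_c :: "(real ^ 'n \<Rightarrow> complex) set" where
  "Linf_c = {f \<in> bounded_functions. compact (closure {x. f x \<noteq> 0})}"

definition sublinear_operator :: "((real ^ 'n \<Rightarrow> complex) \<Rightarrow> (real ^ 'n \<Rightarrow> complex)) \<Rightarrow> bool" where
  "sublinear_operator T \<longleftrightarrow>
    (\<forall>f \<in> L2_functions. T f \<in> borel_measurable lebesgue) \<and>
    (\<forall>f \<in> L2_functions. \<forall>g \<in> L2_functions.
       AE x in lebesgue. norm (T (\<lambda>y. f y + g y) x) \<le> norm (T f x) + norm (T g x)) \<and>
    (\<forall>f \<in> L2_functions. \<forall>c :: complex.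
       AE x in lebesgue. norm (T (\<lambda>y. c * f y) x) = norm c * norm (T f x))"

definition bounded_on_L2 :: "((real ^ 'n \<Rightarrow> complex) \<Rightarrow> (real ^ 'n \<Rightarrow> complex)) \<Rightarrow> bool" where
  "bounded_on_L2 T \<longleftrightarrow>
    (\<exists>C :: real. \<forall>f \<in> L2_functions.
       Lp_norm 2 (\<lambda>_. 1) (T f) \<le> ennreal C * Lp_norm 2 (\<lambda>_. 1) f)"

definition bounded_on_Lp_weight ::
    "((real ^ 'n \<Rightarrow> complex) \<Rightarrow> (real ^ 'n \<Rightarrow> complex)) \<Rightarrow> real \<Rightarrow> (real ^ 'n \<Rightarrow> real) \<Rightarrow> bool" where
  "bounded_on_Lp_weight T p w \<longleftrightarrow>
    (\<exists>C :: real. \<forall>f \<in> Linf_c. Lp_norm p w (T f) \<le> ennreal C * Lp_norm p w f)"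

abbreviation bounded_on_Lp ::
    "((real ^ 'n \<Rightarrow> complex) \<Rightarrow> (real ^ 'n \<Rightarrow> complex)) \<Rightarrow> real \<Rightarrow> bool" where
  "bounded_on_Lp T p \<equiv> bounded_on_Lp_weight T p (\<lambda>_. 1)"

definition weak_type_1_1 :: "((real ^ 'n \<Rightarrow> complex) \<Rightarrow> (real ^ 'n \<Rightarrow> complex)) \<Rightarrow> bool" where
  "weak_type_1_1 T \<longleftrightarrow>
    (\<exists>C :: real. \<forall>t > 0. \<forall>f \<in> Linf_c.
       ennreal t * emeasure lebesgue {x. norm (T f x) > t}
         \<le> ennreal C * (\<integral>\<^sup>+x. ennreal (norm (f x)) \<partial>lebesgue))"

text \<open>Average over a set of positive finite measure.\<close>

definition avg :: "(real ^ 'n) set \<Rightarrow> (real ^ 'n \<Rightarrow> ennreal) \<Rightarrow> ennreal" where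
  "avg B g = (\<integral>\<^sup>+x\<in>B. g x \<partial>lebesgue) / emeasure lebesgue B"

definition HL_maximal :: "(real ^ 'n \<Rightarrow> complex) \<Rightarrow> real ^ 'n \<Rightarrow> ennreal" where
  "HL_maximal f x =
    (SUP (c, r) \<in> {(c, r). r > 0 \<and> x \<in> ball c r}. avg (ball c r) (\<lambda>y. ennreal (norm (f y))))"

definition cond_I :: "((real ^ 'n \<Rightarrow> complex) \<Rightarrow> (real ^ 'n \<Rightarrow> complex)) \<Rightarrow> bool" where
  "cond_I T \<longleftrightarrow>
    (\<exists>C :: real. \<forall>c. \<forall>r > 0. \<forall>f \<in> bounded_functions.
       (\<forall>x. x \<notin> ball c r \<longrightarrow> f x = 0) \<longrightarrow> (LINT x:ball c r|lebesgue. f x) = 0 \<longrightarrow>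
       (\<integral>\<^sup>+x\<in>- ball c (4 * r). ennreal (norm (T f x)) \<partial>lebesgue)
         \<le> ennreal C * (\<integral>\<^sup>+x\<in>ball c r. ennreal (norm (f x)) \<partial>lebesgue))"

definition cond_II :: "((real ^ 'n \<Rightarrow> complex) \<Rightarrow> (real ^ 'n \<Rightarrow> complex)) \<Rightarrow> bool" where
  "cond_II T \<longleftrightarrow>
    (\<exists>C :: real. \<forall>c. \<forall>r > 0. \<forall>f \<in> Linf_c.
       (\<forall>x \<in> ball c (4 * r). f x = 0) \<longrightarrow>
       esssup (restrict_space lebesgue (ball c r)) (\<lambda>x. ennreal (norm (T f x)))
         \<le> ennreal C * avg (ball c (2 * r)) (\<lambda>x. ennreal (norm (T f x)))
            + ennreal C * (INF x \<in> ball c r. HL_maximal f x))"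

definition weight :: "(real ^ 'n \<Rightarrow> real) \<Rightarrow> bool" where
  "weight w \<longleftrightarrow> (\<forall>x. w x \<ge> 0) \<and> (\<forall>K. compact K \<longrightarrow> w absolutely_integrable_on K)"

definition A_class :: "real \<Rightarrow> (real ^ 'n \<Rightarrow> real) set" where
  "A_class p = {w. weight w \<and>
    (\<exists>C :: real. \<forall>c. \<forall>r > 0.
       avg (ball c r) (\<lambda>x. ennreal (w x))
         * avg (ball c r) (\<lambda>x. ennreal (w x) ennpowr (1 - p / (p - 1))) ennpowr (p - 1)
         \<le> ennreal C)}"

end

theory Submission
  imports Defs
begin

text \<open>
  The first part is the method of Calderon and Zygmund. A function \<open>f\<close> is decomposed at height \<open>t\<close> into a part
  bounded by a multiple of \<open>t\<close>, which is handled by the bound on \<open>L\<^sup>2\<close>, and pieces of mean zero on disjoint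
  cells, for which condition (I) controls \<open>T\<close> away from the cells (\<open>calderon_zygmund\<close>, \<open>weak_type_1\<close>). Interpolation
  between the weak type \<open>(1, 1)\<close> and \<open>L\<^sup>2\<close> gives the exponents between \<open>1\<close> and \<open>2\<close> (\<open>marcinkiewicz_1_2\<close>).

  The other two parts rest on one mechanism, sparse domination, with an exponent \<open>r\<close> for which \<open>T\<close> has weak type
  \<open>(r, r)\<close>: \<open>r = 2\<close> in the second part, where this follows from the bound on \<open>L\<^sup>2\<close>, and \<open>r = 1\<close> in the third,
  where it is the conclusion of the first. On a cube, \<open>T f\<close> is at most a constant times the mean of \<open>f\<close> of order \<open>r\<close>
  over a comparable ball, except on subcubes of at most half the total measure. On a subcube, the part of \<open>f\<close> away
  from it contributes again at most the mean, by condition (II), and the part near it is treated in the same way as \<open>f\<close>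
  was on the cube. Repeating this, one bounds the integral of \<open>\<bar>T f\<bar> * G\<close> by a sum over a family of cubes each
  of which has half of its measure to itself (\<open>sparse_step\<close>, \<open>sparse_domination\<close>).

  For \<open>r = 1\<close> there is an obstacle: the right-hand side of condition (II) contains averages of \<open>\<bar>T f\<bar>\<close>, and the
  maximal function of a function of weak type \<open>(1, 1)\<close> is not under control. It is overcome by showing that condition
  (II) improves itself: averages of \<open>\<bar>T f\<bar>\<close> may be replaced by squares of averages of \<open>sqrt \<bar>T f\<bar>\<close>
  (\<open>cond_II_sqrt_bound\<close>), and these respect weak type (\<open>kolmogorov_sqrt\<close>, \<open>maximal_sqrt_weak_type\<close>).

  A sparse bound gives weighted inequalities by duality. The means of \<open>f\<close> and of the dual function are bounded by maximal
  functions with respect to the measures \<open>\<sigma> dx\<close> and \<open>w dx\<close>, where \<open>\<sigma>\<close> is the dual weight. These measures are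
  doubling, hence the maximal functions are bounded on the corresponding spaces (\<open>maximal_strong_type\<close>), and the
  \<open>A\<^sub>p\<close> condition provides the remaining inequality between the weights (\<open>Lp_weight_bound_of_testing\<close>,
  \<open>mass_product_le\<close>).
\<close>

section \<open>Maximal functions of doubling measures\<close>

lemma nn_integral_UN_disjoint:
  assumes f[measurable]: "f \<in> borel_measurable M"
    and I: "countable I" "\<And>i. i \<in> I \<Longrightarrow> X i \<in> sets M" "disjoint_family_on X I"
  shows "(\<integral>\<^sup>+x\<in>(\<Union>i\<in>I. X i). f x \<partial>M) = (\<integral>\<^sup>+i. (\<integral>\<^sup>+x\<in>X i. f x \<partial>M) \<partial>count_space I)"
proof -
  have "emeasure (density M f) (\<Union>i\<in>I. X i) = (\<integral>\<^sup>+i. emeasure (density M f) (X i) \<partial>count_space I)"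
    using I by (intro emeasure_UN_countable) auto
  moreover have "(\<Union>i\<in>I. X i) \<in> sets M" using I by auto
  ultimately show ?thesis
    using I(2) by (simp add: emeasure_density cong: nn_integral_cong_simp)
qed

lemma emeasure_UN_le_count_space:
  assumes I: "countable I" "\<And>i. i \<in> I \<Longrightarrow> X i \<in> sets M"
  shows "emeasure M (\<Union>i\<in>I. X i) \<le> (\<integral>\<^sup>+i. emeasure M (X i) \<partial>count_space I)"
proof -
  have [measurable]: "(\<Union>i\<in>I. X i) \<in> sets M" using I by auto
  have "emeasure M (\<Union>i\<in>I. X i) = (\<integral>\<^sup>+x. indicator (\<Union>i\<in>I. X i) x \<partial>M)" by simp
  also have "\<dots> \<le> (\<integral>\<^sup>+x. (\<integral>\<^sup>+i. indicator (X i) x \<partial>count_space I) \<partial>M)"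
  proof (intro nn_integral_mono)
    fix x
    show "(indicator (\<Union>i\<in>I. X i) x :: ennreal) \<le> (\<integral>\<^sup>+i. indicator (X i) x \<partial>count_space I)"
    proof (cases "x \<in> (\<Union>i\<in>I. X i)")
      case True
      then obtain i where "i \<in> I" "x \<in> X i" by auto
      then show ?thesis using nn_integral_ge_point[of i I "\<lambda>i. indicator (X i) x"] by (auto simp: indicator_def)
    qed simp
  qed
  also have "\<dots> = (\<integral>\<^sup>+i. (\<integral>\<^sup>+x. indicator (X i) x \<partial>M) \<partial>count_space I)"
    using I by (intro nn_integral_count_space_nn_integral) auto
  also have "\<dots> = (\<integral>\<^sup>+i. emeasure M (X i) \<partial>count_space I)"
    using I(2) by (intro nn_integral_cong) auto
  finally show ?thesis .
qed

text \<open>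
  Three measures \<open>\<nu>\<close> occur: Lebesgue
  measure and, for a Muckenhoupt weight, the measures with density \<open>w\<close> and with its dual density \<open>\<sigma>\<close>.
\<close>
definition maximal :: "(real ^ 'n) measure \<Rightarrow> (real ^ 'n \<Rightarrow> ennreal) \<Rightarrow> real ^ 'n \<Rightarrow> ennreal" where
  "maximal \<nu> g x =
    (SUP (c, r) \<in> {(c, r). r > 0 \<and> x \<in> ball c r}. (\<integral>\<^sup>+y\<in>ball c r. g y \<partial>\<nu>) / emeasure \<nu> (ball c r))"

lemma HL_maximal_eq: "HL_maximal f = maximal lebesgue (\<lambda>y. ennreal (norm (f y)))"
  by (simp add: fun_eq_iff HL_maximal_def maximal_def avg_def)

locale doubling_measure =
  fixes \<nu> :: "(real ^ 'n) measure" and D :: real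
  assumes sets_eq: "sets \<nu> = sets lebesgue"
    and pos: "\<And>c r. r > 0 \<Longrightarrow> 0 < emeasure \<nu> (ball c r)"
    and fin: "\<And>c r. emeasure \<nu> (ball c r) < \<infinity>"
    and doubling: "\<And>c r. r > 0 \<Longrightarrow> emeasure \<nu> (ball c (5 * r)) \<le> ennreal D * emeasure \<nu> (ball c r)"
begin

lemma space_eq[simp]: "space \<nu> = UNIV"
  using sets_eq_imp_space_eq[OF sets_eq] by simp

lemma open_sets[measurable]: "open U \<Longrightarrow> U \<in> sets \<nu>"
  by (simp add: sets_eq sets_completionI_sets borel_open)

lemma ball_sets[measurable]: "ball c r \<in> sets \<nu>"
  by (intro open_sets open_ball)

lemma sigma_finite: "sigma_finite_measure \<nu>"
proof
  show "\<exists>A. countable A \<and> A \<subseteq> sets \<nu> \<and> \<Union> A = space \<nu> \<and> (\<forall>a\<in>A. emeasure \<nu> a \<noteq> \<infinity>)"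
  proof (intro exI[of _ "range (\<lambda>k::nat. ball 0 (real k))"] conjI)
    show "\<Union> (range (\<lambda>k::nat. ball (0::real^'n) (real k))) = space \<nu>"
      using reals_Archimedean2 by (auto)
  qed (use fin in \<open>auto simp: less_top\<close>)
qed

lemma average_le_maximal:
  assumes "x \<in> ball c r"
  shows "(\<integral>\<^sup>+y\<in>ball c r. g y \<partial>\<nu>) \<le> maximal \<nu> g x * emeasure \<nu> (ball c r)"
proof -
  have r: "r > 0" using assms by (metis ball_empty empty_iff not_less)
  have "(\<integral>\<^sup>+y\<in>ball c r. g y \<partial>\<nu>) / emeasure \<nu> (ball c r) \<le> maximal \<nu> g x"
    unfolding maximal_def using assms r by (intro SUP_upper2[of "(c, r)"]) auto
  then have "(\<integral>\<^sup>+y\<in>ball c r. g y \<partial>\<nu>) / emeasure \<nu> (ball c r) * emeasure \<nu> (ball c r)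
      \<le> maximal \<nu> g x * emeasure \<nu> (ball c r)"
    by (rule mult_right_mono) simp
  then show ?thesis
    using pos[OF r, of c] fin[of c r] by (simp add: ennreal_divide_times mult_divide_eq_ennreal)
qed

lemma maximal_leI:
  assumes "\<And>c r. r > 0 \<Longrightarrow> x \<in> ball c r \<Longrightarrow> (\<integral>\<^sup>+y\<in>ball c r. g y \<partial>\<nu>) \<le> m * emeasure \<nu> (ball c r)"
  shows "maximal \<nu> g x \<le> m"
  unfolding maximal_def
proof (intro SUP_least, clarify)
  fix c :: "real^'n" and r :: real assume r: "r > 0" "x \<in> ball c r"
  have "(\<integral>\<^sup>+y\<in>ball c r. g y \<partial>\<nu>) / emeasure \<nu> (ball c r) \<le> m * emeasure \<nu> (ball c r) / emeasure \<nu> (ball c r)"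
    using assms[OF r] by (rule divide_right_mono_ennreal)
  then show "(\<integral>\<^sup>+y\<in>ball c r. g y \<partial>\<nu>) / emeasure \<nu> (ball c r) \<le> m"
    using pos[OF r(1), of c] fin[of c r] by (simp add: mult_divide_eq_ennreal)
qed

lemma less_maximal_iff:
  "t < maximal \<nu> g x \<longleftrightarrow>
    (\<exists>c r. r > 0 \<and> x \<in> ball c r \<and> t * emeasure \<nu> (ball c r) < (\<integral>\<^sup>+y\<in>ball c r. g y \<partial>\<nu>))"
proof
  assume "t < maximal \<nu> g x"
  show "\<exists>c r. r > 0 \<and> x \<in> ball c r \<and> t * emeasure \<nu> (ball c r) < (\<integral>\<^sup>+y\<in>ball c r. g y \<partial>\<nu>)"
  proof (rule ccontr)
    assume "\<not> ?thesis"
    then have "maximal \<nu> g x \<le> t" by (intro maximal_leI leI) blast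
    with \<open>t < maximal \<nu> g x\<close> show False by simp
  qed
next
  assume "\<exists>c r. r > 0 \<and> x \<in> ball c r \<and> t * emeasure \<nu> (ball c r) < (\<integral>\<^sup>+y\<in>ball c r. g y \<partial>\<nu>)"
  then obtain c r where r: "x \<in> ball c r" "t * emeasure \<nu> (ball c r) < (\<integral>\<^sup>+y\<in>ball c r. g y \<partial>\<nu>)" by blast
  show "t < maximal \<nu> g x"
  proof (rule ccontr)
    assume "\<not> ?thesis"
    then have "maximal \<nu> g x * emeasure \<nu> (ball c r) \<le> t * emeasure \<nu> (ball c r)"
      by (intro mult_right_mono) auto
    with average_le_maximal[OF r(1)] r(2) show False
      by (meson leD order_trans)
  qed
qed

lemma open_maximal: "open {x. t < maximal \<nu> g x}"
proof -
  have "{x. t < maximal \<nu> g x} =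
     \<Union>{ball c r |c r. r > 0 \<and> t * emeasure \<nu> (ball c r) < (\<integral>\<^sup>+y\<in>ball c r. g y \<partial>\<nu>)}"
    unfolding less_maximal_iff by blast
  then show ?thesis by (auto intro!: open_Union)
qed

lemma maximal_measurable[measurable]: "maximal \<nu> g \<in> borel_measurable borel"
  by (rule borel_measurableI_greater) (simp add: open_maximal)

lemma maximal_mono: "(\<And>y. g y \<le> h y) \<Longrightarrow> maximal \<nu> g x \<le> maximal \<nu> h x"
  unfolding maximal_def
  by (intro SUP_mono') (auto intro!: divide_right_mono_ennreal nn_integral_mono mult_right_mono)

lemma maximal_le_bound:
  assumes "\<And>y. g y \<le> m" shows "maximal \<nu> g x \<le> m"
proof (rule maximal_leI)
  fix c r
  have "(\<integral>\<^sup>+y\<in>ball c r. g y \<partial>\<nu>) \<le> (\<integral>\<^sup>+y\<in>ball c r. m \<partial>\<nu>)"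
    by (intro nn_integral_mono mult_right_mono assms) auto
  then show "(\<integral>\<^sup>+y\<in>ball c r. g y \<partial>\<nu>) \<le> m * emeasure \<nu> (ball c r)"
    by (simp add: nn_integral_cmult_indicator)
qed

text \<open>
  Where the maximal function exceeds \<open>t\<close>, every point lies in a ball on which the average of \<open>g\<close> exceeds
  \<open>t\<close>. Among the balls of radius at most \<open>R\<close>, Vitali's covering lemma selects disjoint ones whose fivefold
  dilates still cover; doubling compares the dilates with the balls, and disjointness sums the integrals to
  at most that of \<open>g\<close>. The bound does not depend on \<open>R\<close>.
\<close>
lemma maximal_weak_type:
  assumes g: "g \<in> borel_measurable \<nu>"
  shows "t * emeasure \<nu> {x. t < maximal \<nu> g x} \<le> ennreal D * (\<integral>\<^sup>+x. g x \<partial>\<nu>)"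
proof -
  define K where "K R = {p :: (real^'n) \<times> real. 0 < snd p \<and> snd p \<le> R \<and>
       t * emeasure \<nu> (ball (fst p) (snd p)) < (\<integral>\<^sup>+y\<in>ball (fst p) (snd p). g y \<partial>\<nu>)}" for R
  define S where "S R = (\<Union>p\<in>K (real R). ball (fst p) (snd p))" for R
  have open_S: "open (S R)" for R unfolding S_def by auto
  have inc: "incseq S"
    unfolding S_def K_def incseq_def by (auto intro!: UN_mono)
  have Un: "{x. t < maximal \<nu> g x} = (\<Union>R. S R)"
  proof (intro set_eqI iffI)
    fix x assume "x \<in> {x. t < maximal \<nu> g x}"
    then obtain c r where r: "r > 0" "x \<in> ball c r" "t * emeasure \<nu> (ball c r) < (\<integral>\<^sup>+y\<in>ball c r. g y \<partial>\<nu>)"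
      by (auto simp: less_maximal_iff)
    obtain R :: nat where "r \<le> real R" using real_arch_simple by blast
    then have "(c, r) \<in> K (real R)" using r by (auto simp: K_def)
    then show "x \<in> (\<Union>R. S R)"
      using r by (auto simp: S_def intro!: exI[of _ R] bexI[of _ "(c, r)"])
  qed (fastforce simp: less_maximal_iff S_def K_def)
  have bound: "t * emeasure \<nu> (S R) \<le> ennreal D * (\<integral>\<^sup>+x. g x \<partial>\<nu>)" for R
  proof -
    obtain C where C: "countable C" "C \<subseteq> K (real R)"
      and disj: "pairwise (\<lambda>i j. disjnt (ball (fst i) (snd i)) (ball (fst j) (snd j))) C"
      and cov: "S R \<subseteq> (\<Union>i\<in>C. ball (fst i) (5 * snd i))"
      by (rule Vitali_covering_lemma_balls[where S="S R" and K="K (real R)" and a=fst and r=snd and B="real R"]) (auto simp: S_def K_def)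
    have df: "disjoint_family_on (\<lambda>i. ball (fst i) (snd i)) C"
      using disj by (auto simp: disjoint_family_on_def pairwise_def disjnt_def)
    have "t * emeasure \<nu> (S R) \<le> t * emeasure \<nu> (\<Union>i\<in>C. ball (fst i) (5 * snd i))"
      using cov C by (intro mult_left_mono emeasure_mono) auto
    also have "\<dots> \<le> t * (\<integral>\<^sup>+i. emeasure \<nu> (ball (fst i) (5 * snd i)) \<partial>count_space C)"
      using C by (intro mult_left_mono emeasure_UN_le_count_space) auto
    also have "\<dots> = (\<integral>\<^sup>+i. t * emeasure \<nu> (ball (fst i) (5 * snd i)) \<partial>count_space C)"
      by (simp add: nn_integral_cmult)
    also have "\<dots> \<le> (\<integral>\<^sup>+i. ennreal D * (\<integral>\<^sup>+y\<in>ball (fst i) (snd i). g y \<partial>\<nu>) \<partial>count_space C)"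
    proof (intro nn_integral_mono)
      fix i assume "i \<in> space (count_space C)"
      then have i: "0 < snd i" "t * emeasure \<nu> (ball (fst i) (snd i)) \<le> (\<integral>\<^sup>+y\<in>ball (fst i) (snd i). g y \<partial>\<nu>)"
        using C(2) by (auto simp: K_def less_imp_le)
      have "t * emeasure \<nu> (ball (fst i) (5 * snd i)) \<le> t * (ennreal D * emeasure \<nu> (ball (fst i) (snd i)))"
        by (intro mult_left_mono doubling i) auto
      also have "\<dots> = ennreal D * (t * emeasure \<nu> (ball (fst i) (snd i)))" by (simp add: ac_simps)
      also have "\<dots> \<le> ennreal D * (\<integral>\<^sup>+y\<in>ball (fst i) (snd i). g y \<partial>\<nu>)"
        by (intro mult_left_mono i) auto
      finally show "t * emeasure \<nu> (ball (fst i) (5 * snd i)) \<le> ennreal D * (\<integral>\<^sup>+y\<in>ball (fst i) (snd i). g y \<partial>\<nu>)" .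
    qed
    also have "\<dots> = ennreal D * (\<integral>\<^sup>+i. (\<integral>\<^sup>+y\<in>ball (fst i) (snd i). g y \<partial>\<nu>) \<partial>count_space C)"
      by (simp add: nn_integral_cmult)
    also have "\<dots> = ennreal D * (\<integral>\<^sup>+y\<in>(\<Union>i\<in>C. ball (fst i) (snd i)). g y \<partial>\<nu>)"
      using g C df by (subst nn_integral_UN_disjoint) auto
    also have "\<dots> \<le> ennreal D * (\<integral>\<^sup>+x. g x \<partial>\<nu>)"
      by (intro mult_left_mono nn_integral_mono) (auto simp: indicator_def)
    finally show ?thesis .
  qed
  have "emeasure \<nu> {x. t < maximal \<nu> g x} = (SUP R. emeasure \<nu> (S R))"
    unfolding Un using inc open_S by (intro SUP_emeasure_incseq[symmetric]) auto
  then show ?thesis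
    using bound by (simp add: SUP_mult_left_ennreal SUP_least)
qed

text \<open>
  The part of \<open>g\<close> below \<open>t\<close> contributes at most \<open>t\<close> to every average, so the weak-type estimate need only
  be paid for the part above \<open>t\<close>. This form gives the strong type by integration over \<open>t\<close>.
\<close>

lemma maximal_weak_type_truncated:
  assumes g: "g \<in> borel_measurable \<nu>"
  shows "t * emeasure \<nu> {x. 2 * t < maximal \<nu> g x} \<le> ennreal D * (\<integral>\<^sup>+x\<in>{x. t < g x}. g x \<partial>\<nu>)"
proof -
  have [measurable]: "g \<in> borel_measurable lebesgue" using g sets_eq measurable_cong_sets by blast
  let ?h = "\<lambda>x. g x * indicator {x. t < g x} x"
  have [measurable]: "?h \<in> borel_measurable \<nu>"
    using g by measurable
  have "maximal \<nu> g x \<le> t + maximal \<nu> ?h x" for x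
  proof (rule maximal_leI)
    fix c r assume r: "r > 0" "x \<in> ball c r"
    have "(\<integral>\<^sup>+y\<in>ball c r. g y \<partial>\<nu>) \<le> (\<integral>\<^sup>+y. t * indicator (ball c r) y + ?h y * indicator (ball c r) y \<partial>\<nu>)"
      by (intro nn_integral_mono) (auto simp: indicator_def)
    also have "\<dots> = t * emeasure \<nu> (ball c r) + (\<integral>\<^sup>+y\<in>ball c r. ?h y \<partial>\<nu>)"
      using g by (subst nn_integral_add) (auto simp: nn_integral_cmult_indicator)
    also have "\<dots> \<le> t * emeasure \<nu> (ball c r) + maximal \<nu> ?h x * emeasure \<nu> (ball c r)"
      by (intro add_mono average_le_maximal r) auto
    finally show "(\<integral>\<^sup>+y\<in>ball c r. g y \<partial>\<nu>) \<le> (t + maximal \<nu> ?h x) * emeasure \<nu> (ball c r)"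
      by (simp add: distrib_right)
  qed
  then have "2 * t < maximal \<nu> g x \<Longrightarrow> t < maximal \<nu> ?h x" for x
    by (metis add_left_mono leD leI mult_2 order_trans)
  then have "t * emeasure \<nu> {x. 2 * t < maximal \<nu> g x} \<le> t * emeasure \<nu> {x. t < maximal \<nu> ?h x}"
    by (intro mult_left_mono emeasure_mono) (auto intro: open_sets open_maximal)
  also have "\<dots> \<le> ennreal D * (\<integral>\<^sup>+x. ?h x \<partial>\<nu>)" by (rule maximal_weak_type) simp
  finally show ?thesis .
qed

end

section \<open>Interpolation between weak-type estimates\<close>
lemma powr_eq_nn_integral:
  assumes p: "p > 0" and v: "v \<ge> 0"
  shows "ennreal (v powr p) = (\<integral>\<^sup>+\<tau>. ennreal (p * \<tau> powr (p - 1)) * indicator {0<..<v} \<tau> \<partial>lborel)"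
proof -
  have "((\<lambda>x. p * x powr (p - 1)) has_integral (p * (v powr (p - 1 + 1) / (p - 1 + 1)))) {0..v}"
    using p v by (intro has_integral_mult_right has_integral_powr_from_0) auto
  then have "((\<lambda>x. p * x powr (p - 1)) has_integral v powr p) {0..v}" using p by simp
  then have "((\<lambda>x. p * x powr (p - 1)) has_integral v powr p) {0<..<v}"
    by (simp add: has_integral_Icc_iff_Ioo)
  from nn_integral_has_integral_lebesgue[OF _ this]
  have "(\<integral>\<^sup>+\<tau>. ennreal (indicator {0<..<v} \<tau> * (p * \<tau> powr (p - 1))) \<partial>lborel) = v powr p"
    using p by auto
  then show ?thesis
    by (rule trans[OF sym]) (auto intro!: nn_integral_cong split: split_indicator)
qed

lemma powr_tail_eq_nn_integral:
  assumes p: "p < 2" "0 < p" and v: "v > 0"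
  shows "(\<integral>\<^sup>+\<tau>. ennreal (p * \<tau> powr (p - 3)) * indicator {v..} \<tau> \<partial>lborel) = ennreal (p / (2 - p) * v powr (p - 2))"
proof -
  have "((\<lambda>x. p * x powr (p - 3)) has_integral (p * (- (v powr (p - 3 + 1)) / (p - 3 + 1)))) {v..}"
    using p v by (intro has_integral_mult_right has_integral_powr_to_inf) auto
  moreover have "p * (- (v powr (p - 3 + 1)) / (p - 3 + 1)) = p / (2 - p) * v powr (p - 2)"
    using p by (simp add: field_simps)
  ultimately have "((\<lambda>x. p * x powr (p - 3)) has_integral p / (2 - p) * v powr (p - 2)) {v..}" by simp
  from nn_integral_has_integral_lebesgue[OF _ this]
  have "(\<integral>\<^sup>+\<tau>. ennreal (indicator {v..} \<tau> * (p * \<tau> powr (p - 3))) \<partial>lborel) = p / (2 - p) * v powr (p - 2)"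
    using p by auto
  then show ?thesis
    by (rule trans[rotated]) (auto intro!: nn_integral_cong split: split_indicator)
qed

lemma layer_cake:
  assumes "sigma_finite_measure M" and V[measurable]: "V \<in> borel_measurable M" "\<And>x. V x \<ge> 0" and p: "p > 0"
  shows "(\<integral>\<^sup>+x. ennreal (V x powr p) \<partial>M) =
    (\<integral>\<^sup>+\<tau>\<in>{0<..}. ennreal (p * \<tau> powr (p - 1)) * emeasure M {x\<in>space M. V x > \<tau>} \<partial>lborel)"
proof -
  interpret sigma_finite_measure M by fact
  interpret pair_sigma_finite M lborel ..
  have "(\<integral>\<^sup>+x. ennreal (V x powr p) \<partial>M) =
      (\<integral>\<^sup>+x. (\<integral>\<^sup>+\<tau>. ennreal (p * \<tau> powr (p - 1)) * indicator {0<..} \<tau> * indicator {x\<in>space M. V x > \<tau>} x \<partial>lborel) \<partial>M)"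
    using V(2) p
    by (intro nn_integral_cong) (auto simp: powr_eq_nn_integral intro!: nn_integral_cong split: split_indicator)
  also have "\<dots> = (\<integral>\<^sup>+\<tau>. (\<integral>\<^sup>+x. ennreal (p * \<tau> powr (p - 1)) * indicator {0<..} \<tau> * indicator {x\<in>space M. V x > \<tau>} x \<partial>M) \<partial>lborel)"
    by (intro Fubini'[symmetric]) simp
  also have "\<dots> = (\<integral>\<^sup>+\<tau>\<in>{0<..}. ennreal (p * \<tau> powr (p - 1)) * emeasure M {x\<in>space M. V x > \<tau>} \<partial>lborel)"
    by (intro nn_integral_cong, subst nn_integral_cmult_indicator) (measurable, simp add: ac_simps)
  finally show ?thesis .
qed

lemma layer_integral_above:
  assumes "sigma_finite_measure M" and g[measurable]: "g \<in> borel_measurable M" "\<And>x. g x \<ge> 0"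
    and p: "p > 1" and a: "a > 0"
  shows "(\<integral>\<^sup>+\<tau>\<in>{0<..}. ennreal (p * \<tau> powr (p - 2)) * (\<integral>\<^sup>+x\<in>{x\<in>space M. g x > a * \<tau>}. ennreal (g x) \<partial>M) \<partial>lborel)
     = ennreal (p / (p - 1) * (1 / a) powr (p - 1)) * (\<integral>\<^sup>+x. ennreal (g x powr p) \<partial>M)"
proof -
  interpret sigma_finite_measure M by fact
  interpret pair_sigma_finite M lborel ..
  have "(\<integral>\<^sup>+\<tau>\<in>{0<..}. ennreal (p * \<tau> powr (p - 2)) * (\<integral>\<^sup>+x\<in>{x\<in>space M. g x > a * \<tau>}. ennreal (g x) \<partial>M) \<partial>lborel)
     = (\<integral>\<^sup>+\<tau>. (\<integral>\<^sup>+x. ennreal (p * \<tau> powr (p - 2)) * indicator {0<..} \<tau> * (ennreal (g x) * indicator {x\<in>space M. g x > a * \<tau>} x) \<partial>M) \<partial>lborel)"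
    by (intro nn_integral_cong, subst nn_integral_cmult) (auto simp: ac_simps)
  also have "\<dots> = (\<integral>\<^sup>+x. (\<integral>\<^sup>+\<tau>. ennreal (p * \<tau> powr (p - 2)) * indicator {0<..} \<tau> * (ennreal (g x) * indicator {x\<in>space M. g x > a * \<tau>} x) \<partial>lborel) \<partial>M)"
    by (intro Fubini') simp
  also have "\<dots> = (\<integral>\<^sup>+x. ennreal (p / (p - 1) * (1 / a) powr (p - 1)) * ennreal (g x powr p) \<partial>M)"
  proof (intro nn_integral_cong)
    fix x assume x: "x \<in> space M"
    have "(\<integral>\<^sup>+\<tau>. ennreal (p * \<tau> powr (p - 2)) * indicator {0<..} \<tau> * (ennreal (g x) * indicator {x\<in>space M. g x > a * \<tau>} x) \<partial>lborel)
      = (\<integral>\<^sup>+\<tau>. ennreal (g x * p / (p - 1)) * (ennreal ((p - 1) * \<tau> powr ((p - 1) - 1)) * indicator {0<..<g x / a} \<tau>) \<partial>lborel)"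
    proof (intro nn_integral_cong)
      fix \<tau> :: real
      have "p * \<tau> powr (p - 2) * g x = g x * p / (p - 1) * ((p - 1) * \<tau> powr ((p - 1) - 1))"
        using p by simp
      moreover have "a * \<tau> < g x \<longleftrightarrow> \<tau> < g x / a" using a by (simp add: field_simps)
      ultimately show "ennreal (p * \<tau> powr (p - 2)) * indicator {0<..} \<tau> * (ennreal (g x) * indicator {x\<in>space M. g x > a * \<tau>} x) =
         ennreal (g x * p / (p - 1)) * (ennreal ((p - 1) * \<tau> powr ((p - 1) - 1)) * indicator {0<..<g x / a} \<tau>)"
        using x p g(2)[of x] by (simp add: ennreal_mult[symmetric] indicator_def)
    qed
    also have "\<dots> = ennreal (g x * p / (p - 1)) * ennreal ((g x / a) powr (p - 1))"
      using p a g(2)[of x] by (subst nn_integral_cmult, simp) (subst powr_eq_nn_integral[of "p - 1"], auto)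
    also have "\<dots> = ennreal (p / (p - 1) * (1 / a) powr (p - 1)) * ennreal (g x powr p)"
    proof -
      have "g x * (g x / a) powr (p - 1) = (1 / a) powr (p - 1) * g x powr p"
        using g(2)[of x] a p powr_add[of "g x" 1 "p - 1"] by (simp add: powr_divide)
      then have "g x * p / (p - 1) * (g x / a) powr (p - 1) = p / (p - 1) * (1 / a) powr (p - 1) * g x powr p"
        by (simp add: field_simps)
      then show ?thesis using p g(2)[of x] by (simp add: ennreal_mult[symmetric])
    qed
    finally show "(\<integral>\<^sup>+\<tau>. ennreal (p * \<tau> powr (p - 2)) * indicator {0<..} \<tau> * (ennreal (g x) * indicator {x\<in>space M. g x > a * \<tau>} x) \<partial>lborel)
      = ennreal (p / (p - 1) * (1 / a) powr (p - 1)) * ennreal (g x powr p)" .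
  qed
  also have "\<dots> = ennreal (p / (p - 1) * (1 / a) powr (p - 1)) * (\<integral>\<^sup>+x. ennreal (g x powr p) \<partial>M)"
    by (subst nn_integral_cmult) auto
  finally show ?thesis .
qed

lemma layer_integral_below:
  assumes "sigma_finite_measure M" and g[measurable]: "g \<in> borel_measurable M" "\<And>x. g x \<ge> 0"
    and p: "0 < p" "p < 2"
  shows "(\<integral>\<^sup>+\<tau>\<in>{0<..}. ennreal (p * \<tau> powr (p - 3)) * (\<integral>\<^sup>+x\<in>{x\<in>space M. g x \<le> \<tau>}. ennreal ((g x)\<^sup>2) \<partial>M) \<partial>lborel)
     = ennreal (p / (2 - p)) * (\<integral>\<^sup>+x. ennreal (g x powr p) \<partial>M)"
proof -
  interpret sigma_finite_measure M by fact
  interpret pair_sigma_finite M lborel ..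
  have "(\<integral>\<^sup>+\<tau>\<in>{0<..}. ennreal (p * \<tau> powr (p - 3)) * (\<integral>\<^sup>+x\<in>{x\<in>space M. g x \<le> \<tau>}. ennreal ((g x)\<^sup>2) \<partial>M) \<partial>lborel)
     = (\<integral>\<^sup>+\<tau>. (\<integral>\<^sup>+x. ennreal (p * \<tau> powr (p - 3)) * indicator {0<..} \<tau> * (ennreal ((g x)\<^sup>2) * indicator {x\<in>space M. g x \<le> \<tau>} x) \<partial>M) \<partial>lborel)"
    by (intro nn_integral_cong, subst nn_integral_cmult) (auto simp: ac_simps)
  also have "\<dots> = (\<integral>\<^sup>+x. (\<integral>\<^sup>+\<tau>. ennreal (p * \<tau> powr (p - 3)) * indicator {0<..} \<tau> * (ennreal ((g x)\<^sup>2) * indicator {x\<in>space M. g x \<le> \<tau>} x) \<partial>lborel) \<partial>M)"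
    by (intro Fubini') simp
  also have "\<dots> = (\<integral>\<^sup>+x. ennreal (p / (2 - p)) * ennreal (g x powr p) \<partial>M)"
  proof (intro nn_integral_cong)
    fix x assume x: "x \<in> space M"
    show "(\<integral>\<^sup>+\<tau>. ennreal (p * \<tau> powr (p - 3)) * indicator {0<..} \<tau> * (ennreal ((g x)\<^sup>2) * indicator {x\<in>space M. g x \<le> \<tau>} x) \<partial>lborel)
      = ennreal (p / (2 - p)) * ennreal (g x powr p)"
    proof (cases "g x = 0")
      case True
      then show ?thesis using p by simp
    next
      case False
      then have gx: "g x > 0" using g(2)[of x] by simp
      have "(\<integral>\<^sup>+\<tau>. ennreal (p * \<tau> powr (p - 3)) * indicator {0<..} \<tau> * (ennreal ((g x)\<^sup>2) * indicator {x\<in>space M. g x \<le> \<tau>} x) \<partial>lborel)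
        = (\<integral>\<^sup>+\<tau>. ennreal ((g x)\<^sup>2) * (ennreal (p * \<tau> powr (p - 3)) * indicator {g x..} \<tau>) \<partial>lborel)"
        using x gx by (intro nn_integral_cong) (auto simp: ac_simps split: split_indicator)
      also have "\<dots> = ennreal ((g x)\<^sup>2) * ennreal (p / (2 - p) * g x powr (p - 2))"
        using p gx by (subst nn_integral_cmult, simp) (simp add: powr_tail_eq_nn_integral)
      also have "\<dots> = ennreal (p / (2 - p)) * ennreal (g x powr p)"
      proof -
        have "(g x)\<^sup>2 * g x powr (p - 2) = g x powr p"
          using gx powr_add[of "g x" 2 "p - 2"] by (simp add: powr_numeral)
        then have "(g x)\<^sup>2 * (p / (2 - p) * g x powr (p - 2)) = p / (2 - p) * g x powr p"
          by (simp add: mult.left_commute)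
        then show ?thesis using p by (simp add: ennreal_mult[symmetric])
      qed
      finally show ?thesis .
    qed
  qed
  also have "\<dots> = ennreal (p / (2 - p)) * (\<integral>\<^sup>+x. ennreal (g x powr p) \<partial>M)"
    by (subst nn_integral_cmult) auto
  finally show ?thesis .
qed

text \<open>
  Marcinkiewicz interpolation between weak type \<open>(1, 1)\<close>, applied to the part of \<open>g\<close> above a multiple of
  \<open>\<tau>\<close>, and weak type \<open>(2, 2)\<close>, applied to the part below \<open>\<tau>\<close>. The hypothesis is what remains of the two
  estimates after the splitting. Integrating it against \<open>p * \<tau> powr (p - 1)\<close> and exchanging the integrals
  leaves, for each \<open>x\<close>, a power integral that converges at \<open>0\<close> because \<open>p > 1\<close> and at infinity because
  \<open>p < 2\<close>. For a maximal function the second term is absent (\<open>B = 0\<close>), and every \<open>p > 1\<close> is allowed.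
\<close>
lemma marcinkiewicz_1_2:
  assumes sf: "sigma_finite_measure M" and V: "V \<in> borel_measurable M" "\<And>x. V x \<ge> 0"
    and g: "g \<in> borel_measurable M" "\<And>x. g x \<ge> 0"
    and p: "1 < p" "B = 0 \<or> p < 2" and a: "a > 0" and AB: "A \<ge> 0" "B \<ge> 0"
    and weak: "\<And>\<tau>. \<tau> > 0 \<Longrightarrow> emeasure M {x\<in>space M. V x > \<tau>} \<le>
       ennreal (A / \<tau>) * (\<integral>\<^sup>+x\<in>{x\<in>space M. g x > a * \<tau>}. ennreal (g x) \<partial>M) +
       ennreal (B / \<tau>\<^sup>2) * (\<integral>\<^sup>+x\<in>{x\<in>space M. g x \<le> \<tau>}. ennreal ((g x)\<^sup>2) \<partial>M)"
  shows "(\<integral>\<^sup>+x. ennreal (V x powr p) \<partial>M) \<le>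
     ennreal (A * (p / (p - 1) * (1 / a) powr (p - 1)) + B * \<bar>p / (2 - p)\<bar>) * (\<integral>\<^sup>+x. ennreal (g x powr p) \<partial>M)"
proof -
  interpret sigma_finite_measure M by fact
  interpret pair_sigma_finite lborel M ..
  note [measurable] = V(1) g(1)
  let ?I = "\<lambda>\<tau>. (\<integral>\<^sup>+x\<in>{x\<in>space M. g x > a * \<tau>}. ennreal (g x) \<partial>M)"
  let ?J = "\<lambda>\<tau>. (\<integral>\<^sup>+x\<in>{x\<in>space M. g x \<le> \<tau>}. ennreal ((g x)\<^sup>2) \<partial>M)"
  have [measurable]: "?I \<in> borel_measurable lborel" "?J \<in> borel_measurable lborel" by measurable
  have "(\<integral>\<^sup>+x. ennreal (V x powr p) \<partial>M) =
    (\<integral>\<^sup>+\<tau>\<in>{0<..}. ennreal (p * \<tau> powr (p - 1)) * emeasure M {x\<in>space M. V x > \<tau>} \<partial>lborel)"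
    using p by (intro layer_cake sf V) auto
  also have "\<dots> \<le> (\<integral>\<^sup>+\<tau>. ennreal A * (ennreal (p * \<tau> powr (p - 2)) * ?I \<tau> * indicator {0<..} \<tau>) +
      ennreal B * (ennreal (p * \<tau> powr (p - 3)) * ?J \<tau> * indicator {0<..} \<tau>) \<partial>lborel)"
  proof (intro nn_integral_mono)
    fix \<tau> :: real
    show "ennreal (p * \<tau> powr (p - 1)) * emeasure M {x\<in>space M. V x > \<tau>} * indicator {0<..} \<tau> \<le>
      ennreal A * (ennreal (p * \<tau> powr (p - 2)) * ?I \<tau> * indicator {0<..} \<tau>) +
      ennreal B * (ennreal (p * \<tau> powr (p - 3)) * ?J \<tau> * indicator {0<..} \<tau>)"
    proof (cases "\<tau> > 0")
      case True
      have e1: "ennreal (p * \<tau> powr (p - 1)) * ennreal (A / \<tau>) = ennreal A * ennreal (p * \<tau> powr (p - 2))"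
        using True p AB powr_add[of \<tau> "p - 2" 1] by (simp add: ennreal_mult[symmetric])
      have e2: "ennreal (p * \<tau> powr (p - 1)) * ennreal (B / \<tau>\<^sup>2) = ennreal B * ennreal (p * \<tau> powr (p - 3))"
        using True p AB powr_add[of \<tau> "p - 3" 2] by (simp add: ennreal_mult[symmetric] powr_numeral)
      have "ennreal (p * \<tau> powr (p - 1)) * emeasure M {x\<in>space M. V x > \<tau>} \<le>
        ennreal (p * \<tau> powr (p - 1)) * (ennreal (A / \<tau>) * ?I \<tau> + ennreal (B / \<tau>\<^sup>2) * ?J \<tau>)"
        by (intro mult_left_mono weak True) auto
      also have "\<dots> = ennreal A * (ennreal (p * \<tau> powr (p - 2)) * ?I \<tau>) + ennreal B * (ennreal (p * \<tau> powr (p - 3)) * ?J \<tau>)"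
        by (simp add: distrib_left mult.assoc[symmetric] e1 e2)
      finally show ?thesis using True by simp
    qed simp
  qed
  also have "\<dots> = ennreal A * (\<integral>\<^sup>+\<tau>. (ennreal (p * \<tau> powr (p - 2)) * ?I \<tau> * indicator {0<..} \<tau>) \<partial>lborel) +
      ennreal B * (\<integral>\<^sup>+\<tau>. (ennreal (p * \<tau> powr (p - 3)) * ?J \<tau> * indicator {0<..} \<tau>) \<partial>lborel)"
    by (simp add: nn_integral_add nn_integral_cmult)
  also have "\<dots> = ennreal A * (ennreal (p / (p - 1) * (1 / a) powr (p - 1)) * (\<integral>\<^sup>+x. ennreal (g x powr p) \<partial>M)) +
      ennreal B * (ennreal \<bar>p / (2 - p)\<bar> * (\<integral>\<^sup>+x. ennreal (g x powr p) \<partial>M))"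
  proof (intro arg_cong2[where f="(+)"])
    show "ennreal A * (\<integral>\<^sup>+\<tau>. (ennreal (p * \<tau> powr (p - 2)) * ?I \<tau> * indicator {0<..} \<tau>) \<partial>lborel) =
       ennreal A * (ennreal (p / (p - 1) * (1 / a) powr (p - 1)) * (\<integral>\<^sup>+x. ennreal (g x powr p) \<partial>M))"
      using layer_integral_above[OF sf g p(1) a] by simp
    show "ennreal B * (\<integral>\<^sup>+\<tau>. (ennreal (p * \<tau> powr (p - 3)) * ?J \<tau> * indicator {0<..} \<tau>) \<partial>lborel) =
       ennreal B * (ennreal \<bar>p / (2 - p)\<bar> * (\<integral>\<^sup>+x. ennreal (g x powr p) \<partial>M))"
    proof (cases "B = 0")
      case False
      then show ?thesis using p layer_integral_below[OF sf g, of p] by simp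
    qed simp
  qed
  also have "\<dots> = ennreal (A * (p / (p - 1) * (1 / a) powr (p - 1)) + B * \<bar>p / (2 - p)\<bar>) * (\<integral>\<^sup>+x. ennreal (g x powr p) \<partial>M)"
  proof -
    have "ennreal (A * X + B * Y) = ennreal A * ennreal X + ennreal B * ennreal Y" if "X \<ge> 0" "Y \<ge> 0" for X Y
      using AB that by (simp add: ennreal_plus ennreal_mult)
    from this[of "p / (p - 1) * (1 / a) powr (p - 1)" "\<bar>p / (2 - p)\<bar>"] show ?thesis
      using p(1) by (simp add: distrib_right mult.assoc[symmetric])
  qed
  finally show ?thesis .
qed

context doubling_measure
begin

definition strong_type_constant :: "real \<Rightarrow> real" where
  "strong_type_constant p = 2 * \<bar>D\<bar> * (p / (p - 1) * 2 powr (p - 1))"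

lemma strong_type_constant_nonneg: "p > 1 \<Longrightarrow> strong_type_constant p \<ge> 0"
  by (simp add: strong_type_constant_def)

text \<open>
  Stated for a real function \<open>V\<close> below the maximal function, since the latter can be infinite on a null
  set.
\<close>
lemma maximal_strong_type:
  fixes V g :: "real ^ 'n \<Rightarrow> real"
  assumes p: "p > 1" and V: "V \<in> borel_measurable \<nu>" "\<And>x. V x \<ge> 0"
    and g: "g \<in> borel_measurable \<nu>" "\<And>x. g x \<ge> 0"
    and le: "\<And>x. ennreal (V x) \<le> maximal \<nu> (\<lambda>x. ennreal (g x)) x"
  shows "(\<integral>\<^sup>+x. ennreal (V x powr p) \<partial>\<nu>) \<le> ennreal (strong_type_constant p) * (\<integral>\<^sup>+x. ennreal (g x powr p) \<partial>\<nu>)"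
proof -
  let ?A = "2 * \<bar>D\<bar>"
  have "(\<integral>\<^sup>+x. ennreal (V x powr p) \<partial>\<nu>) \<le>
    ennreal (?A * (p / (p - 1) * (1 / (1/2)) powr (p - 1)) + 0 * \<bar>p / (2 - p)\<bar>) * (\<integral>\<^sup>+x. ennreal (g x powr p) \<partial>\<nu>)"
  proof (intro marcinkiewicz_1_2 sigma_finite V g p)
    fix \<tau> :: real assume \<tau>: "\<tau> > 0"
    have "2 * ennreal (\<tau> / 2) = ennreal \<tau>" using \<tau> ennreal_mult[of 2 "\<tau> / 2"] by simp
    then have "{x. V x > \<tau>} \<subseteq> {x. 2 * ennreal (\<tau> / 2) < maximal \<nu> (\<lambda>x. ennreal (g x)) x}"
      using le \<tau> by (auto intro: order.strict_trans2[of "ennreal \<tau>" "ennreal (V _)"] simp: ennreal_less_iff)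
    then have "ennreal (\<tau> / 2) * emeasure \<nu> {x. V x > \<tau>}
       \<le> ennreal (\<tau> / 2) * emeasure \<nu> {x. 2 * ennreal (\<tau> / 2) < maximal \<nu> (\<lambda>x. ennreal (g x)) x}"
      by (intro mult_left_mono emeasure_mono open_sets open_maximal) auto
    also have "\<dots> \<le> ennreal D * (\<integral>\<^sup>+x\<in>{x. ennreal (\<tau> / 2) < ennreal (g x)}. ennreal (g x) \<partial>\<nu>)"
      using g by (intro maximal_weak_type_truncated) auto
    also have "\<dots> \<le> ennreal \<bar>D\<bar> * (\<integral>\<^sup>+x\<in>{x\<in>space \<nu>. g x > 1/2 * \<tau>}. ennreal (g x) \<partial>\<nu>)"
      using \<tau> by (intro mult_mono nn_integral_mono ennreal_leI) (auto simp: ennreal_less_iff indicator_def)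
    finally have "ennreal (2 / \<tau>) * (ennreal (\<tau> / 2) * emeasure \<nu> {x. V x > \<tau>}) \<le>
        ennreal (2 / \<tau>) * (ennreal \<bar>D\<bar> * (\<integral>\<^sup>+x\<in>{x\<in>space \<nu>. g x > 1/2 * \<tau>}. ennreal (g x) \<partial>\<nu>))"
      by (rule mult_left_mono) simp
    then show "emeasure \<nu> {x\<in>space \<nu>. V x > \<tau>} \<le>
       ennreal (?A / \<tau>) * (\<integral>\<^sup>+x\<in>{x\<in>space \<nu>. g x > 1/2 * \<tau>}. ennreal (g x) \<partial>\<nu>) +
       ennreal (0 / \<tau>\<^sup>2) * (\<integral>\<^sup>+x\<in>{x\<in>space \<nu>. g x \<le> \<tau>}. ennreal ((g x)\<^sup>2) \<partial>\<nu>)"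
      using \<tau> by (simp add: mult.assoc[symmetric] ennreal_mult[symmetric])
  qed auto
  then show ?thesis by (simp add: strong_type_constant_def)
qed

end

lemma emeasure_lebesgue_ball:
  "r \<ge> 0 \<Longrightarrow> emeasure lebesgue (ball (c :: real ^ 'n) r) = ennreal (unit_ball_vol (CARD('n)) * r ^ CARD('n))"
  by (simp add: emeasure_ball)

lemma emeasure_lebesgue_ball_scale:
  assumes "s \<ge> 0" "r \<ge> 0"
  shows "emeasure lebesgue (ball (c :: real ^ 'n) (s * r)) = ennreal (s ^ CARD('n)) * emeasure lebesgue (ball (d :: real ^ 'n) r)"
proof -
  have "0 \<le> s * r" using assms by simp
  then show ?thesis
    using assms emeasure_lebesgue_ball[of "s * r" c] emeasure_lebesgue_ball[of r d]
    by (simp only: ennreal_mult[symmetric] power_mult_distrib ac_simps zero_le_power mult_nonneg_nonneg unit_ball_vol_nonneg)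
qed

lemma doubling_lebesgue: "doubling_measure (lebesgue :: (real ^ 'n) measure) (5 ^ CARD('n))"
proof
  show "0 < emeasure lebesgue (ball c r)" if "r > 0" for c :: "real ^ 'n" and r
    unfolding emeasure_lebesgue_ball[OF less_imp_le[OF that]] using that by simp
  show "emeasure lebesgue (ball c r) < \<infinity>" for c :: "real ^ 'n" and r
    using emeasure_lborel_ball_finite[of c r] by simp
  show "emeasure lebesgue (ball c (5 * r)) \<le> ennreal (5 ^ CARD('n)) * emeasure lebesgue (ball c r)" if "r > 0" for c :: "real ^ 'n" and r
    using that emeasure_lebesgue_ball_scale[of 5 r c c] by simp
qed simp

interpretation lebesgue: doubling_measure "lebesgue :: (real ^ 'n) measure" "5 ^ CARD('n)"
  by (rule doubling_lebesgue)

section \<open>Dyadic cells and the Whitney decomposition\<close>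

text \<open>
  The cells of generation \<open>k\<close> are half-open cubes of side \<open>2 * L / 2 ^ k\<close>, aligned so that the cube
  \<open>[- L, L) ^ n\<close> is the cell of generation \<open>0\<close> that contains the origin. The key is the integer vector that numbers
  the cell; passing to the parent halves it, which makes the nesting of cells plain arithmetic.
\<close>
definition key :: "real \<Rightarrow> nat \<Rightarrow> real ^ 'n \<Rightarrow> int ^ 'n" where
  "key L k x = (\<chi> i. \<lfloor>2 ^ k * (x $ i + L) / (2 * L)\<rfloor>)"

definition cell :: "real \<Rightarrow> nat \<Rightarrow> real ^ 'n \<Rightarrow> (real ^ 'n) set" where
  "cell L k x = {y. key L k y = key L k x}"

text \<open>
  The radius is \<open>m * n\<close> times the side of a cell of generation \<open>k - 1\<close>. Thus, for \<open>m = 1\<close>, the ball contains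
  both the cell of generation \<open>k\<close> around its centre and the parent of that cell, while its measure is comparable to
  that of the cell.
\<close>
definition cell_ball :: "real \<Rightarrow> real \<Rightarrow> nat \<Rightarrow> real ^ 'n \<Rightarrow> (real ^ 'n) set" where
  "cell_ball L m k x = ball x (m * (4 * real CARD('n) * L / 2 ^ k))"

lemma in_cell[simp]: "x \<in> cell L k x"
  by (simp add: cell_def)

lemma cell_eq: "y \<in> cell L k x \<Longrightarrow> cell L k y = cell L k x"
  by (simp add: cell_def)

lemma key_Suc: "key L k x $ i = key L (Suc k) x $ i div 2"
proof -
  have "\<lfloor>2 ^ k * (x $ i + L) / (2 * L)\<rfloor> = \<lfloor>(2 ^ Suc k * (x $ i + L) / (2 * L)) / of_int 2\<rfloor>"
    by (simp add: ac_simps)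
  also have "\<dots> = \<lfloor>2 ^ Suc k * (x $ i + L) / (2 * L)\<rfloor> div 2"
    by (rule floor_divide_real_eq_div) simp
  finally show ?thesis by (simp add: key_def)
qed

lemma cell_Suc_subset: "cell L (Suc k) x \<subseteq> cell L k x"
  by (auto simp: cell_def vec_eq_iff key_Suc[of L k])

lemma cell_mono: "j \<le> k \<Longrightarrow> cell L k x \<subseteq> cell L j x"
  by (induction k rule: dec_induct) (use cell_Suc_subset in blast)+

lemma cell_subset_cell:
  assumes "x \<in> cell L j z" "j \<le> k"
  shows "cell L k x \<subseteq> cell L j z"
  using cell_mono[OF assms(2), of L x] cell_eq[OF assms(1)] by simp

lemma cell_eq_box:
  assumes L: "L > 0"
  shows "cell L k x = {y. \<forall>i. key L k x $ i * (2 * L / 2 ^ k) - L \<le> y $ i \<and>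
      y $ i < key L k x $ i * (2 * L / 2 ^ k) - L + 2 * L / 2 ^ k}"
proof -
  have "\<lfloor>2 ^ k * (t + L) / (2 * L)\<rfloor> = m \<longleftrightarrow>
    of_int m * (2 * L / 2 ^ k) - L \<le> t \<and> t < of_int m * (2 * L / 2 ^ k) - L + 2 * L / 2 ^ k" for t :: real and m
    using L by (simp add: floor_eq_iff field_simps)
  then have "(key L k y $ i = key L k x $ i) \<longleftrightarrow> key L k x $ i * (2 * L / 2 ^ k) - L \<le> y $ i \<and>
      y $ i < key L k x $ i * (2 * L / 2 ^ k) - L + 2 * L / 2 ^ k" for y i
    by (simp add: key_def[of L k y])
  then show ?thesis
    unfolding cell_def vec_eq_iff by presburger
qed

lemma component_borel_measurable[measurable]: "(\<lambda>y :: real ^ 'n. y $ i) \<in> borel_measurable borel"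
  by (intro borel_measurable_continuous_onI continuous_intros)

lemma cell_borel:
  assumes L: "L > 0" shows "cell L k x \<in> sets borel"
  unfolding cell_eq_box[OF L] by measurable

lemma cell_lebesgue[measurable]: "L > 0 \<Longrightarrow> cell L k x \<in> sets lebesgue"
  by (simp add: sets_completionI_sets cell_borel)

lemma emeasure_cell:
  fixes x :: "real ^ 'n"
  assumes L: "L > 0"
  shows "emeasure lebesgue (cell L k x) = ennreal ((2 * L / 2 ^ k) ^ CARD('n))"
proof -
  define s where "s = 2 * L / 2 ^ k"
  define a :: "real ^ 'n" where "a = (\<chi> i. key L k x $ i * (2 * L / 2 ^ k) - L)"
  define b :: "real ^ 'n" where "b = (\<chi> i. a $ i + s)"
  have s: "s > 0" using L by (simp add: s_def)
  have eq: "cell L k x = {y. \<forall>i. a $ i \<le> y $ i \<and> y $ i < b $ i}"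
    by (simp add: cell_eq_box[OF L] a_def b_def s_def)
  have sub: "box a b \<subseteq> cell L k x" "cell L k x \<subseteq> cbox a b"
    by (auto simp: eq mem_box_cart less_imp_le)
  have ab: "(b - a) \<bullet> i = s" "a \<bullet> i \<le> b \<bullet> i" if "i \<in> Basis" for i
    using that s by (auto simp: Basis_vec_def b_def inner_axis)
  have "emeasure lborel (box a b) = ennreal (s ^ CARD('n))" "emeasure lborel (cbox a b) = ennreal (s ^ CARD('n))"
    using ab s by (simp_all add: emeasure_lborel_box_eq emeasure_lborel_cbox_eq)
  moreover have "emeasure lebesgue (box a b) \<le> emeasure lebesgue (cell L k x)"
     "emeasure lebesgue (cell L k x) \<le> emeasure lebesgue (cbox a b)"
    by (rule emeasure_mono[OF sub(1) cell_lebesgue[OF L]], rule emeasure_mono[OF sub(2)]) simp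
  ultimately show ?thesis by (simp add: s_def)
qed

lemma emeasure_cell_pos: "L > 0 \<Longrightarrow> 0 < emeasure lebesgue (cell L k x)"
  and emeasure_cell_finite: "L > 0 \<Longrightarrow> emeasure lebesgue (cell L k x) < \<infinity>"
  by (simp_all only: emeasure_cell) auto

lemma cell_subset_ball:
  fixes x :: "real ^ 'n"
  assumes L: "L > 0"
  shows "cell L k x \<subseteq> ball x (real CARD('n) * (2 * L / 2 ^ k))"
proof
  fix y assume y: "y \<in> cell L k x"
  have "\<bar>(x - y) $ i\<bar> < 2 * L / 2 ^ k" for i
    using y in_cell[of x L k] unfolding cell_eq_box[OF L]
    by (auto simp: abs_less_iff dest!: spec[of _ i])
  then have "(\<Sum>i\<in>UNIV. \<bar>(x - y) $ i\<bar>) < (\<Sum>i\<in>(UNIV :: 'n set). 2 * L / 2 ^ k)"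
    by (intro sum_strict_mono) auto
  then show "y \<in> ball x (real CARD('n) * (2 * L / 2 ^ k))"
    using norm_le_l1_cart[of "x - y"] by (simp add: dist_norm)
qed

lemma cell_subset_cell_ball: "L > 0 \<Longrightarrow> cell L k x \<subseteq> cell_ball L 1 k x"
  unfolding cell_ball_def by (rule order_trans[OF cell_subset_ball subset_ball]) (auto simp: field_simps)

lemma parent_subset_cell_ball: "L > 0 \<Longrightarrow> cell L k x \<subseteq> cell_ball L 1 (Suc k) x"
  using cell_subset_ball[of L k x] by (simp add: cell_ball_def field_simps)

lemma cell_ball_mono: "L > 0 \<Longrightarrow> m \<le> m' \<Longrightarrow> cell_ball L m k x \<subseteq> cell_ball L m' k x"
  unfolding cell_ball_def by (intro subset_ball mult_right_mono) auto

text \<open>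
  Radii at least halve from one generation to the next, so the eightfold balls of the descendants of a cell
  stay inside the eightfold ball of the cell: localizing first to the cell and then to a descendant is the same as
  localizing to the descendant.
\<close>
lemma child_cell_ball_subset:
  fixes x z :: "real ^ 'n"
  assumes L: "L > 0" and x: "x \<in> cell L j z" and jk: "j < k"
  shows "cell_ball L 8 k x \<subseteq> cell_ball L 8 j z"
proof -
  define r where "r k = 4 * real CARD('n) * L / 2 ^ k" for k
  have "r k \<le> r (Suc j)" using jk L unfolding r_def
    by (intro divide_left_mono power_increasing) auto
  then have "r k \<le> r j / 2" by (simp add: r_def)
  moreover have "dist x z < r j"
    using cell_subset_cell_ball[OF L, of j z] x by (auto simp: cell_ball_def r_def dist_commute)
  moreover have "r j > 0" using L by (simp add: r_def)
  ultimately have "dist x z + 8 * r k \<le> 8 * r j" by simp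
  then show ?thesis
    unfolding cell_ball_def r_def[symmetric] by (simp add: ball_subset_ball_iff)
qed

definition ball_cell_ratio :: "'n::finite itself \<Rightarrow> real" where
  "ball_cell_ratio _ = unit_ball_vol (CARD('n)) * (16 * real CARD('n)) ^ CARD('n)"

lemma ball_cell_ratio_nonneg[simp]: "ball_cell_ratio TYPE('n::finite) \<ge> 0"
  by (simp add: ball_cell_ratio_def)

lemma emeasure_cell_ball:
  fixes x :: "real ^ 'n"
  assumes L: "L > 0"
  shows "emeasure lebesgue (cell_ball L 8 k x) = ennreal (ball_cell_ratio TYPE('n)) * emeasure lebesgue (cell L k x)"
proof -
  define s where "s = 2 * L / 2 ^ k"
  have s: "8 * (4 * real CARD('n) * L / 2 ^ k) = (16 * real CARD('n)) * s" "s > 0"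
    using L by (simp_all add: s_def)
  have r: "0 \<le> (16 * real CARD('n)) * s" using s(2) by simp
  show ?thesis
    unfolding cell_ball_def s(1) emeasure_lebesgue_ball[OF r] emeasure_cell[OF L] ball_cell_ratio_def s_def[symmetric]
    using s(2) by (simp add: power_mult_distrib ennreal_mult[symmetric])
qed

text \<open>
  Every point of \<open>E\<close> has a first generation at which its cell lies in \<open>E\<close>. The cells chosen in this way
  are disjoint by minimality, and the parent of each contains a point outside \<open>E\<close>. If \<open>E\<close> is the set where some
  quantities are large, they are therefore controlled at a point near each chosen cell.
\<close>
lemma whitney:
  fixes E :: "(real ^ 'n) set"
  assumes L: "L > 0" and E: "open E" and nsub: "\<not> cell L j z \<subseteq> E"
  obtains J :: "(nat \<times> (real ^ 'n)) set" where "countable J"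
    "\<And>k x. (k, x) \<in> J \<Longrightarrow> j < k \<and> x \<in> cell L j z \<and> \<not> cell L (k - 1) x \<subseteq> E"
    "disjoint_family_on (\<lambda>(k, x). cell L k x) J"
    "(\<Union>(k, x)\<in>J. cell L k x) = E \<inter> cell L j z"
proof -
  let ?Q = "cell L j z"
  define \<kappa> where "\<kappa> x = (LEAST k. j \<le> k \<and> cell L k x \<subseteq> E)" for x
  have ex: "\<exists>k. j \<le> k \<and> cell L k x \<subseteq> E" if "x \<in> E" for x
  proof -
    obtain e where e: "e > 0" "ball x e \<subseteq> E" using E \<open>x \<in> E\<close> by (rule openE)
    obtain k where k: "2 * real CARD('n) * L / e < 2 ^ k" using real_arch_pow[of 2] by auto
    have "real CARD('n) * (2 * L / 2 ^ (max j k)) \<le> real CARD('n) * (2 * L / 2 ^ k)"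
      using L by (intro mult_left_mono divide_left_mono power_increasing) auto
    also have "\<dots> < e" using k e L by (simp add: field_simps)
    finally have "cell L (max j k) x \<subseteq> ball x e"
      using cell_subset_ball[OF L, of "max j k" x] subset_ball[of "real CARD('n) * (2 * L / 2 ^ (max j k))" e x] by auto
    then show ?thesis using e by (intro exI[of _ "max j k"]) auto
  qed
  have \<kappa>: "j \<le> \<kappa> x" "cell L (\<kappa> x) x \<subseteq> E" if "x \<in> E" for x
    using LeastI_ex[OF ex[OF that]] by (auto simp: \<kappa>_def)
  have \<kappa>_le: "\<kappa> x \<le> k" if "j \<le> k" "cell L k x \<subseteq> E" for x k
    using that unfolding \<kappa>_def by (intro Least_le) auto
  have \<kappa>_gt: "j < \<kappa> x" if "x \<in> E \<inter> ?Q" for x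
  proof -
    have "cell L j x = ?Q" using that by (intro cell_eq) auto
    then have "\<kappa> x \<noteq> j" using \<kappa>(2)[of x] that nsub by auto
    then show ?thesis using \<kappa>(1)[of x] that by auto
  qed
  have same: "\<kappa> y = \<kappa> x" if x: "x \<in> E" and y: "y \<in> cell L (\<kappa> x) x" for x y
  proof (rule antisym)
    have yE: "y \<in> E" using \<kappa>(2)[OF x] y by auto
    have eq: "cell L (\<kappa> x) y = cell L (\<kappa> x) x" using y by (rule cell_eq)
    show 1: "\<kappa> y \<le> \<kappa> x" using \<kappa>[OF x] eq by (intro \<kappa>_le) auto
    have "cell L (\<kappa> y) y = cell L (\<kappa> y) x"
      using y 1 cell_mono by (intro cell_eq) blast
    then show "\<kappa> x \<le> \<kappa> y" using \<kappa>[OF yE] by (intro \<kappa>_le) auto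
  qed
  define P where "P = (\<lambda>x. cell L (\<kappa> x) x) ` (E \<inter> ?Q)"
  have "P \<subseteq> range (\<lambda>(k, m). {y. key L k y = m})"
    by (auto simp: P_def cell_def)
  then have cP: "countable P" by (rule countable_subset) simp
  have "\<forall>p\<in>P. \<exists>x. x \<in> E \<inter> ?Q \<and> p = cell L (\<kappa> x) x" by (auto simp: P_def)
  then obtain rep where rep: "\<And>p. p \<in> P \<Longrightarrow> rep p \<in> E \<inter> ?Q \<and> p = cell L (\<kappa> (rep p)) (rep p)"
    by metis
  have disj: "p \<inter> q = {}" if "p \<in> P" "q \<in> P" "p \<noteq> q" for p q
  proof (rule ccontr)
    assume "p \<inter> q \<noteq> {}"
    then obtain y where y: "y \<in> p" "y \<in> q" by auto
    have "p = cell L (\<kappa> y) y" if "p \<in> P" "y \<in> p" for p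
      using rep[OF that(1)] that(2) same[of "rep p" y] cell_eq[of y L "\<kappa> (rep p)" "rep p"] by auto
    then show False using y that by metis
  qed
  define J where "J = (\<lambda>p. (\<kappa> (rep p), rep p)) ` P"
  show thesis
  proof (rule that[of J])
    show "countable J" using cP by (simp add: J_def)
    show "j < k \<and> x \<in> ?Q \<and> \<not> cell L (k - 1) x \<subseteq> E" if kx: "(k, x) \<in> J" for k x
    proof -
      obtain p where p: "p \<in> P" "k = \<kappa> x" "x = rep p" using kx by (auto simp: J_def)
      have xE: "x \<in> E \<inter> ?Q" using rep p by auto
      have "\<not> cell L (k - 1) x \<subseteq> E"
        using \<kappa>_le[of "k - 1" x] \<kappa>_gt[OF xE] p by fastforce
      then show ?thesis using xE \<kappa>_gt[OF xE] p by auto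
    qed
    show "disjoint_family_on (\<lambda>(k, x). cell L k x) J"
      unfolding disjoint_family_on_def
    proof (intro ballI impI)
      fix a b assume "a \<in> J" "b \<in> J" "a \<noteq> b"
      then obtain p q where pq: "p \<in> P" "q \<in> P" "a = (\<kappa> (rep p), rep p)" "b = (\<kappa> (rep q), rep q)" "p \<noteq> q"
        by (auto simp: J_def)
      then show "(case a of (k, x) \<Rightarrow> cell L k x) \<inter> (case b of (k, x) \<Rightarrow> cell L k x) = {}"
        using disj[OF pq(1,2,5)] rep[OF pq(1)] rep[OF pq(2)] by simp
    qed
    have "(\<Union>(k, x)\<in>J. cell L k x) = \<Union>P"
      unfolding J_def using rep by fastforce
    also have "\<dots> = E \<inter> ?Q"
    proof
      have "cell L (\<kappa> x) x \<subseteq> E \<inter> ?Q" if "x \<in> E \<inter> ?Q" for x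
        using \<kappa>[of x] that cell_subset_cell[of x L j z "\<kappa> x"] by auto
      then show "\<Union>P \<subseteq> E \<inter> ?Q" by (auto simp: P_def)
      show "E \<inter> ?Q \<subseteq> \<Union>P" by (auto simp: P_def)
    qed
    finally show "(\<Union>(k, x)\<in>J. cell L k x) = E \<inter> ?Q" .
  qed
qed

lemma cell_0_eq:
  "L > 0 \<Longrightarrow> cell L 0 (0 :: real ^ 'n) = {x. \<forall>i. - L \<le> x $ i \<and> x $ i < L}"
  by (simp add: cell_eq_box) (simp add: key_def floor_eq_iff)

lemma ball_subset_cell_0: "L > 0 \<Longrightarrow> ball (0 :: real ^ 'n) L \<subseteq> cell L 0 0"
proof
  fix x :: "real ^ 'n" assume "L > 0" "x \<in> ball 0 L"
  then have "\<bar>x $ i\<bar> < L" for i using component_le_norm_cart[of x i] by auto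
  then show "x \<in> cell L 0 0" using \<open>L > 0\<close> by (auto simp: cell_0_eq abs_less_iff) (smt (verit))+
qed

section \<open>Operators on bounded functions with compact support\<close>

lemma ennpowr_finite: "a > 0 \<Longrightarrow> x < \<infinity> \<Longrightarrow> x ennpowr a < \<infinity>"
  by (auto simp: ennpowr_def)

lemma ennpowr_ennreal: "a > 0 \<Longrightarrow> x \<ge> 0 \<Longrightarrow> ennreal x ennpowr a = ennreal (x powr a)"
  by (auto simp: ennpowr_def)

text \<open>
  Inequalities between norms and inequalities between the integrals of \<open>p\<close>-th powers: this lemma and
  \<open>ennpowr_le_of_le\<close> allow everything in between to be done with integrals.
\<close>
lemma le_of_ennpowr_le:
  assumes p: "p > 0" and C: "C \<ge> 0" and Y: "Y < \<infinity>"
    and le: "X ennpowr (1 / p) \<le> ennreal C * Y ennpowr (1 / p)"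
  shows "X \<le> ennreal (C powr p) * Y"
proof -
  obtain y where y: "Y = ennreal y" "y \<ge> 0" using Y by (cases Y) auto
  have "X ennpowr (1 / p) < \<infinity>"
    using le p y C by (simp add: ennpowr_ennreal ennreal_mult[symmetric] le_less_trans)
  then have "X < \<infinity>" using p by (auto simp: ennpowr_def less_top split: if_splits)
  then obtain x where x: "X = ennreal x" "x \<ge> 0" by (cases X) auto
  have "x powr (1 / p) \<le> C * y powr (1 / p)"
    using le p x y C by (simp add: ennpowr_ennreal ennreal_mult[symmetric])
  then have "(x powr (1 / p)) powr p \<le> (C * y powr (1 / p)) powr p"
    using p by (intro powr_mono2) auto
  then have "x \<le> C powr p * y" using p x y C by (simp add: powr_powr powr_mult)
  then show ?thesis using x y C by (simp add: ennreal_mult[symmetric])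
qed

lemma ennpowr_le_of_le:
  assumes p: "p > 0" and C: "C > 0" and le: "X \<le> ennreal C * Y"
  shows "X ennpowr (1 / p) \<le> ennreal (C powr (1 / p)) * Y ennpowr (1 / p)"
proof (cases "Y = \<infinity>")
  case True
  then show ?thesis using p C by (simp add: ennpowr_def ennreal_mult_top)
next
  case False
  then obtain y where y: "Y = ennreal y" "y \<ge> 0" by (cases Y) auto
  have "X < \<infinity>" using le y C by (simp add: ennreal_mult[symmetric] le_less_trans)
  then obtain x where x: "X = ennreal x" "x \<ge> 0" by (cases X) auto
  have "x \<le> C * y" using le x y C by (simp add: ennreal_mult[symmetric])
  then have "x powr (1 / p) \<le> (C * y) powr (1 / p)" using p x by (intro powr_mono2) auto
  then show ?thesis using p x y C by (simp add: ennpowr_ennreal ennreal_mult[symmetric] powr_mult)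
qed

definition restr :: "'a set \<Rightarrow> ('a \<Rightarrow> complex) \<Rightarrow> 'a \<Rightarrow> complex" where
  "restr A f = (\<lambda>x. if x \<in> A then f x else 0)"

lemma restr_measurable[measurable]:
  "A \<in> sets M \<Longrightarrow> f \<in> borel_measurable M \<Longrightarrow> restr A f \<in> borel_measurable M"
  unfolding restr_def by (intro measurable_If_set) auto

lemma Linf_cI:
  assumes "f \<in> borel_measurable lebesgue" "\<And>x. norm (f x) \<le> m" "\<And>x. f x \<noteq> 0 \<Longrightarrow> x \<in> ball 0 R"
  shows "f \<in> Linf_c"
proof -
  have "{x. f x \<noteq> 0} \<subseteq> ball 0 R" using assms(3) by auto
  then have "bounded {x. f x \<noteq> 0}" using bounded_ball bounded_subset by blast
  then have "compact (closure {x. f x \<noteq> 0})" by (simp add: compact_closure)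
  moreover have "bounded (range f)" using assms(2) by (auto simp: bounded_iff)
  ultimately show ?thesis using assms(1) by (simp add: Linf_c_def bounded_functions_def)
qed

lemma Linf_cE:
  assumes "f \<in> Linf_c"
  obtains m R where "m > 0" "R > 0" "\<And>x. norm (f x) \<le> m" "\<And>x. f x \<noteq> 0 \<Longrightarrow> x \<in> ball 0 R"
proof -
  have "bounded {x. f x \<noteq> 0}"
    using assms bounded_subset[OF compact_imp_bounded closure_subset] by (auto simp: Linf_c_def)
  then obtain R where R: "R > 0" "{x. f x \<noteq> 0} \<subseteq> ball 0 R" using bounded_subset_ballD[of _ 0] by blast
  have "bounded (range f)" using assms by (auto simp: Linf_c_def bounded_functions_def)
  then obtain m where "m > 0" "\<And>x. norm (f x) \<le> m" by (auto simp: bounded_pos)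
  then show thesis using that[of m R] R by blast
qed

lemma Linf_c_bounded_functions: "f \<in> Linf_c \<Longrightarrow> f \<in> bounded_functions"
  by (simp add: Linf_c_def)

lemma Linf_c_measurable: "f \<in> Linf_c \<Longrightarrow> f \<in> borel_measurable lebesgue"
  by (simp add: Linf_c_def bounded_functions_def)

lemma Linf_c_mono:
  assumes f: "f \<in> Linf_c" and g: "g \<in> borel_measurable lebesgue" "\<And>x. norm (g x) \<le> C * norm (f x)"
  shows "g \<in> Linf_c"
proof -
  obtain m R where m: "m > 0" "R > 0" "\<And>x. norm (f x) \<le> m" "\<And>x. f x \<noteq> 0 \<Longrightarrow> x \<in> ball 0 R"
    using Linf_cE[OF f] by metis
  show ?thesis
  proof (rule Linf_cI[OF g(1)])
    show "norm (g x) \<le> \<bar>C\<bar> * m" for x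
      using g(2)[of x] m(3)[of x] m(1) by (smt (verit) mult_mono norm_ge_zero abs_ge_self mult_right_mono)
    show "x \<in> ball 0 R" if "g x \<noteq> 0" for x
      using g(2)[of x] that m(4)[of x] by fastforce
  qed
qed

lemma Linf_c_restr: "f \<in> Linf_c \<Longrightarrow> A \<in> sets lebesgue \<Longrightarrow> restr A f \<in> Linf_c"
  by (rule Linf_c_mono[of f "restr A f" 1])
    (blast intro: restr_measurable Linf_c_measurable, blast intro: restr_measurable Linf_c_measurable, simp add: restr_def)

lemma Linf_c_cmult: "f \<in> Linf_c \<Longrightarrow> (\<lambda>x. c * f x) \<in> Linf_c"
  by (rule Linf_c_mono[of f _ "norm c"]) (auto simp: norm_mult dest: Linf_c_measurable)

lemma Linf_c_add:
  assumes "f \<in> Linf_c" "g \<in> Linf_c" shows "(\<lambda>x. f x + g x) \<in> Linf_c"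
proof -
  obtain m R where m: "\<And>x. norm (f x) \<le> m" "\<And>x. f x \<noteq> 0 \<Longrightarrow> x \<in> ball 0 R"
    using Linf_cE[OF assms(1)] by metis
  obtain m' R' where m': "\<And>x. norm (g x) \<le> m'" "\<And>x. g x \<noteq> 0 \<Longrightarrow> x \<in> ball 0 R'"
    using Linf_cE[OF assms(2)] by metis
  show ?thesis
  proof (rule Linf_cI)
    show "norm (f x + g x) \<le> m + m'" for x
      using norm_triangle_ineq[of "f x" "g x"] m(1)[of x] m'(1)[of x] by linarith
    show "x \<in> ball 0 (max R R')" if "f x + g x \<noteq> 0" for x
      using m(2)[of x] m'(2)[of x] that by fastforce
    show "(\<lambda>x. f x + g x) \<in> borel_measurable lebesgue"
      using assms by (intro borel_measurable_add Linf_c_measurable)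
  qed
qed

lemma Linf_c_minus: "f \<in> Linf_c \<Longrightarrow> (\<lambda>x. - f x) \<in> Linf_c"
  using Linf_c_cmult[of f "-1"] by simp

lemma Linf_c_diff:
  assumes "f \<in> Linf_c" "g \<in> Linf_c" shows "(\<lambda>x. f x - g x) \<in> Linf_c"
  using Linf_c_add[OF assms(1) Linf_c_minus[OF assms(2)]] by simp

lemma Linf_c_sum:
  "finite I \<Longrightarrow> (\<And>i. i \<in> I \<Longrightarrow> f i \<in> Linf_c) \<Longrightarrow> (\<lambda>x. \<Sum>i\<in>I. f i x) \<in> Linf_c"
proof (induction rule: finite_induct)
  case empty
  show ?case by (rule Linf_cI[of _ 0 0]) auto
next
  case (insert i I)
  then show ?case using Linf_c_add[of "f i" "\<lambda>x. \<Sum>i\<in>I. f i x"] by simp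
qed

lemma Linf_c_integral_finite:
  fixes f :: "real ^ 'n \<Rightarrow> complex"
  assumes "f \<in> Linf_c" and h: "\<And>x. norm (h x) \<le> C * indicator {x. f x \<noteq> 0} x"
  shows "(\<integral>\<^sup>+x. ennreal (norm (h x :: real)) \<partial>lebesgue) < \<infinity>"
proof -
  obtain R where R: "\<And>x. f x \<noteq> 0 \<Longrightarrow> x \<in> ball 0 R"
    using Linf_cE[OF assms(1)] by metis
  have "(\<integral>\<^sup>+x. ennreal (norm (h x)) \<partial>lebesgue) \<le> (\<integral>\<^sup>+x. ennreal \<bar>C\<bar> * indicator (ball (0 :: real ^ 'n) R) x \<partial>lebesgue)"
  proof (intro nn_integral_mono)
    fix x
    have "norm (h x) \<le> \<bar>C\<bar> * indicator (ball 0 R) x" using h[of x] R[of x]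
      by (cases "f x = 0") (auto simp: indicator_def)
    then show "ennreal (norm (h x)) \<le> ennreal \<bar>C\<bar> * indicator (ball 0 R) x"
      using ennreal_leI by (fastforce simp: indicator_def)
  qed
  also have "\<dots> = ennreal \<bar>C\<bar> * emeasure lebesgue (ball (0 :: real ^ 'n) R)"
    by (rule nn_integral_cmult_indicator) simp
  also have "\<dots> < \<infinity>"
    using emeasure_lborel_ball_finite[of "0 :: real ^ 'n" R] by (simp add: ennreal_mult_less_top)
  finally show ?thesis .
qed

lemma Linf_c_integral_power_finite:
  assumes "f \<in> Linf_c"
  shows "(\<integral>\<^sup>+x. ennreal (norm (f x) ^ Suc r) \<partial>lebesgue) < \<infinity>"
proof -
  obtain m where m: "m > 0" "\<And>x. norm (f x) \<le> m" using Linf_cE[OF assms] by metis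
  have "(\<integral>\<^sup>+x. ennreal (norm (norm (f x) ^ Suc r)) \<partial>lebesgue) < \<infinity>"
    using m by (intro Linf_c_integral_finite[OF assms, of _ "m ^ Suc r"])
      (auto simp: indicator_def norm_power intro!: power_mono mult_mono simp del: power_Suc)
  then show ?thesis by simp
qed

lemma Linf_c_norm_finite:
  assumes "f \<in> Linf_c" shows "(\<integral>\<^sup>+x. ennreal (norm (f x)) \<partial>lebesgue) < \<infinity>"
  using Linf_c_integral_power_finite[OF assms, of 0] by simp

lemma Linf_c_L2: "f \<in> Linf_c \<Longrightarrow> f \<in> L2_functions"
  using Linf_c_integral_power_finite[of f 1]
  by (auto simp: L2_functions_def Lp_norm_def powr_numeral numeral_2_eq_2 powr_realpow' intro!: ennpowr_finite[unfolded infinity_ennreal_def] dest: Linf_c_measurable)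

text \<open>
  Weak type \<open>(r, r)\<close>. The sparse bounds are proved for an arbitrary \<open>r\<close>; they are used with \<open>r = 1\<close>, where
  the estimate comes from condition (I), and with \<open>r = 2\<close>, where it follows from boundedness on \<open>L\<^sup>2\<close>.
\<close>
definition weak_type :: "((real ^ 'n \<Rightarrow> complex) \<Rightarrow> (real ^ 'n \<Rightarrow> complex)) \<Rightarrow> nat \<Rightarrow> real \<Rightarrow> bool" where
  "weak_type T r C \<longleftrightarrow> (\<forall>f\<in>Linf_c. \<forall>t>0.
      emeasure lebesgue {x. norm (T f x) > t} \<le> ennreal (C / t ^ r) * (\<integral>\<^sup>+x. ennreal (norm (f x) ^ r) \<partial>lebesgue))"

locale L2_operator =
  fixes T :: "(real ^ 'n \<Rightarrow> complex) \<Rightarrow> (real ^ 'n \<Rightarrow> complex)"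
  assumes sublinear: "sublinear_operator T" and L2_bounded: "bounded_on_L2 T"
begin

lemma T_measurable: "f \<in> Linf_c \<Longrightarrow> T f \<in> borel_measurable lebesgue"
  using sublinear Linf_c_L2 by (auto simp: sublinear_operator_def)

lemma T_add: "f \<in> Linf_c \<Longrightarrow> g \<in> Linf_c \<Longrightarrow>
   AE x in lebesgue. norm (T (\<lambda>y. f y + g y) x) \<le> norm (T f x) + norm (T g x)"
  using sublinear Linf_c_L2[of f] Linf_c_L2[of g] unfolding sublinear_operator_def by blast

lemma T_cmult: "f \<in> Linf_c \<Longrightarrow> AE x in lebesgue. norm (T (\<lambda>y. c * f y) x) = norm c * norm (T f x)"
  using sublinear Linf_c_L2[of f] unfolding sublinear_operator_def by blast

lemma T_diff:
  assumes "f \<in> Linf_c" "g \<in> Linf_c"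
  shows "AE x in lebesgue. norm (T (\<lambda>y. f y - g y) x) \<le> norm (T f x) + norm (T g x)"
  using T_add[OF assms(1) Linf_c_cmult[OF assms(2), of "-1"]] T_cmult[OF assms(2), of "-1"]
  by eventually_elim simp

lemma T_sum:
  "finite I \<Longrightarrow> (\<And>i. i \<in> I \<Longrightarrow> f i \<in> Linf_c) \<Longrightarrow>
    AE x in lebesgue. norm (T (\<lambda>y. \<Sum>i\<in>I. f i y) x) \<le> (\<Sum>i\<in>I. norm (T (f i) x))"
proof (induction rule: finite_induct)
  case empty
  have "(\<lambda>_. 0) \<in> Linf_c" by (rule Linf_cI[of _ 0 0]) auto
  then show ?case using T_cmult[of "\<lambda>_. 0" 0] by (auto elim: eventually_mono)
next
  case (insert i I)
  have "AE x in lebesgue. norm (T (\<lambda>y. f i y + (\<Sum>i\<in>I. f i y)) x) \<le> norm (T (f i) x) + norm (T (\<lambda>y. \<Sum>i\<in>I. f i y) x)"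
    using insert by (intro T_add Linf_c_sum) auto
  then have "AE x in lebesgue. norm (T (\<lambda>y. f i y + (\<Sum>i\<in>I. f i y)) x) \<le> norm (T (f i) x) + (\<Sum>i\<in>I. norm (T (f i) x))"
    using insert.IH insert.prems by (auto elim: eventually_elim2)
  then show ?case using insert.hyps by simp
qed

lemma L2_bound:
  obtains C where "C \<ge> 0"
    "\<And>f. f \<in> Linf_c \<Longrightarrow> (\<integral>\<^sup>+x. ennreal (norm (T f x) ^ 2) \<partial>lebesgue) \<le> ennreal C * (\<integral>\<^sup>+x. ennreal (norm (f x) ^ 2) \<partial>lebesgue)"
proof -
  obtain C where C: "\<And>f. f \<in> L2_functions \<Longrightarrow> Lp_norm 2 (\<lambda>_. 1) (T f) \<le> ennreal C * Lp_norm 2 (\<lambda>_. 1) f"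
    using L2_bounded by (auto simp: bounded_on_L2_def)
  show thesis
  proof (rule that)
    fix f :: "real ^ 'n \<Rightarrow> complex" assume f: "f \<in> Linf_c"
    have "(\<integral>\<^sup>+x. ennreal (norm (T f x) powr 2 * 1) \<partial>lebesgue) \<le> ennreal (max C 0 powr 2) * (\<integral>\<^sup>+x. ennreal (norm (f x) powr 2 * 1) \<partial>lebesgue)"
    proof (rule le_of_ennpowr_le)
      show "(\<integral>\<^sup>+x. ennreal (norm (T f x) powr 2 * 1) \<partial>lebesgue) ennpowr (1/2)
        \<le> ennreal (max C 0) * (\<integral>\<^sup>+x. ennreal (norm (f x) powr 2 * 1) \<partial>lebesgue) ennpowr (1/2)"
        using C[OF Linf_c_L2[OF f]] by (auto simp: Lp_norm_def ennreal_neg max_def split: if_splits)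
      show "(\<integral>\<^sup>+x. ennreal (norm (f x) powr 2 * 1) \<partial>lebesgue) < \<infinity>"
        using Linf_c_integral_power_finite[OF f, of 1] by (simp add: powr_realpow' numeral_2_eq_2 del: power_Suc)
    qed auto
    then show "(\<integral>\<^sup>+x. ennreal (norm (T f x) ^ 2) \<partial>lebesgue) \<le> ennreal (max C 0 powr 2) * (\<integral>\<^sup>+x. ennreal (norm (f x) ^ 2) \<partial>lebesgue)"
      by simp
  qed simp
qed

lemma weak_type_2:
  obtains C where "C \<ge> 0" "weak_type T 2 C"
proof -
  obtain C where C: "C \<ge> 0"
    "\<And>f. f \<in> Linf_c \<Longrightarrow> (\<integral>\<^sup>+x. ennreal (norm (T f x) ^ 2) \<partial>lebesgue) \<le> ennreal C * (\<integral>\<^sup>+x. ennreal (norm (f x) ^ 2) \<partial>lebesgue)"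
    using L2_bound by metis
  have "weak_type T 2 C"
    unfolding weak_type_def
  proof (intro ballI allI impI)
    fix f :: "real ^ 'n \<Rightarrow> complex" and t :: real assume f: "f \<in> Linf_c" and t: "t > 0"
    have [measurable]: "T f \<in> borel_measurable lebesgue" using f by (rule T_measurable)
    have "{x. norm (T f x) > t} \<subseteq> {x \<in> space lebesgue. 1 \<le> ennreal (1 / t ^ 2) * ennreal (norm (T f x) ^ 2)}"
    proof clarsimp
      fix x assume "t < norm (T f x)"
      then have "t ^ 2 \<le> norm (T f x) ^ 2" using t by (intro power_mono) auto
      then show "1 \<le> ennreal (1 / t ^ 2) * ennreal (norm (T f x) ^ 2)"
        using t by (simp add: ennreal_mult[symmetric] divide_simps)
    qed
    then have "emeasure lebesgue {x. norm (T f x) > t} \<le>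
       emeasure lebesgue {x \<in> space lebesgue. 1 \<le> ennreal (1 / t ^ 2) * ennreal (norm (T f x) ^ 2)}"
      by (intro emeasure_mono, assumption, measurable)
    also have "\<dots> \<le> ennreal (1 / t ^ 2) * (\<integral>\<^sup>+x. ennreal (norm (T f x) ^ 2) * indicator (space lebesgue) x \<partial>lebesgue)"
      by (intro nn_integral_Markov_inequality) auto
    also have "\<dots> \<le> ennreal (1 / t ^ 2) * (ennreal C * (\<integral>\<^sup>+x. ennreal (norm (f x) ^ 2) \<partial>lebesgue))"
      using C(2)[OF f] by (intro mult_left_mono) auto
    also have "\<dots> = ennreal (C / t ^ 2) * (\<integral>\<^sup>+x. ennreal (norm (f x) ^ 2) \<partial>lebesgue)"
      using C(1) t by (simp add: mult.assoc[symmetric] ennreal_mult[symmetric])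
    finally show "emeasure lebesgue {x. norm (T f x) > t} \<le> ennreal (C / t ^ 2) * (\<integral>\<^sup>+x. ennreal (norm (f x) ^ 2) \<partial>lebesgue)" .
  qed
  with C(1) show thesis by (rule that)
qed

end

section \<open>The Calderon-Zygmund decomposition and part (i)\<close>

lemma superlevel_lebesgue:
  fixes h :: "real ^ 'n \<Rightarrow> real"
  assumes [measurable]: "h \<in> borel_measurable lebesgue"
  shows "{x. t < h x} \<in> sets lebesgue"
proof -
  have "{x \<in> space lebesgue. t < h x} \<in> sets lebesgue" by measurable
  then show ?thesis by simp
qed

lemma emeasure_superlevel_le:
  fixes h :: "real ^ 'n \<Rightarrow> real"
  assumes [measurable]: "h \<in> borel_measurable lebesgue" and t: "t > 0"
  shows "emeasure lebesgue {x. t < h x} \<le> ennreal (1 / t) * (\<integral>\<^sup>+x. ennreal (h x) \<partial>lebesgue)"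
proof -
  have "emeasure lebesgue {x. t < h x} \<le> emeasure lebesgue {x \<in> space lebesgue. 1 \<le> ennreal (1 / t) * ennreal (h x)}"
  proof (rule emeasure_mono)
    show "{x. t < h x} \<subseteq> {x \<in> space lebesgue. 1 \<le> ennreal (1 / t) * ennreal (h x)}"
      using t by (auto simp: ennreal_mult[symmetric] divide_simps)
  qed measurable
  also have "\<dots> \<le> ennreal (1 / t) * (\<integral>\<^sup>+x. ennreal (h x) * indicator (space lebesgue) x \<partial>lebesgue)"
    by (intro nn_integral_Markov_inequality) auto
  finally show ?thesis by simp
qed

lemma exists_large_cell:
  fixes e :: ennreal
  assumes "e < \<infinity>"
  obtains L0 where "L0 > 0" "\<And>L. L \<ge> L0 \<Longrightarrow> e < emeasure lebesgue (cell L 0 (0 :: real ^ 'n))"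
proof -
  obtain r where r: "e = ennreal r" "r \<ge> 0" using assms by (cases e) auto
  show thesis
  proof (rule that[of "max 1 r"])
    fix L assume L: "max 1 r \<le> L"
    then have "(2 * L) ^ 1 \<le> (2 * L) ^ CARD('n)" by (intro power_increasing) (auto simp: Suc_le_eq)
    then have "r < (2 * L) ^ CARD('n)" using L by simp
    moreover have "L > 0" using L by simp
    ultimately show "e < emeasure lebesgue (cell L 0 (0 :: real ^ 'n))"
      using r by (simp only: emeasure_cell) (simp add: ennreal_less_iff)
  qed simp
qed

lemma open_superset_small:
  assumes "A \<in> sets lebesgue" "e > 0"
  obtains U where "open U" "A \<subseteq> U" "emeasure lebesgue U \<le> emeasure lebesgue A + ennreal e"
proof -
  obtain U where U: "open U" "A \<subseteq> U" "(U - A) \<in> lmeasurable" "emeasure lebesgue (U - A) < ennreal e"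
    using sets_lebesgue_outer_open[OF assms] by metis
  have "emeasure lebesgue U = emeasure lebesgue (A \<union> (U - A))" using U(2) by (simp add: Un_absorb1)
  also have "\<dots> \<le> emeasure lebesgue A + emeasure lebesgue (U - A)"
    using assms(1) U(3) by (intro emeasure_subadditive) auto
  also have "\<dots> \<le> emeasure lebesgue A + ennreal e" using U(4) by (intro add_left_mono less_imp_le)
  finally show thesis using U that by blast
qed

text \<open>
  Finite subadditivity is all that a sublinear operator offers, so countable families of cells are cut down
  to finite ones at the price of a set of small measure.
\<close>
lemma finite_subfamily_exhausts:
  assumes J: "countable J" "\<And>i. i \<in> J \<Longrightarrow> P i \<in> sets M" and fin: "emeasure M (\<Union>i\<in>J. P i) < \<infinity>" and d: "0 < (d :: ennreal)"
  obtains J' where "finite J'" "J' \<subseteq> J" "emeasure M ((\<Union>i\<in>J. P i) - (\<Union>i\<in>J'. P i)) < d"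
proof (cases "J = {}")
  case True
  then show thesis using d by (intro that[of "{}"]) auto
next
  case False
  define A where "A N = (\<Union>i\<in>J. P i) - (\<Union>i<N. P (from_nat_into J i))" for N :: nat
  have inJ: "from_nat_into J i \<in> J" for i by (rule from_nat_into[OF False])
  have U: "(\<Union>i\<in>J. P i) \<in> sets M" using J by auto
  have A: "A N \<in> sets M" for N unfolding A_def using inJ J(2) by (intro sets.Diff[OF U] sets.finite_UN) auto
  have "(\<lambda>N. emeasure M (A N)) \<longlonglongrightarrow> emeasure M (\<Inter>N. A N)"
  proof (rule Lim_emeasure_decseq)
    show "range A \<subseteq> sets M" using A by auto
    show "decseq A" unfolding A_def decseq_def by (auto simp: )
    have "emeasure M (A N) \<le> emeasure M (\<Union>i\<in>J. P i)" for N
      using U unfolding A_def by (intro emeasure_mono) auto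
    then show "emeasure M (A N) \<noteq> \<infinity>" for N using fin by (metis leD)
  qed
  moreover have "(\<Inter>N. A N) = {}"
  proof -
    have "x \<notin> (\<Inter>N. A N)" for x
    proof
      assume x: "x \<in> (\<Inter>N. A N)"
      then obtain i where i: "i \<in> J" "x \<in> P i" by (auto simp: A_def)
      obtain k where "from_nat_into J k = i" using from_nat_into_surj[OF J(1) i(1)] by auto
      then have "x \<notin> A (Suc k)" using i by (auto simp: A_def)
      then show False using x by blast
    qed
    then show ?thesis by blast
  qed
  ultimately have "(\<lambda>N. emeasure M (A N)) \<longlonglongrightarrow> 0" by simp
  then have "eventually (\<lambda>N. emeasure M (A N) < d) sequentially" using d by (rule order_tendstoD)
  then obtain N where N: "emeasure M (A N) < d" by (auto simp: eventually_sequentially)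
  show thesis
    using N inJ by (intro that[of "from_nat_into J ` {..<N}"]) (auto simp: A_def)
qed

lemma sum_restr_inside:
  assumes "finite J" "disjoint_family_on P J" "i \<in> J" "y \<in> P i"
  shows "(\<Sum>j\<in>J. restr (P j) (h j) y) = h i y"
proof -
  have "restr (P j) (h j) y = 0" if "j \<in> J - {i}" for j
    using assms that by (auto simp: restr_def disjoint_family_on_def)
  then have "(\<Sum>j\<in>J - {i}. restr (P j) (h j) y) = 0" by (intro sum.neutral) auto
  then show ?thesis using assms by (subst sum.remove[of J i]) (auto simp: restr_def)
qed

lemma sum_restr_outside: "(\<And>j. j \<in> J \<Longrightarrow> y \<notin> P j) \<Longrightarrow> (\<Sum>j\<in>J. restr (P j) (h j) y) = 0"
  by (intro sum.neutral) (auto simp: restr_def)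

lemma Linf_c_integrable: "f \<in> Linf_c \<Longrightarrow> integrable lebesgue f"
  using Linf_c_norm_finite Linf_c_measurable by (intro integrableI_bounded) auto

lemma nn_integral_restr: "(\<integral>\<^sup>+x. ennreal (norm (restr A f x)) \<partial>M) = (\<integral>\<^sup>+x\<in>A. ennreal (norm (f x)) \<partial>M)"
  by (intro nn_integral_cong) (auto simp: restr_def indicator_def)

lemma sum_nn_integral_disjoint:
  assumes f: "f \<in> borel_measurable M" and J: "finite J" "\<And>i. i \<in> J \<Longrightarrow> P i \<in> sets M" "disjoint_family_on P J"
  shows "(\<Sum>i\<in>J. \<integral>\<^sup>+x\<in>P i. f x \<partial>M) = (\<integral>\<^sup>+x\<in>(\<Union>i\<in>J. P i). f x \<partial>M)"
  using nn_integral_UN_disjoint[OF f countable_finite[OF J(1)] J(2,3)] J(1)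
  by (simp add: nn_integral_count_space_finite)

text \<open>
  The cells are the Whitney cells, inside a large cube, of an open set that contains both the set where \<open>\<bar>f\<bar>\<close>
  exceeds \<open>t\<close> and the set where its maximal function does. Including the former, whose measure Chebyshev's inequality
  controls, makes \<open>\<bar>f\<bar> \<le> t\<close> hold outside the cells. The mean of \<open>f\<close> over a cell is at most a constant
  times \<open>t\<close>, because a point near the cell has maximal function at most \<open>t\<close>.

  Only finitely many cells carry a mean-zero piece \<open>b i\<close>; the restriction \<open>e\<close> of \<open>f\<close> to the other cells has an
  \<open>L\<^sup>2\<close> norm as small as desired.
\<close>
lemma calderon_zygmund:
  fixes f :: "real ^ 'n \<Rightarrow> complex"
  assumes f: "f \<in> Linf_c" and t: "t > 0" and nonzero: "(\<integral>\<^sup>+x. ennreal (norm (f x)) \<partial>lebesgue) > 0" and \<delta>: "\<delta> > 0"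
  defines "\<kappa> \<equiv> ball_cell_ratio TYPE('n)"
  obtains L :: real and J :: "(nat \<times> (real ^ 'n)) set" and g e :: "real ^ 'n \<Rightarrow> complex" and b :: "nat \<times> (real ^ 'n) \<Rightarrow> real ^ 'n \<Rightarrow> complex"
  where "L > 0" "finite J" "g \<in> Linf_c" "e \<in> Linf_c" "\<And>i. i \<in> J \<Longrightarrow> b i \<in> Linf_c"
    "f = (\<lambda>x. g x + e x + (\<Sum>i\<in>J. b i x))"
    "\<And>x. norm (g x) \<le> (1 + \<kappa>) * t"
    "(\<integral>\<^sup>+x. ennreal (norm (g x)) \<partial>lebesgue) \<le> (\<integral>\<^sup>+x. ennreal (norm (f x)) \<partial>lebesgue)"
    "(\<integral>\<^sup>+x. ennreal (norm (e x) ^ 2) \<partial>lebesgue) \<le> ennreal \<delta>"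
    "\<And>k x y. (k, x) \<in> J \<Longrightarrow> y \<notin> cell_ball L 1 k x \<Longrightarrow> b (k, x) y = 0"
    "\<And>i. i \<in> J \<Longrightarrow> (LINT y|lebesgue. b i y) = 0"
    "(\<Sum>i\<in>J. \<integral>\<^sup>+y. ennreal (norm (b i y)) \<partial>lebesgue) \<le> 2 * (\<integral>\<^sup>+x. ennreal (norm (f x)) \<partial>lebesgue)"
    "(\<Sum>(k, x)\<in>J. emeasure lebesgue (cell_ball L 8 k x)) \<le> ennreal (\<kappa> * (2 + 5 ^ CARD('n)) / t) * (\<integral>\<^sup>+x. ennreal (norm (f x)) \<partial>lebesgue)"
proof -
  let ?F = "\<lambda>x. ennreal (norm (f x))"
  note [measurable] = Linf_c_measurable[OF f]
  obtain I where I: "(\<integral>\<^sup>+x. ?F x \<partial>lebesgue) = ennreal I" "I > 0"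
    using Linf_c_norm_finite[OF f] nonzero by (cases "\<integral>\<^sup>+x. ?F x \<partial>lebesgue") auto
  have \<kappa>0: "\<kappa> \<ge> 0" by (simp add: \<kappa>_def)
  let ?E1 = "{x. norm (f x) > t}"
  have E1: "?E1 \<in> sets lebesgue" by (rule superlevel_lebesgue) simp
  have "emeasure lebesgue ?E1 \<le> ennreal (1 / t) * (\<integral>\<^sup>+x. ?F x \<partial>lebesgue)"
    using t by (intro emeasure_superlevel_le) auto
  also have "\<dots> = ennreal (I / t)" using I t by (simp add: ennreal_mult[symmetric])
  finally have mE1: "emeasure lebesgue ?E1 \<le> ennreal (I / t)" .
  obtain U1 where U1: "open U1" "?E1 \<subseteq> U1" "emeasure lebesgue U1 \<le> emeasure lebesgue ?E1 + ennreal (I / t)"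
    using open_superset_small[OF E1, of "I / t"] I t by auto
  let ?M = "maximal lebesgue ?F"
  let ?U2 = "{x. ennreal t < ?M x}"
  have U2: "open ?U2" by (rule lebesgue.open_maximal)
  have "ennreal (1 / t) * (ennreal t * emeasure lebesgue ?U2) \<le> ennreal (1 / t) * (ennreal (5 ^ CARD('n)) * ennreal I)"
    using lebesgue.maximal_weak_type[of ?F "ennreal t"] I by (intro mult_left_mono) auto
  then have mU2: "emeasure lebesgue ?U2 \<le> ennreal (5 ^ CARD('n) * I / t)"
    using t I by (simp add: mult.assoc[symmetric] ennreal_mult[symmetric])
  define E where "E = U1 \<union> ?U2"
  have E: "open E" using U1 U2 by (auto simp: E_def)
  have "emeasure lebesgue E \<le> emeasure lebesgue U1 + emeasure lebesgue ?U2"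
    unfolding E_def using U1 U2 by (intro emeasure_subadditive) auto
  also have "\<dots> \<le> (ennreal (I / t) + ennreal (I / t)) + ennreal (5 ^ CARD('n) * I / t)"
    using U1(3) mE1 mU2 by (intro add_mono) (auto intro: order_trans add_right_mono)
  also have "\<dots> = ennreal ((2 + 5 ^ CARD('n)) / t * I)"
    using t I by (simp add: ennreal_plus[symmetric] field_simps del: ennreal_plus)
  finally have mE: "emeasure lebesgue E \<le> ennreal ((2 + 5 ^ CARD('n)) / t * I)" .
  have finE: "emeasure lebesgue E < \<infinity>" using mE by (rule le_less_trans) simp
  \<comment> \<open>The root cube contains the support of \<open>f\<close> and is too large to be covered by the exceptional set.\<close>
  obtain m R where m: "m > 0" "R > 0" "\<And>x. norm (f x) \<le> m" "\<And>x. f x \<noteq> 0 \<Longrightarrow> x \<in> ball 0 R"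
    using Linf_cE[OF f] by metis
  obtain L0 where L0: "L0 > 0" "\<And>L. L \<ge> L0 \<Longrightarrow> emeasure lebesgue E < emeasure lebesgue (cell L 0 (0 :: real ^ 'n))"
    using exists_large_cell[OF finE] by metis
  define L where "L = max L0 R"
  have L: "L > 0" using L0 by (simp add: L_def)
  let ?Q = "cell L 0 (0 :: real ^ 'n)"
  have supp: "x \<in> ?Q" if "f x \<noteq> 0" for x
    using ball_subset_cell_0[OF L] m(4)[OF that] subset_ball[of R L 0] by (auto simp: L_def)
  have "\<not> ?Q \<subseteq> E"
  proof
    assume "?Q \<subseteq> E"
    then have "emeasure lebesgue ?Q \<le> emeasure lebesgue E" using E by (intro emeasure_mono) auto
    then show False using L0(2)[of L] by (simp add: L_def)
  qed
  from whitney[OF L E this]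
  obtain J :: "(nat \<times> (real ^ 'n)) set" where J: "countable J"
    "\<And>k x. (k, x) \<in> J \<Longrightarrow> 0 < k \<and> x \<in> ?Q \<and> \<not> cell L (k - 1) x \<subseteq> E"
    "disjoint_family_on (\<lambda>(k, x). cell L k x) J"
    "(\<Union>(k, x)\<in>J. cell L k x) = E \<inter> ?Q"
    by metis
  define P where "P = (\<lambda>(k, x :: real ^ 'n). cell L k x)"
  define B where "B = (\<lambda>(k, x :: real ^ 'n). cell_ball L 8 k x)"
  have P_sets[measurable]: "P i \<in> sets lebesgue" for i
    using L by (auto simp: P_def split: prod.split)
  define \<mu> where "\<mu> i = measure lebesgue (P i)" for i
  have \<mu>: "emeasure lebesgue (P i) = ennreal (\<mu> i)" "\<mu> i > 0" for i
  proof -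
    have fin: "emeasure lebesgue (P i) < \<infinity>" "0 < emeasure lebesgue (P i)"
      using emeasure_cell_finite[OF L, of "fst i" "snd i"] emeasure_cell_pos[OF L, of "fst i" "snd i"]
      by (simp_all only: P_def case_prod_beta)
    then show 1: "emeasure lebesgue (P i) = ennreal (\<mu> i)"
      unfolding \<mu>_def by (intro emeasure_eq_ennreal_measure) auto
    show "\<mu> i > 0" using fin(2) unfolding 1 by (simp add: )
  qed
  have mB: "emeasure lebesgue (B i) = ennreal \<kappa> * emeasure lebesgue (P i)" for i
    unfolding B_def P_def \<kappa>_def using emeasure_cell_ball[OF L] by (auto split: prod.split)
  \<comment> \<open>The parent of the cell contains a point of maximal function at most \<open>t\<close>, which lies in a ball
    comparable to the cell.\<close>
  have avg_P: "(\<integral>\<^sup>+y\<in>P i. ?F y \<partial>lebesgue) \<le> ennreal (\<kappa> * t * \<mu> i)" if "i \<in> J" for i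
  proof -
    obtain k x where i: "i = (k, x)" by (cases i)
    then have k: "0 < k" "\<not> cell L (k - 1) x \<subseteq> E" using J(2)[of k x] that by auto
    then obtain y where y: "y \<in> cell L (k - 1) x" "y \<notin> E" by auto
    have "cell L (k - 1) x \<subseteq> B i"
      using parent_subset_cell_ball[OF L, of "k - 1" x] cell_ball_mono[OF L, of 1 8 k x] k(1)
      by (auto simp: i B_def)
    then have yB: "y \<in> B i" using y by auto
    have PB: "P i \<subseteq> B i" using cell_subset_cell_ball[OF L, of k x] cell_ball_mono[OF L, of 1 8 k x]
      by (auto simp: i B_def P_def)
    have "(\<integral>\<^sup>+y\<in>P i. ?F y \<partial>lebesgue) \<le> (\<integral>\<^sup>+y\<in>B i. ?F y \<partial>lebesgue)"
      using PB by (intro nn_integral_mono) (auto simp: indicator_def)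
    also have "\<dots> \<le> ?M y * emeasure lebesgue (B i)"
      using yB unfolding B_def i by (simp only: prod.case cell_ball_def) (rule lebesgue.average_le_maximal)
    also have "\<dots> \<le> ennreal t * emeasure lebesgue (B i)"
      using y(2) by (intro mult_right_mono) (auto simp: E_def not_less)
    also have "\<dots> = ennreal (\<kappa> * t * \<mu> i)"
      using t \<kappa>0 \<mu>[of i] by (simp add: mB ennreal_mult[symmetric] ac_simps)
    finally show ?thesis .
  qed
  define a where "a i = (LINT y|lebesgue. restr (P i) f y) / \<mu> i" for i
  have Lr: "restr (P i) f \<in> Linf_c" for i by (intro Linf_c_restr f P_sets)
  have a1: "ennreal (norm (a i) * \<mu> i) \<le> (\<integral>\<^sup>+y\<in>P i. ?F y \<partial>lebesgue)" for i
  proof -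
    have "norm (a i) * \<mu> i = norm (LINT y|lebesgue. restr (P i) f y)"
      using \<mu>(2)[of i] by (simp add: a_def norm_divide)
    then show ?thesis
      using integral_norm_bound_ennreal[OF Linf_c_integrable[OF Lr[of i]]] by (simp add: nn_integral_restr)
  qed
  have a2: "norm (a i) \<le> \<kappa> * t" if "i \<in> J" for i
  proof -
    have "ennreal (norm (a i) * \<mu> i) \<le> ennreal (\<kappa> * t * \<mu> i)"
      using a1 avg_P[OF that] by (rule order_trans)
    then have "norm (a i) * \<mu> i \<le> \<kappa> * t * \<mu> i" using \<kappa>0 t \<mu>(2)[of i] by (simp add: ennreal_le_iff)
    then show ?thesis using \<mu>(2)[of i] by simp
  qed
  have disj: "disjoint_family_on P J" using J(3) by (simp add: P_def)
  have UP: "(\<Union>i\<in>J. P i) = E \<inter> ?Q" using J(4) by (simp add: P_def)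
  have finU: "emeasure lebesgue (\<Union>i\<in>J. P i) < \<infinity>"
    unfolding UP by (rule le_less_trans[OF _ finE], rule emeasure_mono) (use E in auto)
  have \<delta>m: "0 < ennreal (\<delta> / m\<^sup>2)" using \<delta> m by simp
  obtain J' where J': "finite J'" "J' \<subseteq> J" "emeasure lebesgue ((\<Union>i\<in>J. P i) - (\<Union>i\<in>J'. P i)) < ennreal (\<delta> / m\<^sup>2)"
    using finite_subfamily_exhausts[OF J(1) P_sets finU \<delta>m] by metis
  have disj': "disjoint_family_on P J'" using disj J'(2) by (rule disjoint_family_on_mono[rotated])
  define U where "U = (\<Union>i\<in>J. P i)"
  define V where "V = (\<Union>i\<in>J'. P i)"
  have U_sets[measurable]: "U \<in> sets lebesgue" "V \<in> sets lebesgue"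
    using J(1) J'(1) by (auto simp: U_def V_def)
  have compl[measurable]: "- U \<in> sets lebesgue" "- V \<in> sets lebesgue"
    using sets.compl_sets[OF U_sets(1)] sets.compl_sets[OF U_sets(2)] by (simp_all add: Compl_eq_Diff_UNIV)
  have VU: "V \<subseteq> U" using J'(2) by (auto simp: U_def V_def)
  define g where "g = (\<lambda>y. restr (- U) f y + (\<Sum>i\<in>J'. restr (P i) (\<lambda>_. a i) y))"
  define e where "e = restr (U - V) f"
  define b where "b i = restr (P i) (\<lambda>y. f y - a i)" for i
  have const: "restr (P i) (\<lambda>_. c) \<in> Linf_c" if "i \<in> J'" for i c
  proof (rule Linf_cI)
    show "norm (restr (P i) (\<lambda>_. c) x) \<le> norm c" for x by (simp add: restr_def)
    show "x \<in> ball 0 (CARD('n) * (2 * L))" if "restr (P i) (\<lambda>_. c) x \<noteq> 0" for x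
    proof -
      have "x \<in> P i" using that by (auto simp: restr_def split: if_splits)
      then have "x \<in> ?Q" using \<open>i \<in> J'\<close> J'(2) UP by blast
      then show ?thesis using cell_subset_ball[OF L, of 0 "0 :: real ^ 'n"] by auto
    qed
  qed (intro restr_measurable P_sets borel_measurable_const)
  have b_alt: "b i = (\<lambda>y. restr (P i) f y - restr (P i) (\<lambda>_. a i) y)" for i
    by (auto simp: b_def restr_def)
  have bL: "b i \<in> Linf_c" if "i \<in> J'" for i
    unfolding b_alt by (intro Linf_c_diff Lr const that)
  have gL: "g \<in> Linf_c" unfolding g_def
    by (intro Linf_c_add Linf_c_restr[OF f] compl Linf_c_sum[OF J'(1)] const)
  have eL: "e \<in> Linf_c" unfolding e_def by (intro Linf_c_restr f sets.Diff U_sets)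
  have bint: "(\<integral>\<^sup>+y. ennreal (norm (b i y)) \<partial>lebesgue) \<le> 2 * (\<integral>\<^sup>+y\<in>P i. ?F y \<partial>lebesgue)" for i
  proof -
    have "(\<integral>\<^sup>+y. ennreal (norm (b i y)) \<partial>lebesgue) \<le> (\<integral>\<^sup>+y. ?F y * indicator (P i) y + ennreal (norm (a i)) * indicator (P i) y \<partial>lebesgue)"
      by (intro nn_integral_mono)
        (auto simp: b_def restr_def indicator_def ennreal_plus[symmetric] norm_triangle_ineq4 simp del: ennreal_plus)
    also have "\<dots> = (\<integral>\<^sup>+y\<in>P i. ?F y \<partial>lebesgue) + ennreal (norm (a i) * \<mu> i)"
      using \<mu>(2)[of i] by (subst nn_integral_add) (auto simp: nn_integral_cmult_indicator \<mu>(1) ennreal_mult)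
    also have "\<dots> \<le> (\<integral>\<^sup>+y\<in>P i. ?F y \<partial>lebesgue) + (\<integral>\<^sup>+y\<in>P i. ?F y \<partial>lebesgue)"
      by (intro add_left_mono a1)
    finally show ?thesis by (simp add: mult_2)
  qed
  have sumF: "(\<Sum>i\<in>J'. \<integral>\<^sup>+y\<in>P i. ?F y \<partial>lebesgue) = (\<integral>\<^sup>+y\<in>V. ?F y \<partial>lebesgue)"
    unfolding V_def by (intro sum_nn_integral_disjoint J' disj') auto
  show thesis
  proof (rule that[of L J' g e b])
    show "L > 0" "finite J'" "g \<in> Linf_c" "e \<in> Linf_c" "\<And>i. i \<in> J' \<Longrightarrow> b i \<in> Linf_c"
      using L J' gL eL bL by auto
    show "f = (\<lambda>x. g x + e x + (\<Sum>i\<in>J'. b i x))"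
    proof
      fix x
      show "f x = g x + e x + (\<Sum>i\<in>J'. b i x)"
      proof (cases "x \<in> V")
        case True
        then obtain i where i: "i \<in> J'" "x \<in> P i" by (auto simp: V_def)
        have "g x = a i" using True VU sum_restr_inside[OF J'(1) disj' i, of "\<lambda>i _. a i"]
          by (auto simp: g_def restr_def)
        moreover have "(\<Sum>i\<in>J'. b i x) = f x - a i"
          unfolding b_def by (rule sum_restr_inside[OF J'(1) disj' i])
        ultimately show ?thesis using True by (simp add: e_def restr_def)
      next
        case False
        then have "(\<Sum>i\<in>J'. restr (P i) (\<lambda>_. a i) x) = 0" "(\<Sum>i\<in>J'. b i x) = 0"
          unfolding b_def by (auto simp: V_def intro!: sum_restr_outside)
        then show ?thesis using False VU by (auto simp: g_def e_def restr_def)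
      qed
    qed
    show "norm (g x) \<le> (1 + \<kappa>) * t" for x
    proof (cases "x \<in> V")
      case True
      then obtain i where i: "i \<in> J'" "x \<in> P i" by (auto simp: V_def)
      have "g x = a i" using True VU sum_restr_inside[OF J'(1) disj' i, of "\<lambda>i _. a i"]
        by (auto simp: g_def restr_def)
      then show ?thesis using a2[of i] i J'(2) t by (auto simp: algebra_simps)
    next
      case False
      then have "(\<Sum>i\<in>J'. restr (P i) (\<lambda>_. a i) x) = 0"
        by (auto simp: V_def intro!: sum_restr_outside)
      then have g: "g x = restr (- U) f x" by (simp add: g_def)
      have "norm (f x) \<le> t" if "x \<notin> U"
      proof (cases "x \<in> ?Q")
        case True
        then have "x \<notin> E" using that by (auto simp: U_def UP)
        then have "\<not> norm (f x) > t" using U1(2) unfolding E_def by blast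
        then show ?thesis by simp
      next
        case False
        then have "f x = 0" using supp[of x] by blast
        then show ?thesis using t by simp
      qed
      then have "norm (g x) \<le> t" using t by (auto simp: g restr_def)
      also have "t \<le> (1 + \<kappa>) * t" using \<kappa>0 t by (simp add: algebra_simps)
      finally show ?thesis .
    qed
    show "(\<integral>\<^sup>+x. ennreal (norm (g x)) \<partial>lebesgue) \<le> (\<integral>\<^sup>+x. ?F x \<partial>lebesgue)"
    proof -
      have "(\<integral>\<^sup>+x. ennreal (norm (g x)) \<partial>lebesgue) \<le>
          (\<integral>\<^sup>+x. ?F x * indicator (- V) x + (\<Sum>i\<in>J'. ennreal (norm (a i)) * indicator (P i) x) \<partial>lebesgue)"
      proof (intro nn_integral_mono)
        fix x
        have "norm (g x) \<le> norm (f x) * indicator (- V) x + (\<Sum>i\<in>J'. norm (a i) * indicator (P i) x)"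
          unfolding g_def using VU
          by (intro order_trans[OF norm_triangle_ineq] add_mono order_trans[OF norm_sum] sum_mono)
            (auto simp: restr_def indicator_def)
        then have "ennreal (norm (g x)) \<le> ennreal (norm (f x) * indicator (- V) x + (\<Sum>i\<in>J'. norm (a i) * indicator (P i) x))"
          by (rule ennreal_leI)
        also have "\<dots> = ?F x * indicator (- V) x + (\<Sum>i\<in>J'. ennreal (norm (a i)) * indicator (P i) x)"
          by (subst ennreal_plus) (auto simp: ennreal_mult ennreal_indicator sum_nonneg sum_ennreal[symmetric] simp del: sum_ennreal)
        finally show "ennreal (norm (g x)) \<le> ?F x * indicator (- V) x + (\<Sum>i\<in>J'. ennreal (norm (a i)) * indicator (P i) x)" .
      qed
      also have "\<dots> = (\<integral>\<^sup>+x\<in>-V. ?F x \<partial>lebesgue) + (\<Sum>i\<in>J'. ennreal (norm (a i) * \<mu> i))"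
        using less_imp_le[OF \<mu>(2)] U_sets
        by (subst nn_integral_add) (auto simp: nn_integral_sum nn_integral_cmult_indicator \<mu>(1) ennreal_mult)
      also have "\<dots> \<le> (\<integral>\<^sup>+x\<in>-V. ?F x \<partial>lebesgue) + (\<Sum>i\<in>J'. \<integral>\<^sup>+y\<in>P i. ?F y \<partial>lebesgue)"
        by (intro add_left_mono sum_mono a1)
      also have "\<dots> = (\<integral>\<^sup>+x\<in>-V. ?F x \<partial>lebesgue) + (\<integral>\<^sup>+x\<in>V. ?F x \<partial>lebesgue)" by (simp add: sumF)
      also have "\<dots> = (\<integral>\<^sup>+x. ?F x * indicator (-V) x + ?F x * indicator V x \<partial>lebesgue)"
        using U_sets by (subst nn_integral_add) auto
      also have "\<dots> = (\<integral>\<^sup>+x. ?F x \<partial>lebesgue)"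
        by (intro nn_integral_cong) (auto simp: indicator_def)
      finally show ?thesis .
    qed
    show "(\<integral>\<^sup>+x. ennreal (norm (e x) ^ 2) \<partial>lebesgue) \<le> ennreal \<delta>"
    proof -
      have "(\<integral>\<^sup>+x. ennreal (norm (e x) ^ 2) \<partial>lebesgue) \<le> (\<integral>\<^sup>+x. ennreal (m ^ 2) * indicator (U - V) x \<partial>lebesgue)"
        using m(3) by (intro nn_integral_mono) (auto simp: e_def restr_def indicator_def intro!: ennreal_leI power_mono)
      also have "\<dots> = ennreal (m ^ 2) * emeasure lebesgue (U - V)"
        by (rule nn_integral_cmult_indicator) simp
      also have "\<dots> \<le> ennreal (m ^ 2) * ennreal (\<delta> / m ^ 2)"
        using J'(3) by (intro mult_left_mono) (auto simp: U_def V_def)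
      also have "\<dots> = ennreal \<delta>" using m \<delta> by (simp add: ennreal_mult[symmetric])
      finally show ?thesis .
    qed
    show "b (k, x) y = 0" if "(k, x) \<in> J'" "y \<notin> cell_ball L 1 k x" for k x y
      using that cell_subset_cell_ball[OF L, of k x] by (auto simp: b_def restr_def P_def)
    show "(LINT y|lebesgue. b i y) = 0" if "i \<in> J'" for i
    proof -
      have "(LINT y|lebesgue. restr (P i) (\<lambda>_. a i) y) = (LINT y|lebesgue. indicator (P i) y *\<^sub>R a i)"
        by (intro Bochner_Integration.integral_cong) (auto simp: restr_def)
      also have "\<dots> = \<mu> i *\<^sub>R a i"
        using \<mu>(1)[of i] by (subst has_bochner_integral_integral_eq[OF has_bochner_integral_indicator]) (auto simp: \<mu>_def)
      finally have "(LINT y|lebesgue. restr (P i) (\<lambda>_. a i) y) = (LINT y|lebesgue. restr (P i) f y)"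
        using \<mu>(2)[of i] by (simp add: a_def scaleR_conv_of_real)
      then show ?thesis
        unfolding b_alt by (subst Bochner_Integration.integral_diff) (auto intro: Linf_c_integrable Lr const that)
    qed
    show "(\<Sum>i\<in>J'. \<integral>\<^sup>+y. ennreal (norm (b i y)) \<partial>lebesgue) \<le> 2 * (\<integral>\<^sup>+x. ?F x \<partial>lebesgue)"
    proof -
      have "(\<Sum>i\<in>J'. \<integral>\<^sup>+y. ennreal (norm (b i y)) \<partial>lebesgue) \<le> (\<Sum>i\<in>J'. 2 * (\<integral>\<^sup>+y\<in>P i. ?F y \<partial>lebesgue))"
        by (intro sum_mono bint)
      also have "\<dots> = 2 * (\<integral>\<^sup>+y\<in>V. ?F y \<partial>lebesgue)" by (simp add: sum_distrib_left[symmetric] sumF)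
      also have "\<dots> \<le> 2 * (\<integral>\<^sup>+x. ?F x \<partial>lebesgue)"
        by (intro mult_left_mono nn_integral_mono) (auto simp: indicator_def)
      finally show ?thesis .
    qed
    show "(\<Sum>(k, x)\<in>J'. emeasure lebesgue (cell_ball L 8 k x)) \<le> ennreal (\<kappa> * (2 + 5 ^ CARD('n)) / t) * (\<integral>\<^sup>+x. ?F x \<partial>lebesgue)"
    proof -
      have "(\<Sum>(k, x)\<in>J'. emeasure lebesgue (cell_ball L 8 k x)) = (\<Sum>i\<in>J'. ennreal \<kappa> * emeasure lebesgue (P i))"
        unfolding mB[symmetric] B_def by (intro sum.cong) auto
      also have "\<dots> = ennreal \<kappa> * (\<Sum>i\<in>J'. emeasure lebesgue (P i))" by (simp add: sum_distrib_left)
      also have "(\<Sum>i\<in>J'. emeasure lebesgue (P i)) = emeasure lebesgue V"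
        unfolding V_def using J'(1) disj' by (intro sum_emeasure) auto
      also have "emeasure lebesgue V \<le> emeasure lebesgue E"
        using VU E by (intro emeasure_mono) (auto simp: U_def UP)
      also have "\<dots> \<le> ennreal ((2 + 5 ^ CARD('n)) / t * I)" by (rule mE)
      also have "ennreal \<kappa> * ennreal ((2 + 5 ^ CARD('n)) / t * I) = ennreal (\<kappa> * (2 + 5 ^ CARD('n)) / t) * (\<integral>\<^sup>+x. ?F x \<partial>lebesgue)"
        using I t \<kappa>0 by (simp add: ennreal_mult[symmetric] ac_simps)
      finally show ?thesis by (simp add: mult_left_mono)
    qed
  qed
qed

lemma weak_typeD:
  "weak_type T r C \<Longrightarrow> f \<in> Linf_c \<Longrightarrow> t > 0 \<Longrightarrow>
    emeasure lebesgue {x. norm (T f x) > t} \<le> ennreal (C / t ^ r) * (\<integral>\<^sup>+x. ennreal (norm (f x) ^ r) \<partial>lebesgue)"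
  by (simp add: weak_type_def)

context L2_operator
begin

text \<open>
  The good part is bounded by a multiple of \<open>t\<close>, so its contribution is controlled in \<open>L\<^sup>2\<close>. On the enlarged
  cells nothing is claimed: their total measure is admissible. Away from them, condition (I) applies to each mean-zero
  piece, and the resulting integrals add up to a multiple of the integral of \<open>\<bar>f\<bar>\<close>. The remainder \<open>e\<close>, small
  in \<open>L\<^sup>2\<close>, absorbs the infinitely many cells that were left out.
\<close>
lemma weak_type_1:
  assumes "cond_I T"
  obtains C where "C \<ge> 0" "weak_type T 1 C"
proof -
  obtain C2 where C2: "C2 \<ge> 0" "weak_type T 2 C2" by (rule weak_type_2)
  obtain CI where CI0: "\<forall>c. \<forall>r > 0. \<forall>f \<in> bounded_functions.
       (\<forall>x. x \<notin> ball c r \<longrightarrow> f x = 0) \<longrightarrow> (LINT x:ball c r|lebesgue. f x) = 0 \<longrightarrow>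
       (\<integral>\<^sup>+x\<in>- ball c (4 * r). ennreal (norm (T f x)) \<partial>lebesgue)
         \<le> ennreal CI * (\<integral>\<^sup>+x\<in>ball c r. ennreal (norm (f x)) \<partial>lebesgue)"
    using assms unfolding cond_I_def ..
  define \<kappa> where "\<kappa> = ball_cell_ratio TYPE('n)"
  have \<kappa>0: "\<kappa> \<ge> 0" by (simp add: \<kappa>_def)
  define K where "K = 9 * C2 * (1 + \<kappa>) + 1 + \<kappa> * (2 + 5 ^ CARD('n)) + 6 * \<bar>CI\<bar>"
  have K0: "K \<ge> 0" using C2 \<kappa>0 by (simp add: K_def)
  have "weak_type T 1 K"
    unfolding weak_type_def power_one_right
  proof (intro ballI allI impI)
    fix f :: "real ^ 'n \<Rightarrow> complex" and t :: real assume f: "f \<in> Linf_c" and t: "t > 0"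
    note [measurable] = Linf_c_measurable[OF f] T_measurable[OF f]
    show "emeasure lebesgue {x. norm (T f x) > t} \<le> ennreal (K / t) * (\<integral>\<^sup>+x. ennreal (norm (f x)) \<partial>lebesgue)"
    proof (cases "(\<integral>\<^sup>+x. ennreal (norm (f x)) \<partial>lebesgue) = 0")
      case True
      then have "AE x in lebesgue. f x = 0" by (simp add: nn_integral_0_iff_AE)
      then have "(\<integral>\<^sup>+x. ennreal (norm (f x) ^ 2) \<partial>lebesgue) = 0"
        by (subst nn_integral_0_iff_AE) (auto elim: eventually_mono)
      then show ?thesis using C2(2) f t by (auto simp: weak_type_def)
    next
      case False
      then have pos: "(\<integral>\<^sup>+x. ennreal (norm (f x)) \<partial>lebesgue) > 0" by (simp add: zero_less_iff_neq_zero)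
      obtain I where I: "(\<integral>\<^sup>+x. ennreal (norm (f x)) \<partial>lebesgue) = ennreal I" "I > 0"
        using Linf_c_norm_finite[OF f] pos by (cases "\<integral>\<^sup>+x. ennreal (norm (f x)) \<partial>lebesgue") auto
      \<comment> \<open>The weak type \<open>(2, 2)\<close> bound for the remainder at height \<open>t / 3\<close> is \<open>9 * C2 * \<delta> / t\<^sup>2\<close>, which this
        choice keeps below \<open>I / t\<close>.\<close>
      define \<delta> where "\<delta> = I * t / (9 * C2 + 1)"
      have \<delta>: "\<delta> > 0" using I t C2 by (simp add: \<delta>_def add_nonneg_pos)
      show ?thesis
      proof (rule calderon_zygmund[OF f t pos \<delta>, folded \<kappa>_def])
        fix L :: real and J :: "(nat \<times> (real ^ 'n)) set" and g e b
        assume CZ: "L > 0" "finite J" "g \<in> Linf_c" "e \<in> Linf_c" "\<And>i. i \<in> J \<Longrightarrow> b i \<in> Linf_c"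
        "f = (\<lambda>x. g x + e x + (\<Sum>i\<in>J. b i x))"
        "\<And>x. norm (g x) \<le> (1 + \<kappa>) * t"
        "(\<integral>\<^sup>+x. ennreal (norm (g x)) \<partial>lebesgue) \<le> (\<integral>\<^sup>+x. ennreal (norm (f x)) \<partial>lebesgue)"
        "(\<integral>\<^sup>+x. ennreal (norm (e x) ^ 2) \<partial>lebesgue) \<le> ennreal \<delta>"
        "\<And>k x y. (k, x) \<in> J \<Longrightarrow> y \<notin> cell_ball L 1 k x \<Longrightarrow> b (k, x) y = 0"
        "\<And>i. i \<in> J \<Longrightarrow> (LINT y|lebesgue. b i y) = 0"
        "(\<Sum>i\<in>J. \<integral>\<^sup>+y. ennreal (norm (b i y)) \<partial>lebesgue) \<le> 2 * (\<integral>\<^sup>+x. ennreal (norm (f x)) \<partial>lebesgue)"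
        "(\<Sum>(k, x)\<in>J. emeasure lebesgue (cell_ball L 8 k x)) \<le> ennreal (\<kappa> * (2 + 5 ^ CARD('n)) / t) * (\<integral>\<^sup>+x. ennreal (norm (f x)) \<partial>lebesgue)"
      define B where "B = (\<lambda>(k, x :: real ^ 'n). cell_ball L 8 k x)"
      have B_sets: "B i \<in> sets lebesgue" for i by (auto simp: B_def cell_ball_def split: prod.split)
      let ?S = "\<lambda>x. (\<Sum>i\<in>J. norm (T (b i) x)) * indicator (- (\<Union>i\<in>J. B i)) x"
      have UB: "(\<Union>i\<in>J. B i) \<in> sets lebesgue" using CZ(2) B_sets by auto
      have UBc[measurable]: "- (\<Union>i\<in>J. B i) \<in> sets lebesgue"
        using sets.compl_sets[OF UB] by (simp add: Compl_eq_Diff_UNIV)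
      note [measurable] = T_measurable[OF CZ(3)] T_measurable[OF CZ(4)] Linf_c_measurable[OF CZ(3)]
      have sum_meas[measurable]: "(\<lambda>x. \<Sum>i\<in>J. norm (T (b i) x)) \<in> borel_measurable lebesgue"
        using T_measurable[OF CZ(5)] by (intro borel_measurable_sum) auto
      let ?A1 = "{x. norm (T g x) > t / 3}" and ?A2 = "{x. norm (T e x) > t / 3}" and ?A3 = "\<Union>i\<in>J. B i" and ?A4 = "{x. ?S x > t / 3}"
      have A_sets: "?A1 \<in> sets lebesgue" "?A2 \<in> sets lebesgue" "?A4 \<in> sets lebesgue"
        by (intro superlevel_lebesgue; measurable)+
      have "AE x in lebesgue. norm (T f x) \<le> norm (T g x) + norm (T e x) + (\<Sum>i\<in>J. norm (T (b i) x))"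
      proof -
        have "AE x in lebesgue. norm (T f x) \<le> norm (T (\<lambda>x. g x + e x) x) + norm (T (\<lambda>x. \<Sum>i\<in>J. b i x) x)"
          unfolding CZ(6) by (intro T_add Linf_c_add Linf_c_sum CZ(2-5))
        moreover have "AE x in lebesgue. norm (T (\<lambda>x. \<Sum>i\<in>J. b i x) x) \<le> (\<Sum>i\<in>J. norm (T (b i) x))"
          by (intro T_sum CZ(2,5))
        ultimately show ?thesis
          using T_add[OF CZ(3,4)] by eventually_elim simp
      qed
      then have "AE x in lebesgue. x \<in> {x. norm (T f x) > t} \<longrightarrow> x \<in> ?A1 \<union> ?A2 \<union> ?A3 \<union> ?A4"
        by eventually_elim (auto simp: indicator_def)
      then have "emeasure lebesgue {x. norm (T f x) > t} \<le> emeasure lebesgue (?A1 \<union> ?A2 \<union> ?A3 \<union> ?A4)"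
        using A_sets UB by (intro emeasure_mono_AE) auto
      also have "\<dots> \<le> emeasure lebesgue ?A1 + emeasure lebesgue ?A2 + emeasure lebesgue ?A3 + emeasure lebesgue ?A4"
        using A_sets UB by (intro order_trans[OF emeasure_subadditive] add_mono) auto
      also have "\<dots> \<le> ennreal (9 * C2 * (1 + \<kappa>) * I / t) + ennreal (I / t) + ennreal (\<kappa> * (2 + 5 ^ CARD('n)) * I / t) + ennreal (6 * \<bar>CI\<bar> * I / t)"
      proof (intro add_mono)
        have "emeasure lebesgue ?A1 \<le> ennreal (C2 / (t / 3) ^ 2) * (\<integral>\<^sup>+x. ennreal (norm (g x) ^ 2) \<partial>lebesgue)"
          using t by (intro weak_typeD[OF C2(2)] CZ(3)) auto
        also have "\<dots> \<le> ennreal (C2 / (t / 3) ^ 2) * (\<integral>\<^sup>+x. ennreal ((1 + \<kappa>) * t) * ennreal (norm (g x)) \<partial>lebesgue)"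
          using CZ(7) \<kappa>0 t
          by (intro mult_left_mono nn_integral_mono) (auto simp: ennreal_mult[symmetric] power2_eq_square intro!: ennreal_leI mult_right_mono)
        also have "\<dots> = ennreal (C2 / (t / 3) ^ 2) * (ennreal ((1 + \<kappa>) * t) * (\<integral>\<^sup>+x. ennreal (norm (g x)) \<partial>lebesgue))"
          by (subst nn_integral_cmult) auto
        also have "\<dots> \<le> ennreal (C2 / (t / 3) ^ 2) * (ennreal ((1 + \<kappa>) * t) * ennreal I)"
          using CZ(8) I by (intro mult_left_mono) auto
        also have "\<dots> = ennreal (9 * C2 * (1 + \<kappa>) * I / t)"
          using C2 \<kappa>0 t I by (simp add: ennreal_mult[symmetric] power2_eq_square)
        finally show "emeasure lebesgue ?A1 \<le> ennreal (9 * C2 * (1 + \<kappa>) * I / t)" .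
      next
        have "emeasure lebesgue ?A2 \<le> ennreal (C2 / (t / 3) ^ 2) * (\<integral>\<^sup>+x. ennreal (norm (e x) ^ 2) \<partial>lebesgue)"
          using t by (intro weak_typeD[OF C2(2)] CZ(4)) auto
        also have "\<dots> \<le> ennreal (C2 / (t / 3) ^ 2) * ennreal \<delta>"
          using CZ(9) by (intro mult_left_mono) auto
        also have "\<dots> = ennreal (9 * C2 / (9 * C2 + 1) * (I / t))"
          using C2 \<delta> t by (simp add: ennreal_mult[symmetric] power2_eq_square \<delta>_def ac_simps)
        also have "\<dots> \<le> ennreal (1 * (I / t))"
          using C2 I t by (intro ennreal_leI mult_right_mono) auto
        finally show "emeasure lebesgue ?A2 \<le> ennreal (I / t)" by simp
      next
        have "emeasure lebesgue ?A3 \<le> (\<Sum>i\<in>J. emeasure lebesgue (B i))"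
          using CZ(2) B_sets by (intro emeasure_subadditive_finite) auto
        also have "\<dots> = (\<Sum>(k, x)\<in>J. emeasure lebesgue (cell_ball L 8 k x))"
          by (intro sum.cong) (auto simp: B_def)
        also have "\<dots> \<le> ennreal (\<kappa> * (2 + 5 ^ CARD('n)) / t) * ennreal I" using CZ(13) I by simp
        also have "\<dots> = ennreal (\<kappa> * (2 + 5 ^ CARD('n)) * I / t)"
          using \<kappa>0 t I by (simp add: ennreal_mult[symmetric])
        finally show "emeasure lebesgue ?A3 \<le> ennreal (\<kappa> * (2 + 5 ^ CARD('n)) * I / t)" .
      next
        have far: "(\<integral>\<^sup>+x\<in>- ?A3. ennreal (norm (T (b i) x)) \<partial>lebesgue) \<le> ennreal \<bar>CI\<bar> * (\<integral>\<^sup>+y. ennreal (norm (b i y)) \<partial>lebesgue)"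
          if i: "i \<in> J" for i
        proof -
          obtain k x where kx: "i = (k, x)" by (cases i)
          define \<rho> where "\<rho> = 4 * real CARD('n) * L / 2 ^ k"
          have \<rho>: "\<rho> > 0" using CZ(1) by (simp add: \<rho>_def)
          have cb: "cell_ball L m k x = ball x (m * \<rho>)" for m by (simp add: cell_ball_def \<rho>_def)
          have zero: "b i y = 0" if "y \<notin> ball x \<rho>" for y
            using CZ(10)[of k x y] i that by (simp add: kx cb)
          have "(LINT y:ball x \<rho>|lebesgue. b i y) = (LINT y|lebesgue. b i y)"
            unfolding set_lebesgue_integral_def using zero
            by (intro Bochner_Integration.integral_cong) (auto simp: indicator_def)
          then have "(LINT y:ball x \<rho>|lebesgue. b i y) = 0" using CZ(11)[OF i] by simp
          then have *: "(\<integral>\<^sup>+x\<in>- ball x (4 * \<rho>). ennreal (norm (T (b i) x)) \<partial>lebesgue)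
              \<le> ennreal CI * (\<integral>\<^sup>+x\<in>ball x \<rho>. ennreal (norm (b i x)) \<partial>lebesgue)"
            using \<rho> zero by (intro CI0[rule_format] Linf_c_bounded_functions CZ(5) i) auto
          have "ball x (4 * \<rho>) \<subseteq> ball x (8 * \<rho>)" using \<rho> by (intro subset_ball) simp
          also have "ball x (8 * \<rho>) = B i" by (simp add: B_def kx cb)
          finally have "- ?A3 \<subseteq> - ball x (4 * \<rho>)" using i by blast
          then have "(\<integral>\<^sup>+x\<in>- ?A3. ennreal (norm (T (b i) x)) \<partial>lebesgue) \<le> (\<integral>\<^sup>+x\<in>- ball x (4 * \<rho>). ennreal (norm (T (b i) x)) \<partial>lebesgue)"
            by (intro nn_integral_mono) (auto simp: indicator_def)
          also note *
          also have "ennreal CI * (\<integral>\<^sup>+x\<in>ball x \<rho>. ennreal (norm (b i x)) \<partial>lebesgue) \<le> ennreal \<bar>CI\<bar> * (\<integral>\<^sup>+y. ennreal (norm (b i y)) \<partial>lebesgue)"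
            by (intro mult_mono nn_integral_mono ennreal_leI) (auto simp: indicator_def)
          finally show ?thesis .
        qed
        have "emeasure lebesgue ?A4 \<le> ennreal (1 / (t / 3)) * (\<integral>\<^sup>+x. ennreal (?S x) \<partial>lebesgue)"
        proof (rule emeasure_superlevel_le)
          show "?S \<in> borel_measurable lebesgue" by measurable
        qed (use t in simp)
        also have "(\<integral>\<^sup>+x. ennreal (?S x) \<partial>lebesgue) = (\<integral>\<^sup>+x. (\<Sum>i\<in>J. ennreal (norm (T (b i) x)) * indicator (- ?A3) x) \<partial>lebesgue)"
          by (intro nn_integral_cong) (auto simp: indicator_def sum_ennreal)
        also have "\<dots> = (\<Sum>i\<in>J. \<integral>\<^sup>+x\<in>- ?A3. ennreal (norm (T (b i) x)) \<partial>lebesgue)"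
        proof (rule nn_integral_sum)
          fix i assume "i \<in> J"
          note [measurable] = T_measurable[OF CZ(5)[OF this]]
          show "(\<lambda>x. ennreal (norm (T (b i) x)) * indicator (- ?A3) x) \<in> borel_measurable lebesgue" by measurable
        qed
        also have "\<dots> \<le> (\<Sum>i\<in>J. ennreal \<bar>CI\<bar> * (\<integral>\<^sup>+y. ennreal (norm (b i y)) \<partial>lebesgue))"
          by (intro sum_mono far)
        also have "\<dots> \<le> ennreal \<bar>CI\<bar> * (2 * ennreal I)"
          using CZ(12) I by (simp add: sum_distrib_left[symmetric] mult_left_mono)
        also have "ennreal (1 / (t / 3)) * (ennreal \<bar>CI\<bar> * (2 * ennreal I)) = ennreal (6 * \<bar>CI\<bar> * I / t)"
        proof -
          have "2 * ennreal I = ennreal (2 * I)" using I by (simp add: ennreal_mult)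
          then show ?thesis using I t by (simp add: ennreal_mult[symmetric] ac_simps)
        qed
        finally show "emeasure lebesgue ?A4 \<le> ennreal (6 * \<bar>CI\<bar> * I / t)" by (simp add: mult_left_mono)
      qed
      also have "\<dots> = ennreal (K / t) * ennreal I"
        using C2 \<kappa>0 t I K0
        by (simp add: ennreal_mult[symmetric] ennreal_plus[symmetric] K_def add_divide_distrib distrib_right del: ennreal_plus)
      finally show ?thesis using I by simp
      qed
    qed
  qed
  with K0 show thesis by (rule that)
qed

text \<open>
  Split \<open>f\<close> at height \<open>t\<close> and evaluate the weak types \<open>(1, 1)\<close> and \<open>(2, 2)\<close> of the two pieces at height
  \<open>t / 2\<close>.
\<close>
lemma Lp_bounded_between_1_2:
  assumes weak: "weak_type T 1 C" "C \<ge> 0" and p: "1 < p" "p < 2"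
  shows "bounded_on_Lp T p"
proof -
  obtain C2 where C2: "C2 \<ge> 0" "weak_type T 2 C2" by (rule weak_type_2)
  define K where "K = 2 * C * (p / (p - 1) * (1 / 1) powr (p - 1)) + 4 * C2 * \<bar>p / (2 - p)\<bar>"
  have K0: "K \<ge> 0" using C2 weak p by (simp add: K_def)
  have main: "(\<integral>\<^sup>+x. ennreal (norm (T f x) powr p) \<partial>lebesgue) \<le> ennreal K * (\<integral>\<^sup>+x. ennreal (norm (f x) powr p) \<partial>lebesgue)"
    if f: "f \<in> Linf_c" for f
    unfolding K_def
  proof (rule marcinkiewicz_1_2)
    note [measurable] = Linf_c_measurable[OF f] T_measurable[OF f]
    show "sigma_finite_measure (lebesgue :: (real ^ 'n) measure)" by (rule lebesgue.sigma_finite)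
    show "(\<lambda>x. norm (T f x)) \<in> borel_measurable lebesgue" "(\<lambda>x. norm (f x)) \<in> borel_measurable lebesgue" by measurable
    fix t :: real assume t: "t > 0"
    define A where "A = {x. norm (f x) > t}"
    have A: "A \<in> sets lebesgue" unfolding A_def by (rule superlevel_lebesgue) simp
    have A': "- A \<in> sets lebesgue" using sets.compl_sets[OF A] by (simp add: Compl_eq_Diff_UNIV)
    have L: "restr A f \<in> Linf_c" "restr (- A) f \<in> Linf_c" using f A A' by (auto intro: Linf_c_restr)
    have "f = (\<lambda>x. restr A f x + restr (- A) f x)" by (auto simp: restr_def)
    then have "AE x in lebesgue. norm (T f x) \<le> norm (T (restr A f) x) + norm (T (restr (- A) f) x)"
      using T_add[OF L] by simp
    then have "AE x in lebesgue. x \<in> {x. norm (T f x) > t} \<longrightarrow>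
       x \<in> {x. norm (T (restr A f) x) > t / 2} \<union> {x. norm (T (restr (- A) f) x) > t / 2}"
      by eventually_elim auto
    moreover have sets: "{x. norm (T (restr A f) x) > t / 2} \<in> sets lebesgue" "{x. norm (T (restr (- A) f) x) > t / 2} \<in> sets lebesgue"
      using T_measurable[OF L(1)] T_measurable[OF L(2)] by (intro superlevel_lebesgue; measurable)+
    ultimately have "emeasure lebesgue {x. norm (T f x) > t} \<le>
       emeasure lebesgue ({x. norm (T (restr A f) x) > t / 2} \<union> {x. norm (T (restr (- A) f) x) > t / 2})"
      by (intro emeasure_mono_AE) auto
    also have "\<dots> \<le> emeasure lebesgue {x. norm (T (restr A f) x) > t / 2} + emeasure lebesgue {x. norm (T (restr (- A) f) x) > t / 2}"
      by (intro emeasure_subadditive sets)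
    also have "\<dots> \<le> ennreal (C / (t / 2) ^ 1) * (\<integral>\<^sup>+x. ennreal (norm (restr A f x) ^ 1) \<partial>lebesgue) +
       ennreal (C2 / (t / 2) ^ 2) * (\<integral>\<^sup>+x. ennreal (norm (restr (- A) f x) ^ 2) \<partial>lebesgue)"
      using t by (intro add_mono weak_typeD[OF weak(1)] weak_typeD[OF C2(2)] L) auto
    also have "\<dots> = ennreal (2 * C / t) * (\<integral>\<^sup>+x\<in>{x\<in>space lebesgue. norm (f x) > 1 * t}. ennreal (norm (f x)) \<partial>lebesgue) +
       ennreal (4 * C2 / t\<^sup>2) * (\<integral>\<^sup>+x\<in>{x\<in>space lebesgue. norm (f x) \<le> t}. ennreal ((norm (f x))\<^sup>2) \<partial>lebesgue)"
      by (intro arg_cong2[where f="(+)"] arg_cong2[where f="(*)"] nn_integral_cong arg_cong[where f=ennreal])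
        (auto simp: restr_def A_def indicator_def power2_eq_square)
    finally show "emeasure lebesgue {x\<in>space lebesgue. norm (T f x) > t} \<le>
       ennreal (2 * C / t) * (\<integral>\<^sup>+x\<in>{x\<in>space lebesgue. norm (f x) > 1 * t}. ennreal (norm (f x)) \<partial>lebesgue) +
       ennreal (4 * C2 / t\<^sup>2) * (\<integral>\<^sup>+x\<in>{x\<in>space lebesgue. norm (f x) \<le> t}. ennreal ((norm (f x))\<^sup>2) \<partial>lebesgue)"
      by simp
  qed (use p C2 weak in auto)
  show ?thesis
    unfolding bounded_on_Lp_weight_def
  proof (intro exI ballI)
    fix f :: "real ^ 'n \<Rightarrow> complex" assume f: "f \<in> Linf_c"
    have "ennreal K \<le> ennreal (K + 1)" using K0 by (intro ennreal_leI) simp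
    then have "(\<integral>\<^sup>+x. ennreal (norm (T f x) powr p * 1) \<partial>lebesgue) \<le> ennreal (K + 1) * (\<integral>\<^sup>+x. ennreal (norm (f x) powr p * 1) \<partial>lebesgue)"
      using main[OF f] mult_right_mono[of "ennreal K" "ennreal (K + 1)"] by (auto intro: order_trans)
    then show "Lp_norm p (\<lambda>_. 1) (T f) \<le> ennreal ((K + 1) powr (1 / p)) * Lp_norm p (\<lambda>_. 1) f"
      unfolding Lp_norm_def using p K0 by (intro ennpowr_le_of_le) auto
  qed
qed

end

section \<open>A self-improvement of condition (II)\<close>

lemma AE_of_locally:
  fixes U :: "(real ^ 'n) set"
  assumes "\<And>x. x \<in> U \<Longrightarrow> \<exists>e>0. AE y in lebesgue. y \<in> ball x e \<longrightarrow> P y"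
  shows "AE y in lebesgue. y \<in> U \<longrightarrow> P y"
proof -
  obtain e where e: "\<And>x. x \<in> U \<Longrightarrow> e x > 0 \<and> (AE y in lebesgue. y \<in> ball x (e x) \<longrightarrow> P y)"
    using assms by metis
  obtain F where F: "F \<subseteq> (\<lambda>x. ball x (e x)) ` U" "countable F" "\<Union>F = \<Union>((\<lambda>x. ball x (e x)) ` U)"
    using Lindelof[of "(\<lambda>x. ball x (e x)) ` U"] by auto
  have "AE y in lebesgue. \<forall>B\<in>F. y \<in> B \<longrightarrow> P y"
    using F(1) e by (subst AE_ball_countable[OF F(2)]) auto
  moreover have "U \<subseteq> \<Union>F" unfolding F(3) using e by force
  ultimately show ?thesis by (auto elim!: eventually_mono)
qed

text \<open>
  A ball through a point of the doubled ball that meets the support of \<open>h\<close> is so large that its double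
  contains any given point of the smaller ball.
\<close>
lemma maximal_comparable_off_support:
  fixes h :: "real ^ 'n \<Rightarrow> complex"
  assumes zero: "\<And>x. x \<in> ball c (8 * r) \<Longrightarrow> h x = 0" and y: "y \<in> ball c r" and z: "z \<in> ball c (2 * r)"
  shows "maximal lebesgue (\<lambda>x. ennreal (norm (h x))) z
     \<le> ennreal (2 ^ CARD('n)) * maximal lebesgue (\<lambda>x. ennreal (norm (h x))) y"
proof (rule lebesgue.maximal_leI)
  fix a R assume R: "R > 0" and za: "z \<in> ball a R"
  let ?h = "\<lambda>x. ennreal (norm (h x))"
  show "(\<integral>\<^sup>+x\<in>ball a R. ?h x \<partial>lebesgue) \<le> ennreal (2 ^ CARD('n)) * maximal lebesgue ?h y * emeasure lebesgue (ball a R)"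
  proof (cases "\<forall>x\<in>ball a R. h x = 0")
    case True
    then have "(\<integral>\<^sup>+x\<in>ball a R. ?h x \<partial>lebesgue) = (\<integral>\<^sup>+x. 0 \<partial>(lebesgue :: (real ^ 'n) measure))"
      by (intro nn_integral_cong) (auto simp: indicator_def)
    then show ?thesis by simp
  next
    case False
    then obtain q where q: "q \<in> ball a R" "h q \<noteq> 0" by auto
    then have "dist c q \<ge> 8 * r" using zero[of q] by force
    moreover have "dist c q \<le> dist c z + (dist z a + dist a q)" by (meson add_left_mono dist_triangle order_trans dist_triangle)
    ultimately have "R > 3 * r" using q(1) z za by (simp add: dist_commute)
    moreover have "dist a y \<le> dist a z + (dist z c + dist c y)" by (meson add_left_mono dist_triangle order_trans dist_triangle)
    ultimately have ya: "y \<in> ball a (2 * R)" using y z za by (simp add: dist_commute)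
    have "(\<integral>\<^sup>+x\<in>ball a R. ?h x \<partial>lebesgue) \<le> (\<integral>\<^sup>+x\<in>ball a (2 * R). ?h x \<partial>lebesgue)"
      using R subset_ball[of R "2 * R" a] by (intro nn_integral_mono) (auto simp: indicator_def)
    also have "\<dots> \<le> maximal lebesgue ?h y * emeasure lebesgue (ball a (2 * R))"
      by (rule lebesgue.average_le_maximal[OF ya])
    also have "emeasure lebesgue (ball a (2 * R)) = ennreal (2 ^ CARD('n)) * emeasure lebesgue (ball a R)"
      using R by (intro emeasure_lebesgue_ball_scale) auto
    finally show ?thesis by (simp add: ac_simps)
  qed
qed

text \<open>
  Condition (II) without essential supremum and infimum: averages and maximal functions enter through real
  upper bounds, and the maximal function only through its value at one point.
\<close>
lemma cond_II_AE_bound: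
  fixes T :: "(real ^ 'n \<Rightarrow> complex) \<Rightarrow> (real ^ 'n \<Rightarrow> complex)"
  assumes "cond_II T"
  obtains C where "C \<ge> 0" "\<And>c r h a m y. r > 0 \<Longrightarrow> h \<in> Linf_c \<Longrightarrow> (\<And>x. x \<in> ball c (4 * r) \<Longrightarrow> h x = 0) \<Longrightarrow>
     a \<ge> 0 \<Longrightarrow> m \<ge> 0 \<Longrightarrow>
     (\<integral>\<^sup>+x\<in>ball c (2 * r). ennreal (norm (T h x)) \<partial>lebesgue) \<le> ennreal a * emeasure lebesgue (ball c (2 * r)) \<Longrightarrow>
     y \<in> ball c r \<Longrightarrow> maximal lebesgue (\<lambda>x. ennreal (norm (h x))) y \<le> ennreal m \<Longrightarrow>
     AE x in lebesgue. x \<in> ball c r \<longrightarrow> norm (T h x) \<le> C * (a + m)"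
proof -
  obtain C where C: "\<forall>c. \<forall>r > 0. \<forall>f \<in> Linf_c.
       (\<forall>x \<in> ball c (4 * r). f x = 0) \<longrightarrow>
       esssup (restrict_space lebesgue (ball c r)) (\<lambda>x. ennreal (norm (T f x)))
         \<le> ennreal C * avg (ball c (2 * r)) (\<lambda>x. ennreal (norm (T f x)))
            + ennreal C * (INF x \<in> ball c r. HL_maximal f x)"
    using assms unfolding cond_II_def ..
  show thesis
  proof (rule that[of "\<bar>C\<bar>"])
    fix c :: "real ^ 'n" and r a m :: real and h y
    assume r: "r > 0" and h: "h \<in> Linf_c" and zero: "\<And>x. x \<in> ball c (4 * r) \<Longrightarrow> h x = 0"
      and am: "a \<ge> 0" "m \<ge> 0"
      and a: "(\<integral>\<^sup>+x\<in>ball c (2 * r). ennreal (norm (T h x)) \<partial>lebesgue) \<le> ennreal a * emeasure lebesgue (ball c (2 * r))"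
      and y: "y \<in> ball c r" "maximal lebesgue (\<lambda>x. ennreal (norm (h x))) y \<le> ennreal m"
    let ?M = "restrict_space lebesgue (ball c r)"
    have "avg (ball c (2 * r)) (\<lambda>x. ennreal (norm (T h x))) \<le> ennreal a * emeasure lebesgue (ball c (2 * r)) / emeasure lebesgue (ball c (2 * r))"
      unfolding avg_def by (intro divide_right_mono_ennreal a)
    also have "\<dots> = ennreal a"
      using lebesgue.pos[of "2 * r" c] lebesgue.fin[of c "2 * r"] r by (intro mult_divide_eq_ennreal) auto
    finally have 1: "avg (ball c (2 * r)) (\<lambda>x. ennreal (norm (T h x))) \<le> ennreal a" .
    have 2: "(INF x \<in> ball c r. HL_maximal h x) \<le> ennreal m"
      using y by (intro INF_lower2[of y]) (auto simp: HL_maximal_eq)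
    have "esssup ?M (\<lambda>x. ennreal (norm (T h x)))
         \<le> ennreal C * avg (ball c (2 * r)) (\<lambda>x. ennreal (norm (T h x)))
            + ennreal C * (INF x \<in> ball c r. HL_maximal h x)"
      using C[rule_format, OF r h zero] by simp
    also have "\<dots> \<le> ennreal \<bar>C\<bar> * ennreal a + ennreal \<bar>C\<bar> * ennreal m"
      by (intro add_mono mult_mono 1 2 ennreal_leI) auto
    also have "\<dots> = ennreal (\<bar>C\<bar> * (a + m))"
      using am by (simp add: ennreal_mult[symmetric] ennreal_plus[symmetric] distrib_left del: ennreal_plus)
    finally have *: "esssup ?M (\<lambda>x. ennreal (norm (T h x))) \<le> ennreal (\<bar>C\<bar> * (a + m))" .
    have "AE x in ?M. ennreal (norm (T h x)) \<le> esssup ?M (\<lambda>x. ennreal (norm (T h x)))" by (rule esssup_AE)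
    then have "AE x in ?M. norm (T h x) \<le> \<bar>C\<bar> * (a + m)"
    proof eventually_elim
      case (elim x)
      then have "ennreal (norm (T h x)) \<le> ennreal (\<bar>C\<bar> * (a + m))" using * by (rule order_trans)
      then show ?case using am by (simp add: ennreal_le_iff)
    qed
    then show "AE x in lebesgue. x \<in> ball c r \<longrightarrow> norm (T h x) \<le> \<bar>C\<bar> * (a + m)"
      by (subst (asm) AE_restrict_space_iff) auto
  qed simp
qed

text \<open>
  The square root of a function of weak type is integrable over its tails: cut the tail into the layers
  between \<open>4 ^ k * s\<^sup>2\<close> and \<open>4 ^ (k + 1) * s\<^sup>2\<close>; their contributions decay geometrically, as \<open>r \<ge> 1\<close>.
\<close>
lemma integral_sqrt_tail:
  fixes v :: "real ^ 'n \<Rightarrow> real"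
  assumes v[measurable]: "v \<in> borel_measurable lebesgue" "\<And>x. v x \<ge> 0" and r: "r \<ge> (1::nat)" and K: "K \<ge> 0"
    and weak: "\<And>t. t > 0 \<Longrightarrow> emeasure lebesgue {x. v x > t} \<le> ennreal (K / t ^ r)" and s: "s > 0"
  shows "(\<integral>\<^sup>+x\<in>{x. v x > s\<^sup>2}. ennreal (sqrt (v x)) \<partial>lebesgue) \<le> ennreal (4 * K * s / (s\<^sup>2) ^ r)"
proof -
  let ?A = "\<lambda>k :: nat. {x. v x > 4 ^ k * s\<^sup>2}"
  have [measurable]: "?A k \<in> sets lebesgue" for k by (intro superlevel_lebesgue v)
  have "(\<integral>\<^sup>+x\<in>{x. v x > s\<^sup>2}. ennreal (sqrt (v x)) \<partial>lebesgue) \<le> (\<integral>\<^sup>+x. (\<Sum>k. ennreal (2 ^ Suc k * s) * indicator (?A k) x) \<partial>lebesgue)"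
  proof (intro nn_integral_mono)
    fix x
    show "ennreal (sqrt (v x)) * indicator {x. v x > s\<^sup>2} x \<le> (\<Sum>k. ennreal (2 ^ Suc k * s) * indicator (?A k) x)"
    proof (cases "v x > s\<^sup>2")
      case True
      obtain k0 where "v x / s\<^sup>2 < 4 ^ k0" using real_arch_pow[of 4] by auto
      moreover have "4 ^ k0 \<le> (4 :: real) ^ Suc k0" by simp
      ultimately have "v x / s\<^sup>2 \<le> 4 ^ Suc k0" by linarith
      then have ex: "\<exists>k. v x \<le> 4 ^ Suc k * s\<^sup>2" using s by (intro exI[of _ k0]) (simp add: field_simps)
      define k where "k = (LEAST k. v x \<le> 4 ^ Suc k * s\<^sup>2)"
      have k: "v x \<le> 4 ^ Suc k * s\<^sup>2" unfolding k_def by (rule LeastI_ex[OF ex])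
      have "v x > 4 ^ k * s\<^sup>2"
      proof (cases k)
        case (Suc i)
        then have "\<not> v x \<le> 4 ^ Suc i * s\<^sup>2" using not_less_Least[of i "\<lambda>k. v x \<le> 4 ^ Suc k * s\<^sup>2"] by (simp add: k_def)
        then show ?thesis using Suc by simp
      qed (use True in simp)
      moreover have "sqrt (v x) \<le> 2 ^ Suc k * s"
      proof -
        have "(2 ^ Suc k)\<^sup>2 = ((2 :: real)\<^sup>2) ^ Suc k" by (simp only: power_mult[symmetric] mult.commute)
        then have "(2 ^ Suc k * s)\<^sup>2 = 4 ^ Suc k * s\<^sup>2" by (simp add: power_mult_distrib)
        then have "sqrt (v x) \<le> sqrt ((2 ^ Suc k * s)\<^sup>2)" using k by (intro real_sqrt_le_mono) (simp only:)
        also have "\<dots> = 2 ^ Suc k * s" using s by (simp only: real_sqrt_abs) simp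
        finally show ?thesis .
      qed
      ultimately have "ennreal (sqrt (v x)) \<le> ennreal (2 ^ Suc k * s) * indicator (?A k) x"
        by (simp add: ennreal_leI)
      also have "\<dots> \<le> (\<Sum>k. ennreal (2 ^ Suc k * s) * indicator (?A k) x)"
      proof -
        define g where "g = (\<lambda>k. ennreal (2 ^ Suc k * s) * indicator (?A k) x)"
        have "sum g {k} \<le> suminf g" by (intro sum_le_suminf) auto
        then have "g k \<le> suminf g" by simp
        then show ?thesis by (simp only: g_def)
      qed
      finally show ?thesis using True by simp
    qed simp
  qed
  also have "\<dots> = (\<Sum>k. ennreal (2 ^ Suc k * s) * emeasure lebesgue (?A k))"
    by (subst nn_integral_suminf) (auto simp: nn_integral_cmult_indicator)
  also have "\<dots> \<le> (\<Sum>k. ennreal (2 * K * s / (s\<^sup>2) ^ r * (1 / 2) ^ k))"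
  proof (intro suminf_le allI)
    fix k :: nat
    have "ennreal (2 ^ Suc k * s) * emeasure lebesgue (?A k) \<le> ennreal (2 ^ Suc k * s) * ennreal (K / (4 ^ k * s\<^sup>2) ^ r)"
      using s by (intro mult_left_mono weak) auto
    also have "\<dots> = ennreal (2 ^ Suc k * s * (K / (4 ^ k * s\<^sup>2) ^ r))"
      using s K by (intro ennreal_mult[symmetric]) auto
    also have "\<dots> \<le> ennreal (2 * K * s / (s\<^sup>2) ^ r * (1 / 2) ^ k)"
    proof (rule ennreal_leI)
      have "(4 ^ k :: real) ^ 1 \<le> (4 ^ k) ^ r" using r by (intro power_increasing) auto
      then have "2 ^ k / (4 ^ k) ^ r \<le> 2 ^ k / (4 ^ k :: real)" by (intro divide_left_mono) auto
      also have "2 ^ k / (4 ^ k :: real) = (1 / 2) ^ k" by (simp add: power_divide[symmetric])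
      finally have "2 * K * s / (s\<^sup>2) ^ r * (2 ^ k / (4 ^ k) ^ r) \<le> 2 * K * s / (s\<^sup>2) ^ r * (1 / 2) ^ k"
        using K s by (intro mult_left_mono) auto
      then show "2 ^ Suc k * s * (K / (4 ^ k * s\<^sup>2) ^ r) \<le> 2 * K * s / (s\<^sup>2) ^ r * (1 / 2) ^ k"
        by (simp add: power_mult_distrib ac_simps)
    qed
    finally show "ennreal (2 ^ Suc k * s) * emeasure lebesgue (?A k) \<le> ennreal (2 * K * s / (s\<^sup>2) ^ r * (1 / 2) ^ k)" .
  qed auto
  also have "\<dots> = ennreal (4 * K * s / (s\<^sup>2) ^ r)"
  proof (rule suminf_ennreal_eq)
    have "(\<lambda>k. 2 * K * s / (s\<^sup>2) ^ r * (1 / 2) ^ k) sums (2 * K * s / (s\<^sup>2) ^ r * (1 / (1 - 1 / 2)))"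
      by (intro sums_mult geometric_sums) simp
    moreover have "2 * K * s / (s\<^sup>2) ^ r * (1 / (1 - 1 / 2)) = 4 * K * s / (s\<^sup>2) ^ r" by simp
    ultimately show "(\<lambda>k. 2 * K * s / (s\<^sup>2) ^ r * (1 / 2) ^ k) sums (4 * K * s / (s\<^sup>2) ^ r)" by (simp only:)
  qed (use K s in auto)
  finally show ?thesis .
qed

text \<open>
  Kolmogorov's inequality for the exponent \<open>1 / 2\<close>. A function of weak type \<open>(1, 1)\<close> need not be locally
  integrable, but its square root is.
\<close>
lemma kolmogorov_sqrt:
  fixes v :: "real ^ 'n \<Rightarrow> real"
  assumes v[measurable]: "v \<in> borel_measurable lebesgue" "\<And>x. v x \<ge> 0" and r: "r \<ge> (1::nat)" and K: "K \<ge> 0"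
    and weak: "\<And>t. t > 0 \<Longrightarrow> emeasure lebesgue {x. v x > t} \<le> ennreal (K / t ^ r)" and s: "s > 0"
    and B[measurable]: "B \<in> sets lebesgue"
  shows "(\<integral>\<^sup>+x\<in>B. ennreal (sqrt (v x)) \<partial>lebesgue) \<le> ennreal s * emeasure lebesgue B + ennreal (4 * K * s / (s\<^sup>2) ^ r)"
proof -
  let ?A = "{x. v x > s\<^sup>2}"
  have [measurable]: "?A \<in> sets lebesgue" by (intro superlevel_lebesgue v)
  have "(\<integral>\<^sup>+x\<in>B. ennreal (sqrt (v x)) \<partial>lebesgue) \<le> (\<integral>\<^sup>+x. ennreal s * indicator B x + ennreal (sqrt (v x)) * indicator ?A x \<partial>lebesgue)"
  proof (intro nn_integral_mono)
    fix x
    have "sqrt (v x) \<le> s" if "\<not> v x > s\<^sup>2" using that s by (intro real_le_lsqrt) auto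
    then show "ennreal (sqrt (v x)) * indicator B x \<le> ennreal s * indicator B x + ennreal (sqrt (v x)) * indicator ?A x"
      by (auto simp: indicator_def intro: ennreal_leI)
  qed
  also have "\<dots> = ennreal s * emeasure lebesgue B + (\<integral>\<^sup>+x\<in>?A. ennreal (sqrt (v x)) \<partial>lebesgue)"
    by (subst nn_integral_add) (auto simp: nn_integral_cmult_indicator)
  also have "\<dots> \<le> ennreal s * emeasure lebesgue B + ennreal (4 * K * s / (s\<^sup>2) ^ r)"
    by (intro add_left_mono integral_sqrt_tail assms)
  finally show ?thesis .
qed

text \<open>
  The square of the maximal function of \<open>sqrt v\<close> has the same weak type as \<open>v\<close>. For \<open>r = 1\<close> this would be
  false for the maximal function of \<open>v\<close> itself, which is why the averages in condition (II) are replaced by averages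
  of square roots.
\<close>
lemma maximal_sqrt_weak_type:
  fixes v :: "real ^ 'n \<Rightarrow> real"
  assumes v[measurable]: "v \<in> borel_measurable lebesgue" "\<And>x. v x \<ge> 0" and r: "r \<ge> (1::nat)" and K: "K \<ge> 0"
    and weak: "\<And>t. t > 0 \<Longrightarrow> emeasure lebesgue {x. v x > t} \<le> ennreal (K / t ^ r)" and s: "s > 0"
  shows "emeasure lebesgue {x. ennreal (2 * s) < maximal lebesgue (\<lambda>x. ennreal (sqrt (v x))) x}
     \<le> ennreal (5 ^ CARD('n) * 4 * K / (s\<^sup>2) ^ r)"
proof -
  let ?S = "{x. ennreal (2 * s) < maximal lebesgue (\<lambda>x. ennreal (sqrt (v x))) x}"
  have 2: "2 * ennreal s = ennreal (2 * s)" using s by (simp add: ennreal_mult)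
  have "ennreal s * emeasure lebesgue ?S \<le> ennreal (5 ^ CARD('n)) * (\<integral>\<^sup>+x\<in>{x. ennreal s < ennreal (sqrt (v x))}. ennreal (sqrt (v x)) \<partial>lebesgue)"
    unfolding 2[symmetric] by (rule lebesgue.maximal_weak_type_truncated) simp
  also have "{x. ennreal s < ennreal (sqrt (v x))} = {x. v x > s\<^sup>2}"
  proof -
    have "s < sqrt (v x) \<longleftrightarrow> s\<^sup>2 < v x" for x using real_sqrt_less_iff[of "s\<^sup>2" "v x"] s by simp
    then show ?thesis using s by (simp add: ennreal_less_iff)
  qed
  also have "ennreal (5 ^ CARD('n)) * (\<integral>\<^sup>+x\<in>{x. v x > s\<^sup>2}. ennreal (sqrt (v x)) \<partial>lebesgue) \<le> ennreal (5 ^ CARD('n)) * ennreal (4 * K * s / (s\<^sup>2) ^ r)"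
    by (intro mult_left_mono integral_sqrt_tail assms) auto
  finally have "ennreal (1 / s) * (ennreal s * emeasure lebesgue ?S) \<le> ennreal (1 / s) * (ennreal (5 ^ CARD('n)) * ennreal (4 * K * s / (s\<^sup>2) ^ r))"
    by (rule mult_left_mono) simp
  then show ?thesis
    using s K by (simp add: mult.assoc[symmetric] ennreal_mult[symmetric])
qed

text \<open>
  In condition (II) the average of \<open>\<bar>T h\<bar>\<close> may be replaced by the square of the average of
  \<open>sqrt \<bar>T h\<bar>\<close>. Let \<open>S\<close> be such that \<open>\<bar>T h\<bar> \<le> S / (2 - s) ^ (2 * N)\<close> on the ball of radius \<open>s * r\<close>
  for all \<open>1 \<le> s < 2\<close>. Around a point of that ball, condition (II) on the radius \<open>(2 - s) * r / 4\<close> involves an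
  average over a ball inside the one of radius \<open>(s + 2) / 2 * r\<close>, where
  \<open>\<bar>T h\<bar> = sqrt \<bar>T h\<bar> * sqrt \<bar>T h\<bar>\<close> is at most the square root of the bound given by \<open>S\<close> times
  \<open>sqrt \<bar>T h\<bar>\<close>. The powers of \<open>2 - s\<close> match, and \<open>S\<close> can be replaced by a constant times
  \<open>sqrt S * \<alpha> + m\<close>, hence by \<open>S / 2 + D\<close>, where \<open>D\<close> is a constant times \<open>\<alpha>\<^sup>2 + m\<close>. Iterating leads
  to \<open>S = 2 * D\<close>.
\<close>
lemma (in L2_operator) cond_II_sqrt_bound:
  assumes "cond_II T"
  obtains C where "C \<ge> 0" "\<And>c r h \<alpha> m y. r > 0 \<Longrightarrow> h \<in> Linf_c \<Longrightarrow> (\<And>x. x \<in> ball c (8 * r) \<Longrightarrow> h x = 0) \<Longrightarrow>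
     \<alpha> \<ge> 0 \<Longrightarrow> m \<ge> 0 \<Longrightarrow>
     (\<integral>\<^sup>+x\<in>ball c (2 * r). ennreal (sqrt (norm (T h x))) \<partial>lebesgue) \<le> ennreal \<alpha> * emeasure lebesgue (ball c (2 * r)) \<Longrightarrow>
     y \<in> ball c r \<Longrightarrow> maximal lebesgue (\<lambda>x. ennreal (norm (h x))) y \<le> ennreal m \<Longrightarrow>
     AE x in lebesgue. x \<in> ball c r \<longrightarrow> norm (T h x) \<le> C * (\<alpha>\<^sup>2 + m)"
proof -
  define N where "N = CARD('n)"
  obtain C0 where C0: "C0 \<ge> 0" "\<And>c r h a m y. r > 0 \<Longrightarrow> h \<in> Linf_c \<Longrightarrow> (\<And>x. x \<in> ball c (4 * r) \<Longrightarrow> h x = 0) \<Longrightarrow>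
     a \<ge> 0 \<Longrightarrow> m \<ge> 0 \<Longrightarrow>
     (\<integral>\<^sup>+x\<in>ball c (2 * r). ennreal (norm (T h x)) \<partial>lebesgue) \<le> ennreal a * emeasure lebesgue (ball c (2 * r)) \<Longrightarrow>
     y \<in> ball c r \<Longrightarrow> maximal lebesgue (\<lambda>x. ennreal (norm (h x))) y \<le> ennreal m \<Longrightarrow>
     AE x in lebesgue. x \<in> ball c r \<longrightarrow> norm (T h x) \<le> C0 * (a + m)"
    by (rule cond_II_AE_bound[OF assms]) blast
  define C where "C = (C0 * 8 ^ N)\<^sup>2 + 2 * (C0 * 2 ^ N)"
  show thesis
  proof (rule that[of C])
    show "C \<ge> 0" using C0 by (simp add: C_def)
    fix c :: "real ^ 'n" and r \<alpha> m :: real and h y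
    assume r: "r > 0" and h: "h \<in> Linf_c" and zero: "\<And>x. x \<in> ball c (8 * r) \<Longrightarrow> h x = 0"
      and am: "\<alpha> \<ge> 0" "m \<ge> 0"
      and \<alpha>: "(\<integral>\<^sup>+x\<in>ball c (2 * r). ennreal (sqrt (norm (T h x))) \<partial>lebesgue) \<le> ennreal \<alpha> * emeasure lebesgue (ball c (2 * r))"
      and y: "y \<in> ball c r" "maximal lebesgue (\<lambda>x. ennreal (norm (h x))) y \<le> ennreal m"
    note [measurable] = T_measurable[OF h]
    define good where "good S \<longleftrightarrow> S \<ge> 0 \<and>
      (\<forall>s\<in>{1..<2}. AE x in lebesgue. x \<in> ball c (s * r) \<longrightarrow> norm (T h x) \<le> S / (2 - s) ^ (2 * N))" for S
    have small: "ball x0 (2 * ((2 - s) * r / 4)) \<subseteq> ball c ((s + 2) / 2 * r)"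
      "ball x0 (4 * ((2 - s) * r / 4)) \<subseteq> ball c (2 * r)"
      if "x0 \<in> ball c (s * r)" "s < 2" for x0 s
    proof -
      have *: "dist x0 c < s * r" using that by (simp add: dist_commute)
      have "dist x0 c + 2 * ((2 - s) * r / 4) \<le> (s + 2) / 2 * r" using * by (simp add: field_simps)
      then show "ball x0 (2 * ((2 - s) * r / 4)) \<subseteq> ball c ((s + 2) / 2 * r)" by (simp add: ball_subset_ball_iff)
      have "dist x0 c + 4 * ((2 - s) * r / 4) \<le> 2 * r" using * by (simp add: field_simps)
      then show "ball x0 (4 * ((2 - s) * r / 4)) \<subseteq> ball c (2 * r)" by (simp add: ball_subset_ball_iff)
    qed
    have vol: "emeasure lebesgue (ball c (2 * r)) = ennreal ((4 / (2 - s)) ^ N) * emeasure lebesgue (ball x0 (2 * ((2 - s) * r / 4)))"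
      if "s < 2" for s and x0 :: "real ^ 'n"
    proof -
      have "4 / (2 - s) * (2 * ((2 - s) * r / 4)) = 2 * r" using that by simp
      then show ?thesis
        using emeasure_lebesgue_ball_scale[of "4 / (2 - s)" "2 * ((2 - s) * r / 4)" c x0] that r by (simp add: N_def)
    qed
    have goodI: "good (C0 * (R + 2 ^ N * m))"
      if R: "R \<ge> 0" and avg: "\<And>s x0. 1 \<le> s \<Longrightarrow> s < 2 \<Longrightarrow> x0 \<in> ball c (s * r) \<Longrightarrow>
        (\<integral>\<^sup>+x\<in>ball x0 (2 * ((2 - s) * r / 4)). ennreal (norm (T h x)) \<partial>lebesgue)
          \<le> ennreal (R / (2 - s) ^ (2 * N)) * emeasure lebesgue (ball x0 (2 * ((2 - s) * r / 4)))" for R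
      unfolding good_def
    proof (intro conjI ballI)
      show "0 \<le> C0 * (R + 2 ^ N * m)" using C0 R am by simp
      fix s :: real assume "s \<in> {1..<2}"
      then have s: "1 \<le> s" "s < 2" by auto
      show "AE x in lebesgue. x \<in> ball c (s * r) \<longrightarrow> norm (T h x) \<le> C0 * (R + 2 ^ N * m) / (2 - s) ^ (2 * N)"
      proof (rule AE_of_locally)
        fix x0 assume x0: "x0 \<in> ball c (s * r)"
        let ?\<rho> = "(2 - s) * r / 4"
        have \<rho>: "?\<rho> > 0" using s r by simp
        have x0': "x0 \<in> ball c (2 * r)" using x0 s r subset_ball[of "s * r" "2 * r" c] by (auto simp del: mem_ball)
        have "ball c (2 * r) \<subseteq> ball c (8 * r)" using r by (intro subset_ball) simp
        then have "h x = 0" if "x \<in> ball x0 (4 * ?\<rho>)" for x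
          using zero small(2)[OF x0 s(2)] that by blast
        moreover have "maximal lebesgue (\<lambda>x. ennreal (norm (h x))) x0 \<le> ennreal (2 ^ N * m)"
        proof -
          have "maximal lebesgue (\<lambda>x. ennreal (norm (h x))) x0 \<le> ennreal (2 ^ N) * maximal lebesgue (\<lambda>x. ennreal (norm (h x))) y"
            unfolding N_def by (rule maximal_comparable_off_support[OF zero y(1) x0'])
          also have "\<dots> \<le> ennreal (2 ^ N) * ennreal m" by (intro mult_left_mono y) auto
          also have "\<dots> = ennreal (2 ^ N * m)" using am by (intro ennreal_mult[symmetric]) auto
          finally show ?thesis .
        qed
        ultimately have "AE x in lebesgue. x \<in> ball x0 ?\<rho> \<longrightarrow> norm (T h x) \<le> C0 * (R / (2 - s) ^ (2 * N) + 2 ^ N * m)"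
          using R am s r \<rho> by (intro C0(2)[OF \<rho> h _ _ _ avg[OF s x0], of "2 ^ N * m" x0]) auto
        moreover have "C0 * (R / (2 - s) ^ (2 * N) + 2 ^ N * m) \<le> C0 * (R + 2 ^ N * m) / (2 - s) ^ (2 * N)"
        proof -
          have "(2 - s) ^ (2 * N) \<le> 1" using s by (intro power_le_one) auto
          then have "2 ^ N * m \<le> 2 ^ N * m / (2 - s) ^ (2 * N)"
            using am s mult_left_mono[of "(2 - s) ^ (2 * N)" 1 "2 ^ N * m"] by (simp add: pos_le_divide_eq)
          then have "R / (2 - s) ^ (2 * N) + 2 ^ N * m \<le> (R + 2 ^ N * m) / (2 - s) ^ (2 * N)"
            by (simp add: add_divide_distrib)
          then show ?thesis using C0(1) mult_left_mono by fastforce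
        qed
        ultimately show "\<exists>e>0. AE x in lebesgue. x \<in> ball x0 e \<longrightarrow> norm (T h x) \<le> C0 * (R + 2 ^ N * m) / (2 - s) ^ (2 * N)"
          using \<rho> by (intro exI[of _ ?\<rho>]) (auto elim!: eventually_mono)
      qed
    qed
    \<comment> \<open>Some finite \<open>S\<close> is needed to start the iteration. As \<open>T h\<close> is square integrable, its averages are
      finite, and condition (II) provides one. It depends on \<open>h\<close>; the
      iteration removes this dependence.\<close>
    have "\<exists>S. good S"
    proof -
      have "(\<integral>\<^sup>+x\<in>ball c (2 * r). ennreal (norm (T h x)) \<partial>lebesgue) \<le> (\<integral>\<^sup>+x. indicator (ball c (2 * r)) x + ennreal (norm (T h x) ^ 2) \<partial>lebesgue)"
      proof (intro nn_integral_mono)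
        fix x
        have "norm (T h x) \<le> 1 + norm (T h x) ^ 2"
          using sum_squares_bound[of 1 "norm (T h x)"] by (simp add: power2_eq_square) (smt (verit) zero_le_square norm_ge_zero)
        then have "ennreal (norm (T h x)) \<le> ennreal (1 + norm (T h x) ^ 2)" by (rule ennreal_leI)
        then have "ennreal (norm (T h x)) \<le> 1 + ennreal (norm (T h x) ^ 2)" by simp
        then show "ennreal (norm (T h x)) * indicator (ball c (2 * r)) x \<le> indicator (ball c (2 * r)) x + ennreal (norm (T h x) ^ 2)"
          by (auto simp: indicator_def)
      qed
      also have "\<dots> = emeasure lebesgue (ball c (2 * r)) + (\<integral>\<^sup>+x. ennreal (norm (T h x) ^ 2) \<partial>lebesgue)"
        by (subst nn_integral_add) auto
      also have "\<dots> < \<infinity>"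
      proof -
        obtain K where "(\<integral>\<^sup>+x. ennreal (norm (T h x) ^ 2) \<partial>lebesgue) \<le> ennreal K * (\<integral>\<^sup>+x. ennreal (norm (h x) ^ 2) \<partial>lebesgue)"
          using L2_bound h by blast
        moreover have "(\<integral>\<^sup>+x. ennreal (norm (h x) ^ 2) \<partial>lebesgue) < \<infinity>"
          using Linf_c_integral_power_finite[OF h, of 1] by (simp only: Suc_1)
        ultimately have "(\<integral>\<^sup>+x. ennreal (norm (T h x) ^ 2) \<partial>lebesgue) < \<infinity>"
          by (metis ennreal_less_top ennreal_mult_less_top infinity_ennreal_def le_less_trans)
        then show ?thesis using lebesgue.fin[of c "2 * r"] by (simp add: ennreal_add_less_top)
      qed
      finally obtain i where i: "(\<integral>\<^sup>+x\<in>ball c (2 * r). ennreal (norm (T h x)) \<partial>lebesgue) = ennreal i" "i \<ge> 0"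
        by (cases "\<integral>\<^sup>+x\<in>ball c (2 * r). ennreal (norm (T h x)) \<partial>lebesgue") auto
      obtain b where b: "emeasure lebesgue (ball c (2 * r)) = ennreal b" "b > 0"
        using lebesgue.pos[of "2 * r" c] lebesgue.fin[of c "2 * r"] r by (cases "emeasure lebesgue (ball c (2 * r))") auto
      have "good (C0 * (4 ^ N * i / b + 2 ^ N * m))"
      proof (rule goodI)
        show "4 ^ N * i / b \<ge> 0" using i b by simp
        fix s x0 assume s: "1 \<le> s" "s < 2" and x0: "x0 \<in> ball c (s * r)"
        have "ball x0 (2 * ((2 - s) * r / 4)) \<subseteq> ball c (2 * r)"
          using small(2)[OF x0 s(2)] r s subset_ball[of "2 * ((2 - s) * r / 4)" "4 * ((2 - s) * r / 4)" x0] by auto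
        then have "(\<integral>\<^sup>+x\<in>ball x0 (2 * ((2 - s) * r / 4)). ennreal (norm (T h x)) \<partial>lebesgue) \<le> ennreal i"
          unfolding i(1)[symmetric] by (intro nn_integral_mono) (auto simp: indicator_def)
        also have "ennreal i = ennreal (i / b) * emeasure lebesgue (ball c (2 * r))"
          using i b by (simp add: ennreal_mult[symmetric])
        also have "\<dots> = ennreal (i / b) * ennreal ((4 / (2 - s)) ^ N) * emeasure lebesgue (ball x0 (2 * ((2 - s) * r / 4)))"
          by (simp add: vol[OF s(2), of x0] mult.assoc)
        also have "\<dots> \<le> ennreal (4 ^ N * i / b / (2 - s) ^ (2 * N)) * emeasure lebesgue (ball x0 (2 * ((2 - s) * r / 4)))"
        proof (intro mult_right_mono)
          have "(2 - s) ^ (2 * N) \<le> (2 - s) ^ N" using s by (intro power_decreasing) auto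
          then have "4 ^ N * i / b / (2 - s) ^ N \<le> 4 ^ N * i / b / (2 - s) ^ (2 * N)"
            using i b s by (intro divide_left_mono mult_pos_pos) auto
          then show "ennreal (i / b) * ennreal ((4 / (2 - s)) ^ N) \<le> ennreal (4 ^ N * i / b / (2 - s) ^ (2 * N))"
            using i b s by (simp add: ennreal_mult[symmetric] power_divide ac_simps ennreal_leI)
        qed simp
        finally show "(\<integral>\<^sup>+x\<in>ball x0 (2 * ((2 - s) * r / 4)). ennreal (norm (T h x)) \<partial>lebesgue)
          \<le> ennreal (4 ^ N * i / b / (2 - s) ^ (2 * N)) * emeasure lebesgue (ball x0 (2 * ((2 - s) * r / 4)))" .
      qed
      then show ?thesis ..
    qed
    then obtain S0 where S0: "good S0" ..
    define D where "D = (C0 * 8 ^ N)\<^sup>2 * \<alpha>\<^sup>2 / 2 + C0 * 2 ^ N * m"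
    have D0: "D \<ge> 0" using C0 am by (simp add: D_def)
    have mono: "good S'" if "good S" "S \<le> S'" for S S'
      unfolding good_def
    proof (intro conjI ballI)
      show "0 \<le> S'" using that by (auto simp: good_def)
      fix s :: real assume s: "s \<in> {1..<2}"
      then have le: "S / (2 - s) ^ (2 * N) \<le> S' / (2 - s) ^ (2 * N)" using that by (intro divide_right_mono) auto
      have "AE x in lebesgue. x \<in> ball c (s * r) \<longrightarrow> norm (T h x) \<le> S / (2 - s) ^ (2 * N)"
        using that s by (auto simp: good_def)
      then show "AE x in lebesgue. x \<in> ball c (s * r) \<longrightarrow> norm (T h x) \<le> S' / (2 - s) ^ (2 * N)"
        by eventually_elim (use le in auto)
    qed
    have step: "good (S / 2 + D)" if S: "good S" for S
    proof -
      have S0: "S \<ge> 0" using S by (simp add: good_def)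
      have "good (C0 * (sqrt S * \<alpha> * 8 ^ N + 2 ^ N * m))"
      proof (rule goodI)
        show "sqrt S * \<alpha> * 8 ^ N \<ge> 0" using S0 am by simp
        fix s x0 assume s: "1 \<le> s" "s < 2" and x0: "x0 \<in> ball c (s * r)"
        let ?B = "ball x0 (2 * ((2 - s) * r / 4))"
        define t where "t = (s + 2) / 2"
        have t: "1 \<le> t" "t < 2" "2 - t = (2 - s) / 2" using s by (auto simp: t_def field_simps)
        define \<sigma> where "\<sigma> = sqrt S / (2 - t) ^ N"
        have \<sigma>: "\<sigma> \<ge> 0" using S0 t by (simp add: \<sigma>_def)
        have \<sigma>2: "sqrt (S / (2 - t) ^ (2 * N)) = \<sigma>"
        proof -
          have "S / (2 - t) ^ (2 * N) = \<sigma>\<^sup>2"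
            using S0 by (simp add: \<sigma>_def power_divide power_mult[symmetric] mult.commute)
          then show ?thesis using \<sigma> by simp
        qed
        have sub: "?B \<subseteq> ball c (t * r)" "?B \<subseteq> ball c (2 * r)"
          using small(1)[OF x0 s(2)] subset_ball[of "t * r" "2 * r" c] t r by (auto simp: t_def)
        have "AE x in lebesgue. x \<in> ball c (t * r) \<longrightarrow> norm (T h x) \<le> S / (2 - t) ^ (2 * N)"
          using S t by (auto simp: good_def)
        then have "AE x in lebesgue. ennreal (norm (T h x)) * indicator ?B x \<le> ennreal \<sigma> * (ennreal (sqrt (norm (T h x))) * indicator (ball c (2 * r)) x)"
        proof eventually_elim
          case (elim x)
          show ?case
          proof (cases "x \<in> ?B")
            case True
            then have "norm (T h x) \<le> S / (2 - t) ^ (2 * N)" using elim sub by blast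
            then have "sqrt (norm (T h x)) \<le> \<sigma>" using \<sigma>2 by (metis real_sqrt_le_mono)
            then have "norm (T h x) \<le> \<sigma> * sqrt (norm (T h x))"
              using mult_right_mono[of "sqrt (norm (T h x))" \<sigma> "sqrt (norm (T h x))"] by simp
            then show ?thesis using True sub \<sigma> by (auto simp: ennreal_mult[symmetric] indicator_def intro!: ennreal_leI)
          qed simp
        qed
        then have "(\<integral>\<^sup>+x\<in>?B. ennreal (norm (T h x)) \<partial>lebesgue) \<le> (\<integral>\<^sup>+x. ennreal \<sigma> * (ennreal (sqrt (norm (T h x))) * indicator (ball c (2 * r)) x) \<partial>lebesgue)"
          by (rule nn_integral_mono_AE)
        also have "\<dots> = ennreal \<sigma> * (\<integral>\<^sup>+x\<in>ball c (2 * r). ennreal (sqrt (norm (T h x))) \<partial>lebesgue)"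
          by (rule nn_integral_cmult) measurable
        also have "\<dots> \<le> ennreal \<sigma> * (ennreal \<alpha> * (ennreal ((4 / (2 - s)) ^ N) * emeasure lebesgue ?B))"
          using \<alpha> by (intro mult_left_mono) (auto simp only: vol[OF s(2), of x0] zero_le)
        also have "\<dots> = ennreal (\<sigma> * \<alpha> * (4 / (2 - s)) ^ N) * emeasure lebesgue ?B"
          using \<sigma> am s by (simp add: ennreal_mult mult.assoc)
        also have "\<sigma> * \<alpha> * (4 / (2 - s)) ^ N = sqrt S * \<alpha> * 8 ^ N / (2 - s) ^ (2 * N)"
        proof -
          have "8 ^ N = (2 :: real) ^ N * 4 ^ N" by (simp add: power_mult_distrib[symmetric])
          then show ?thesis
            unfolding \<sigma>_def t(3) by (simp add: power_divide mult_2 power_add)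
        qed
        finally show "(\<integral>\<^sup>+x\<in>?B. ennreal (norm (T h x)) \<partial>lebesgue) \<le> ennreal (sqrt S * \<alpha> * 8 ^ N / (2 - s) ^ (2 * N)) * emeasure lebesgue ?B" .
      qed
      moreover have "C0 * (sqrt S * \<alpha> * 8 ^ N + 2 ^ N * m) \<le> S / 2 + D"
      proof -
        have "2 * (sqrt S * (C0 * 8 ^ N * \<alpha>)) \<le> (sqrt S)\<^sup>2 + (C0 * 8 ^ N * \<alpha>)\<^sup>2"
          using sum_squares_bound[of "sqrt S" "C0 * 8 ^ N * \<alpha>"] by simp
        then show ?thesis using S0 by (simp add: D_def algebra_simps power_mult_distrib)
      qed
      ultimately show ?thesis by (rule mono)
    qed
    have goodk: "good (2 * D + S0 / 2 ^ k)" for k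
    proof (induction k)
      case 0
      then show ?case using S0 D0 by (intro mono[OF S0]) simp
    next
      case (Suc k)
      have "(2 * D + S0 / 2 ^ k) / 2 + D = 2 * D + S0 / 2 ^ Suc k" by simp
      then show ?case using step[OF Suc] by (simp only:)
    qed
    have "AE x in lebesgue. x \<in> ball c (1 * r) \<longrightarrow> norm (T h x) \<le> (2 * D + S0 / 2 ^ k) / (2 - 1) ^ (2 * N)" for k
    proof -
      have "\<forall>s\<in>{1..<2}. AE x in lebesgue. x \<in> ball c (s * r) \<longrightarrow> norm (T h x) \<le> (2 * D + S0 / 2 ^ k) / (2 - s) ^ (2 * N)"
        using goodk[of k] unfolding good_def by blast
      from bspec[OF this, of 1] show ?thesis by simp
    qed
    then have "AE x in lebesgue. \<forall>k. x \<in> ball c r \<longrightarrow> norm (T h x) \<le> 2 * D + S0 / 2 ^ k"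
      by (subst AE_all_countable) simp
    then show "AE x in lebesgue. x \<in> ball c r \<longrightarrow> norm (T h x) \<le> C * (\<alpha>\<^sup>2 + m)"
    proof eventually_elim
      case (elim x)
      have lim: "(\<lambda>k. 2 * D + S0 * (1 / 2) ^ k) \<longlonglongrightarrow> 2 * D + S0 * 0"
        by (intro tendsto_intros LIMSEQ_power_zero) simp
      have "2 * D \<le> C * (\<alpha>\<^sup>2 + m)"
        using C0(1) am by (simp add: C_def D_def algebra_simps add_nonneg_nonneg)
      moreover have "norm (T h x) \<le> 2 * D" if "x \<in> ball c r"
        using elim that by (intro LIMSEQ_le_const[OF lim[simplified]]) (auto simp: power_divide)
      ultimately show ?case by auto
    qed
  qed
qed

section \<open>Sparse domination\<close>

text \<open>
  The operator is studied on a cell through the restriction of \<open>f\<close> to the eightfold ball. What is cut off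
  vanishes on that ball, as the self-improved condition (II) requires.
\<close>
definition localize :: "real \<Rightarrow> (real ^ 'n \<Rightarrow> complex) \<Rightarrow> nat \<Rightarrow> real ^ 'n \<Rightarrow> real ^ 'n \<Rightarrow> complex" where
  "localize L f k x = restr (cell_ball L 8 k x) f"

definition local_mean :: "real \<Rightarrow> nat \<Rightarrow> (real ^ 'n \<Rightarrow> complex) \<Rightarrow> nat \<Rightarrow> real ^ 'n \<Rightarrow> real" where
  "local_mean L r f k x = root r (enn2real (avg (cell_ball L 8 k x) (\<lambda>y. ennreal (norm (f y) ^ r))))"

lemma cell_ball_lebesgue[measurable]: "cell_ball L m k x \<in> sets lebesgue"
  by (simp add: cell_ball_def)

lemma Linf_c_power_finite:
  assumes "f \<in> Linf_c" "r \<ge> 1"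
  shows "(\<integral>\<^sup>+x. ennreal (norm (f x) ^ r) \<partial>lebesgue) < \<infinity>"
  using Linf_c_integral_power_finite[OF assms(1), of "r - 1"] assms(2) by simp

lemma local_mean_nonneg: "r \<ge> 1 \<Longrightarrow> local_mean L r f k x \<ge> 0"
  by (simp add: local_mean_def)

lemma local_mean_power:
  assumes L: "L > 0" and f: "f \<in> Linf_c" and r: "r \<ge> 1"
  shows "(\<integral>\<^sup>+y\<in>cell_ball L 8 k x. ennreal (norm (f y) ^ r) \<partial>lebesgue) =
    ennreal (local_mean L r f k x ^ r) * emeasure lebesgue (cell_ball L 8 k (x :: real ^ 'n))"
proof -
  let ?B = "cell_ball L 8 k x"
  let ?I = "\<integral>\<^sup>+y\<in>?B. ennreal (norm (f y) ^ r) \<partial>lebesgue"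
  have "?I \<le> (\<integral>\<^sup>+y. ennreal (norm (f y) ^ r) \<partial>lebesgue)" by (intro nn_integral_mono) (auto simp: indicator_def)
  then have I: "?I < \<infinity>" using Linf_c_power_finite[OF f r] by (rule le_less_trans)
  have "8 * (4 * real CARD('n) * L / 2 ^ k) > 0" using L by simp
  then have B: "0 < emeasure lebesgue ?B" "emeasure lebesgue ?B < \<infinity>"
    unfolding cell_ball_def by (simp_all only: lebesgue.pos lebesgue.fin)
  then obtain b where b: "emeasure lebesgue ?B = ennreal b" "b > 0" by (cases "emeasure lebesgue ?B") auto
  obtain i where i: "?I = ennreal i" "i \<ge> 0" using I by (cases ?I) auto
  have "avg ?B (\<lambda>y. ennreal (norm (f y) ^ r)) = ennreal (i / b)"
    unfolding avg_def i(1) b(1) using i b by (simp add: divide_ennreal)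
  then have "local_mean L r f k x ^ r = i / b" using i b r by (simp add: local_mean_def)
  then show ?thesis using i b by (simp add: ennreal_mult[symmetric])
qed

text \<open>
  Where \<open>\<bar>F\<bar>\<close> exceeds \<open>A\<close>, it is at most \<open>\<bar>F\<bar> ^ r / A ^ (r - 1)\<close>. This replaces Jensen's inequality,
  with a factor \<open>2\<close>.
\<close>
lemma maximal_le_of_maximal_power_le:
  fixes F :: "real ^ 'n \<Rightarrow> complex"
  assumes F[measurable]: "F \<in> borel_measurable lebesgue" and A: "A > 0" and r: "r \<ge> (1::nat)"
    and y: "maximal lebesgue (\<lambda>x. ennreal (norm (F x) ^ r)) y \<le> ennreal (A ^ r)"
  shows "maximal lebesgue (\<lambda>x. ennreal (norm (F x))) y \<le> ennreal (2 * A)"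
proof (rule lebesgue.maximal_leI)
  fix c s assume s: "s > 0" "y \<in> ball c s"
  have pt: "norm (F x) \<le> A + 1 / A ^ (r - 1) * norm (F x) ^ r" for x
  proof (cases "norm (F x) \<le> A")
    case False
    then have "A ^ (r - 1) * norm (F x) \<le> norm (F x) ^ (r - 1) * norm (F x)"
      using A by (intro mult_right_mono power_mono) auto
    also have "\<dots> = norm (F x) ^ r" using r by (metis Suc_diff_le diff_Suc_1 mult.commute power_Suc One_nat_def)
    finally have "norm (F x) \<le> norm (F x) ^ r / A ^ (r - 1)" using A by (simp add: pos_le_divide_eq mult.commute)
    then show ?thesis using A by simp
  qed (use A in \<open>simp add: add_increasing2\<close>)
  have "(\<integral>\<^sup>+x\<in>ball c s. ennreal (norm (F x)) \<partial>lebesgue) \<le>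
      (\<integral>\<^sup>+x. ennreal A * indicator (ball c s) x + ennreal (1 / A ^ (r - 1)) * (ennreal (norm (F x) ^ r) * indicator (ball c s) x) \<partial>lebesgue)"
  proof (intro nn_integral_mono)
    fix x
    have "ennreal (norm (F x)) \<le> ennreal (A + 1 / A ^ (r - 1) * norm (F x) ^ r)" by (rule ennreal_leI[OF pt])
    also have "\<dots> = ennreal A + ennreal (1 / A ^ (r - 1)) * ennreal (norm (F x) ^ r)"
      using A by (subst ennreal_plus) (auto simp: ennreal_mult[symmetric])
    finally show "ennreal (norm (F x)) * indicator (ball c s) x \<le> ennreal A * indicator (ball c s) x + ennreal (1 / A ^ (r - 1)) * (ennreal (norm (F x) ^ r) * indicator (ball c s) x)"
      by (auto simp: indicator_def)
  qed
  also have "\<dots> = ennreal A * emeasure lebesgue (ball c s) + ennreal (1 / A ^ (r - 1)) * (\<integral>\<^sup>+x\<in>ball c s. ennreal (norm (F x) ^ r) \<partial>lebesgue)"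
    by (subst nn_integral_add) (auto simp: nn_integral_cmult_indicator nn_integral_cmult)
  also have "\<dots> \<le> ennreal A * emeasure lebesgue (ball c s) + ennreal (1 / A ^ (r - 1)) * (ennreal (A ^ r) * emeasure lebesgue (ball c s))"
    by (intro add_left_mono mult_left_mono order_trans[OF lebesgue.average_le_maximal[OF s(2)]] mult_right_mono y) auto
  also have "\<dots> = ennreal (A + 1 / A ^ (r - 1) * A ^ r) * emeasure lebesgue (ball c s)"
    using A by (simp add: ennreal_mult distrib_right mult.assoc del: times_divide_eq_left)
  also have "A + 1 / A ^ (r - 1) * A ^ r = 2 * A"
  proof -
    have "A ^ r = A * A ^ (r - 1)" using r by (cases r) auto
    then show ?thesis using A by simp
  qed
  finally show "(\<integral>\<^sup>+x\<in>ball c s. ennreal (norm (F x)) \<partial>lebesgue) \<le> ennreal (2 * A) * emeasure lebesgue (ball c s)" .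
qed

text \<open>
  Here \<open>F\<close> is the localization of \<open>f\<close> to a cell of measure \<open>q\<close>, \<open>u\<close> is \<open>\<bar>T F\<bar>\<close>, and \<open>a\<close> is the local
  mean. Three quantities are at most \<open>\<Lambda> * a\<close>, in the appropriate normalization, outside an open set of at most
  half the measure of the cell. For a large \<open>\<Lambda>\<close> each of the three weak-type bounds, and the passage to an open
  superset, costs at most \<open>q / 8\<close>.
\<close>
lemma exceptional_set:
  fixes F :: "real ^ 'n \<Rightarrow> complex" and u :: "real ^ 'n \<Rightarrow> real"
  assumes u[measurable]: "u \<in> borel_measurable lebesgue" "\<And>x. u x \<ge> 0"
    and F[measurable]: "F \<in> borel_measurable lebesgue"
    and r: "r \<ge> (1::nat)" and a: "a > 0" and C: "C \<ge> 0" and \<kappa>: "\<kappa> \<ge> 0" and q: "q > 0"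
    and int: "(\<integral>\<^sup>+x. ennreal (norm (F x) ^ r) \<partial>lebesgue) = ennreal (a ^ r * \<kappa> * q)"
    and weak: "\<And>t. t > 0 \<Longrightarrow> emeasure lebesgue {x. u x > t} \<le> ennreal (C * (a ^ r * \<kappa> * q) / t ^ r)"
    and \<Lambda>: "\<Lambda> = 1 + 32 * 5 ^ CARD('n) * 4 ^ r * (C + 1) * \<kappa>"
  obtains E where "open E" "emeasure lebesgue E \<le> ennreal (q / 2)"
    "\<And>x. x \<notin> E \<Longrightarrow> u x \<le> \<Lambda> * a"
    "\<And>x. x \<notin> E \<Longrightarrow> maximal lebesgue (\<lambda>x. ennreal (sqrt (u x))) x \<le> ennreal (sqrt (\<Lambda> * a))"
    "\<And>x. x \<notin> E \<Longrightarrow> maximal lebesgue (\<lambda>x. ennreal (norm (F x) ^ r)) x \<le> ennreal ((\<Lambda> * a) ^ r)"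
proof -
  have \<Lambda>1: "\<Lambda> \<ge> 1" using C \<kappa> by (simp add: \<Lambda>)
  define A where "A = \<Lambda> * a"
  have A: "A > 0" using \<Lambda>1 a by (simp add: A_def)
  have \<Lambda>r: "\<Lambda> \<le> \<Lambda> ^ r" using power_increasing[of 1 r \<Lambda>] r \<Lambda>1 by simp
  have small: "d * (a ^ r * \<kappa> * q) / A ^ r \<le> q / 8"
    if "0 \<le> d" "d \<le> 4 * 5 ^ CARD('n) * 4 ^ r * (C + 1)" for d
  proof -
    have "d * \<kappa> \<le> 4 * 5 ^ CARD('n) * 4 ^ r * (C + 1) * \<kappa>" using that \<kappa> by (intro mult_right_mono) auto
    then have "8 * (d * \<kappa>) \<le> \<Lambda>" by (simp add: \<Lambda>)
    also note \<Lambda>r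
    finally have "8 * (d * \<kappa>) * q \<le> \<Lambda> ^ r * q" using q by (intro mult_right_mono) auto
    then have "d * \<kappa> * q / \<Lambda> ^ r \<le> q / 8" using \<Lambda>1 by (simp add: field_simps)
    moreover have "d * (a ^ r * \<kappa> * q) / A ^ r = d * \<kappa> * q / \<Lambda> ^ r"
      using a by (simp add: A_def power_mult_distrib)
    ultimately show ?thesis by simp
  qed
  have one: "1 \<le> 5 ^ CARD('n) * (4 :: real) ^ r"
    using mult_mono[of 1 "5 ^ CARD('n)" 1 "(4 :: real) ^ r"] by simp
  have c1: "C \<le> 4 * 5 ^ CARD('n) * 4 ^ r * (C + 1)"
    using mult_mono[of 1 "5 ^ CARD('n) * (4 :: real) ^ r" C "C + 1"] one C by simp
  have c2: "5 ^ CARD('n) * 4 * C * 4 ^ r \<le> 4 * 5 ^ CARD('n) * 4 ^ r * (C + 1)"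
    by (simp add: algebra_simps)
  have c3: "5 ^ CARD('n) \<le> 4 * 5 ^ CARD('n) * 4 ^ r * (C + 1)"
  proof -
    have "1 \<le> (4 :: real) ^ r * (C + 1)" using mult_mono[of 1 "(4 :: real) ^ r" 1 "C + 1"] C by simp
    then have "5 ^ CARD('n) * 1 \<le> 5 ^ CARD('n) * (4 * (4 ^ r * (C + 1)))" by (intro mult_left_mono) auto
    then show ?thesis by (simp add: ac_simps)
  qed
  let ?E1 = "{x. u x > A}" and ?E2 = "{x. ennreal (2 * (sqrt A / 2)) < maximal lebesgue (\<lambda>x. ennreal (sqrt (u x))) x}"
    and ?E3 = "{x. ennreal (A ^ r) < maximal lebesgue (\<lambda>x. ennreal (norm (F x) ^ r)) x}"
  have E1: "?E1 \<in> sets lebesgue" by (intro superlevel_lebesgue u)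
  have "emeasure lebesgue ?E1 \<le> ennreal (C * (a ^ r * \<kappa> * q) / A ^ r)" by (rule weak[OF A])
  also have "\<dots> \<le> ennreal (q / 8)" by (intro ennreal_leI small C c1)
  finally have m1: "emeasure lebesgue ?E1 \<le> ennreal (q / 8)" .
  obtain U where U: "open U" "?E1 \<subseteq> U" "emeasure lebesgue U \<le> emeasure lebesgue ?E1 + ennreal (q / 8)"
    using open_superset_small[OF E1, of "q / 8"] q by auto
  have "emeasure lebesgue ?E2 \<le> ennreal (5 ^ CARD('n) * 4 * (C * (a ^ r * \<kappa> * q)) / ((sqrt A / 2)\<^sup>2) ^ r)"
    using C a \<kappa> q A by (intro maximal_sqrt_weak_type u r weak) auto
  also have "5 ^ CARD('n) * 4 * (C * (a ^ r * \<kappa> * q)) / ((sqrt A / 2)\<^sup>2) ^ r = (5 ^ CARD('n) * 4 * C * 4 ^ r) * (a ^ r * \<kappa> * q) / A ^ r"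
    using A by (simp add: power_divide)
  also have "ennreal \<dots> \<le> ennreal (q / 8)" by (intro ennreal_leI small c2) (use C in simp)
  finally have m2: "emeasure lebesgue ?E2 \<le> ennreal (q / 8)" .
  have "ennreal (1 / A ^ r) * (ennreal (A ^ r) * emeasure lebesgue ?E3) \<le> ennreal (1 / A ^ r) * (ennreal (5 ^ CARD('n)) * ennreal (a ^ r * \<kappa> * q))"
    unfolding int[symmetric] by (intro mult_left_mono lebesgue.maximal_weak_type) auto
  then have "emeasure lebesgue ?E3 \<le> ennreal (5 ^ CARD('n) * (a ^ r * \<kappa> * q) / A ^ r)"
    using A a \<kappa> q by (simp add: mult.assoc[symmetric] ennreal_mult[symmetric])
  also have "\<dots> \<le> ennreal (q / 8)" by (intro ennreal_leI small c3) simp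
  finally have m3: "emeasure lebesgue ?E3 \<le> ennreal (q / 8)" .
  have opens: "open ?E2" "open ?E3" by (rule lebesgue.open_maximal)+
  show thesis
  proof (rule that[of "U \<union> ?E2 \<union> ?E3"])
    show "open (U \<union> ?E2 \<union> ?E3)" using U opens by auto
    have "emeasure lebesgue (U \<union> ?E2 \<union> ?E3) \<le> emeasure lebesgue U + emeasure lebesgue ?E2 + emeasure lebesgue ?E3"
      using U opens by (intro order_trans[OF emeasure_subadditive] add_right_mono emeasure_subadditive) auto
    also have "\<dots> \<le> (ennreal (q / 8) + ennreal (q / 8)) + ennreal (q / 8) + ennreal (q / 8)"
      using U(3) m1 by (intro add_mono m2 m3) (auto intro: order_trans add_right_mono)
    also have "\<dots> = ennreal (q / 2)" using q by (simp add: ennreal_plus[symmetric] del: ennreal_plus)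
    finally show "emeasure lebesgue (U \<union> ?E2 \<union> ?E3) \<le> ennreal (q / 2)" .
    fix x assume x: "x \<notin> U \<union> ?E2 \<union> ?E3"
    show "u x \<le> \<Lambda> * a" using x U(2) by (auto simp: A_def not_less[symmetric])
    show "maximal lebesgue (\<lambda>x. ennreal (sqrt (u x))) x \<le> ennreal (sqrt (\<Lambda> * a))"
      using x by (simp add: A_def not_less)
    show "maximal lebesgue (\<lambda>x. ennreal (norm (F x) ^ r)) x \<le> ennreal ((\<Lambda> * a) ^ r)"
      using x by (simp add: A_def not_less)
  qed
qed

lemma weak_type_null:
  assumes weak: "weak_type T r C" and F: "F \<in> Linf_c" and TF: "T F \<in> borel_measurable lebesgue"
    and 0: "(\<integral>\<^sup>+x. ennreal (norm (F x) ^ r) \<partial>lebesgue) = 0"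
  shows "AE x in lebesgue. T F x = 0"
proof -
  have "AE x in lebesgue. norm (T F x) \<le> 1 / real (Suc k)" for k
  proof -
    have "emeasure lebesgue {x. norm (T F x) > 1 / real (Suc k)} = 0"
      using weak_typeD[OF weak F, of "1 / real (Suc k)"] 0 by simp
    then show ?thesis
      using superlevel_lebesgue[of "\<lambda>x. norm (T F x)" "1 / real (Suc k)"] TF
      by (subst AE_iff_measurable[of "{x. norm (T F x) > 1 / real (Suc k)}"]) (auto simp: not_le)
  qed
  then have "AE x in lebesgue. \<forall>k. norm (T F x) \<le> 1 / real (Suc k)" by (subst AE_all_countable) auto
  then show ?thesis
  proof eventually_elim
    case (elim x)
    have "norm (T F x) \<le> 0"
      by (rule LIMSEQ_le_const[OF LIMSEQ_inverse_real_of_nat]) (use elim in \<open>auto simp: inverse_eq_divide\<close>)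
    then show ?case by simp
  qed
qed

text \<open>
  One generation of the sparse family below the cell of generation \<open>j\<close> around \<open>z\<close>. The chosen subcells fill
  at most half of the cell. Off them \<open>T\<close> of the localized function is controlled by the local mean; on each of them it
  is controlled up to \<open>T\<close> of the function localized further, to which the construction applies again.
\<close>
definition stopping_cells ::
    "((real ^ 'n \<Rightarrow> complex) \<Rightarrow> real ^ 'n \<Rightarrow> complex) \<Rightarrow> real \<Rightarrow> real \<Rightarrow> nat \<Rightarrow> (real ^ 'n \<Rightarrow> complex) \<Rightarrow>
     nat \<Rightarrow> real ^ 'n \<Rightarrow> (nat \<times> (real ^ 'n)) set \<Rightarrow> bool" where
  "stopping_cells T K L r f j z J \<longleftrightarrow>
    countable J \<and> disjoint_family_on (\<lambda>(k, x). cell L k x) J \<and> (\<Union>(k, x)\<in>J. cell L k x) \<subseteq> cell L j z \<and>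
    emeasure lebesgue (\<Union>(k, x)\<in>J. cell L k x) \<le> ennreal (1 / 2) * emeasure lebesgue (cell L j z) \<and>
    (AE y in lebesgue. y \<in> cell L j z - (\<Union>(k, x)\<in>J. cell L k x) \<longrightarrow>
       norm (T (localize L f j z) y) \<le> K * local_mean L r f j z) \<and>
    (\<forall>(k, x)\<in>J. AE y in lebesgue. y \<in> cell L k x \<longrightarrow>
       norm (T (localize L f j z) y) \<le> norm (T (localize L f k x) y) + K * local_mean L r f j z)"

context L2_operator
begin

text \<open>
  The difference between the localizations to a cell and to a subcell vanishes on the eightfold ball of the
  subcell, so the self-improved condition (II) bounds \<open>T\<close> of it there. The square-root average of this function is at
  most the sum of two: that of \<open>T F\<close>, controlled by a maximal function at the point \<open>y\<close>, and that of \<open>T\<close> of the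
  localization to the subcell, controlled by Kolmogorov's inequality.
\<close>
lemma child_estimate:
  assumes II: "cond_II T" and weak: "weak_type T r C" and C: "C \<ge> 0" and r: "r \<ge> 1"
  obtains C' where "C' \<ge> 0"
    "\<And>L F k x y A. L > 0 \<Longrightarrow> F \<in> Linf_c \<Longrightarrow> A > 0 \<Longrightarrow> y \<in> cell_ball L 1 k x \<Longrightarrow>
      maximal lebesgue (\<lambda>x. ennreal (sqrt (norm (T F x)))) y \<le> ennreal (sqrt A) \<Longrightarrow>
      maximal lebesgue (\<lambda>x. ennreal (norm (F x) ^ r)) y \<le> ennreal (A ^ r) \<Longrightarrow>
      AE w in lebesgue. w \<in> cell_ball L 1 k x \<longrightarrow> norm (T F w) \<le> norm (T (localize L F k x) w) + C' * A"
proof -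
  define N where "N = CARD('n)"
  obtain C1 where C1: "C1 \<ge> 0" "\<And>c r h \<alpha> m y. r > 0 \<Longrightarrow> h \<in> Linf_c \<Longrightarrow> (\<And>x. x \<in> ball c (8 * r) \<Longrightarrow> h x = 0) \<Longrightarrow>
     \<alpha> \<ge> 0 \<Longrightarrow> m \<ge> 0 \<Longrightarrow>
     (\<integral>\<^sup>+x\<in>ball c (2 * r). ennreal (sqrt (norm (T h x))) \<partial>lebesgue) \<le> ennreal \<alpha> * emeasure lebesgue (ball c (2 * r)) \<Longrightarrow>
     y \<in> ball c r \<Longrightarrow> maximal lebesgue (\<lambda>x. ennreal (norm (h x))) y \<le> ennreal m \<Longrightarrow>
     AE x in lebesgue. x \<in> ball c r \<longrightarrow> norm (T h x) \<le> C1 * (\<alpha>\<^sup>2 + m)"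
    by (rule cond_II_sqrt_bound[OF II]) blast
  define d where "d = 2 + 4 * C * 4 ^ N"
  have d: "d \<ge> 0" using C by (simp add: d_def)
  show thesis
  proof (rule that[of "C1 * (d\<^sup>2 + 2)"])
    show "C1 * (d\<^sup>2 + 2) \<ge> 0" using C1 by simp
    fix L A :: real and F :: "real ^ 'n \<Rightarrow> complex" and k :: nat and x y :: "real ^ 'n"
    assume L: "L > 0" and F: "F \<in> Linf_c" and A: "A > 0" and y: "y \<in> cell_ball L 1 k x"
      and M1: "maximal lebesgue (\<lambda>x. ennreal (sqrt (norm (T F x)))) y \<le> ennreal (sqrt A)"
      and M2: "maximal lebesgue (\<lambda>x. ennreal (norm (F x) ^ r)) y \<le> ennreal (A ^ r)"
    define \<rho> where "\<rho> = 4 * real CARD('n) * L / 2 ^ k"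
    have \<rho>: "\<rho> > 0" using L by (simp add: \<rho>_def)
    have cb: "cell_ball L m k x = ball x (m * \<rho>)" for m by (simp add: cell_ball_def \<rho>_def)
    define G where "G = localize L F k x"
    define h where "h = (\<lambda>w. F w - G w)"
    have G: "G \<in> Linf_c" unfolding G_def localize_def by (intro Linf_c_restr F cell_ball_lebesgue)
    have h: "h \<in> Linf_c" unfolding h_def by (intro Linf_c_diff F G)
    note [measurable] = Linf_c_measurable[OF F] T_measurable[OF F] T_measurable[OF G] T_measurable[OF h]
    have zero: "h w = 0" if "w \<in> ball x (8 * \<rho>)" for w
      using that by (simp add: h_def G_def localize_def restr_def cb)
    have h_le: "norm (h w) \<le> norm (F w)" for w by (simp add: h_def G_def localize_def restr_def)
    obtain b where b: "emeasure lebesgue (ball x (2 * \<rho>)) = ennreal b" "b > 0"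
      using lebesgue.pos[of "2 * \<rho>" x] lebesgue.fin[of x "2 * \<rho>"] \<rho> by (cases "emeasure lebesgue (ball x (2 * \<rho>))") auto
    have b8: "emeasure lebesgue (ball x (8 * \<rho>)) = ennreal (4 ^ N * b)"
      using emeasure_lebesgue_ball_scale[of 4 "2 * \<rho>" x x] \<rho> b by (simp add: N_def ennreal_mult)
    have y8: "y \<in> ball x (8 * \<rho>)" "y \<in> ball x (2 * \<rho>)" "y \<in> ball x \<rho>"
      using y \<rho> subset_ball[of \<rho> "8 * \<rho>" x] subset_ball[of \<rho> "2 * \<rho>" x] by (auto simp: cb simp del: mem_ball)
    have "(\<integral>\<^sup>+w. ennreal (norm (G w) ^ r) \<partial>lebesgue) = (\<integral>\<^sup>+w\<in>ball x (8 * \<rho>). ennreal (norm (F w) ^ r) \<partial>lebesgue)"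
      using r by (intro nn_integral_cong) (auto simp: G_def localize_def restr_def cb indicator_def power_0_left)
    also have "\<dots> \<le> maximal lebesgue (\<lambda>x. ennreal (norm (F x) ^ r)) y * emeasure lebesgue (ball x (8 * \<rho>))"
      by (rule lebesgue.average_le_maximal[OF y8(1)])
    also have "\<dots> \<le> ennreal (A ^ r) * ennreal (4 ^ N * b)"
      unfolding b8 by (intro mult_right_mono M2) auto
    finally have Gint: "(\<integral>\<^sup>+w. ennreal (norm (G w) ^ r) \<partial>lebesgue) \<le> ennreal (A ^ r) * ennreal (4 ^ N * b)" .
    define K where "K = C * (A ^ r * (4 ^ N * b))"
    have K: "K \<ge> 0" using C A b by (simp add: K_def)
    have weakG: "emeasure lebesgue {w. norm (T G w) > t} \<le> ennreal (K / t ^ r)" if t: "t > 0" for t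
    proof -
      have "emeasure lebesgue {w. norm (T G w) > t} \<le> ennreal (C / t ^ r) * (\<integral>\<^sup>+w. ennreal (norm (G w) ^ r) \<partial>lebesgue)"
        by (rule weak_typeD[OF weak G t])
      also have "\<dots> \<le> ennreal (C / t ^ r) * (ennreal (A ^ r) * ennreal (4 ^ N * b))"
        by (intro mult_left_mono Gint) auto
      also have "\<dots> = ennreal (K / t ^ r)"
        using C A b t by (simp add: ennreal_mult[symmetric] K_def)
      finally show ?thesis .
    qed
    have sG: "(\<integral>\<^sup>+w\<in>ball x (2 * \<rho>). ennreal (sqrt (norm (T G w))) \<partial>lebesgue) \<le> ennreal (sqrt A * (1 + 4 * C * 4 ^ N) * b)"
    proof -
      have "(\<integral>\<^sup>+w\<in>ball x (2 * \<rho>). ennreal (sqrt (norm (T G w))) \<partial>lebesgue) \<le>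
          ennreal (sqrt A) * emeasure lebesgue (ball x (2 * \<rho>)) + ennreal (4 * K * sqrt A / ((sqrt A)\<^sup>2) ^ r)"
        using A by (intro kolmogorov_sqrt r K weakG) auto
      also have "\<dots> = ennreal (sqrt A * b + 4 * K * sqrt A / ((sqrt A)\<^sup>2) ^ r)"
        unfolding b(1) using A b K by (simp add: ennreal_mult)
      also have "sqrt A * b + 4 * K * sqrt A / ((sqrt A)\<^sup>2) ^ r = sqrt A * (1 + 4 * C * 4 ^ N) * b"
        using A by (simp add: K_def algebra_simps)
      finally show ?thesis .
    qed
    have sF: "(\<integral>\<^sup>+w\<in>ball x (2 * \<rho>). ennreal (sqrt (norm (T F w))) \<partial>lebesgue) \<le> ennreal (sqrt A * b)"
    proof -
      have "(\<integral>\<^sup>+w\<in>ball x (2 * \<rho>). ennreal (sqrt (norm (T F w))) \<partial>lebesgue) \<le>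
         maximal lebesgue (\<lambda>x. ennreal (sqrt (norm (T F x)))) y * emeasure lebesgue (ball x (2 * \<rho>))"
        by (rule lebesgue.average_le_maximal[OF y8(2)])
      also have "\<dots> \<le> ennreal (sqrt A) * ennreal b" unfolding b(1) by (intro mult_right_mono M1) auto
      finally show ?thesis using A b by (simp add: ennreal_mult)
    qed
    have "(\<integral>\<^sup>+w\<in>ball x (2 * \<rho>). ennreal (sqrt (norm (T h w))) \<partial>lebesgue) \<le>
        (\<integral>\<^sup>+w. ennreal (sqrt (norm (T F w))) * indicator (ball x (2 * \<rho>)) w + ennreal (sqrt (norm (T G w))) * indicator (ball x (2 * \<rho>)) w \<partial>lebesgue)"
    proof (rule nn_integral_mono_AE)
      show "AE w in lebesgue. ennreal (sqrt (norm (T h w))) * indicator (ball x (2 * \<rho>)) w \<le>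
         ennreal (sqrt (norm (T F w))) * indicator (ball x (2 * \<rho>)) w + ennreal (sqrt (norm (T G w))) * indicator (ball x (2 * \<rho>)) w"
        using T_diff[OF F G] unfolding h_def[symmetric]
      proof eventually_elim
        case (elim w)
        have "sqrt (norm (T h w)) \<le> sqrt (norm (T F w) + norm (T G w))" using elim by (rule real_sqrt_le_mono)
        also have "\<dots> \<le> sqrt (norm (T F w)) + sqrt (norm (T G w))" by (rule sqrt_add_le_add_sqrt) auto
        finally have "ennreal (sqrt (norm (T h w))) \<le> ennreal (sqrt (norm (T F w)) + sqrt (norm (T G w)))" by (rule ennreal_leI)
        then show ?case by (simp add: indicator_def)
      qed
    qed
    also have "\<dots> = (\<integral>\<^sup>+w\<in>ball x (2 * \<rho>). ennreal (sqrt (norm (T F w))) \<partial>lebesgue) + (\<integral>\<^sup>+w\<in>ball x (2 * \<rho>). ennreal (sqrt (norm (T G w))) \<partial>lebesgue)"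
      by (rule nn_integral_add) measurable
    also have "\<dots> \<le> ennreal (sqrt A * b) + ennreal (sqrt A * (1 + 4 * C * 4 ^ N) * b)" by (intro add_mono sF sG)
    also have "\<dots> = ennreal (sqrt A * d) * emeasure lebesgue (ball x (2 * \<rho>))"
      unfolding b(1) using A b C
      by (simp add: ennreal_mult[symmetric] ennreal_plus[symmetric] d_def algebra_simps del: ennreal_plus)
    finally have sh: "(\<integral>\<^sup>+w\<in>ball x (2 * \<rho>). ennreal (sqrt (norm (T h w))) \<partial>lebesgue) \<le> ennreal (sqrt A * d) * emeasure lebesgue (ball x (2 * \<rho>))" .
    have "maximal lebesgue (\<lambda>x. ennreal (norm (h x))) y \<le> maximal lebesgue (\<lambda>x. ennreal (norm (F x))) y"
      by (intro lebesgue.maximal_mono ennreal_leI h_le)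
    also have "\<dots> \<le> ennreal (2 * A)" by (rule maximal_le_of_maximal_power_le[OF _ A r M2]) simp
    finally have mh: "maximal lebesgue (\<lambda>x. ennreal (norm (h x))) y \<le> ennreal (2 * A)" .
    have "AE w in lebesgue. w \<in> ball x \<rho> \<longrightarrow> norm (T h w) \<le> C1 * ((sqrt A * d)\<^sup>2 + 2 * A)"
      using A d by (intro C1(2)[OF \<rho> h zero _ _ sh y8(3) mh]) auto
    moreover have "(sqrt A * d)\<^sup>2 + 2 * A = (d\<^sup>2 + 2) * A" using A by (simp add: power_mult_distrib algebra_simps)
    moreover have "AE w in lebesgue. norm (T F w) \<le> norm (T h w) + norm (T G w)"
      using T_add[OF h G] by (simp add: h_def)
    ultimately show "AE w in lebesgue. w \<in> cell_ball L 1 k x \<longrightarrow> norm (T F w) \<le> norm (T (localize L F k x) w) + C1 * (d\<^sup>2 + 2) * A"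
      unfolding cb G_def[symmetric] by (auto elim!: eventually_elim2)
  qed
qed

text \<open>
  The chosen subcells are the Whitney cells of the exceptional set. The parent of each contains a point outside
  that set, and \<open>child_estimate\<close> is applied at this point.
\<close>
lemma sparse_step:
  assumes II: "cond_II T" and weak: "weak_type T r C" and C: "C \<ge> 0" and r: "r \<ge> 1"
  obtains K where "K \<ge> 0"
    "\<And>L f j z. L > 0 \<Longrightarrow> f \<in> Linf_c \<Longrightarrow> \<exists>J. stopping_cells T K L r f j z J"
proof -
  obtain C' where C': "C' \<ge> 0"
    "\<And>L F k x y A. L > 0 \<Longrightarrow> F \<in> Linf_c \<Longrightarrow> A > 0 \<Longrightarrow> y \<in> cell_ball L 1 k x \<Longrightarrow>
      maximal lebesgue (\<lambda>x. ennreal (sqrt (norm (T F x)))) y \<le> ennreal (sqrt A) \<Longrightarrow>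
      maximal lebesgue (\<lambda>x. ennreal (norm (F x) ^ r)) y \<le> ennreal (A ^ r) \<Longrightarrow>
      AE w in lebesgue. w \<in> cell_ball L 1 k x \<longrightarrow> norm (T F w) \<le> norm (T (localize L F k x) w) + C' * A"
    by (rule child_estimate[OF II weak C r]) blast
  define \<kappa> where "\<kappa> = ball_cell_ratio TYPE('n)"
  have \<kappa>: "\<kappa> \<ge> 0" by (simp add: \<kappa>_def)
  define \<Lambda> where "\<Lambda> = 1 + 32 * 5 ^ CARD('n) * 4 ^ r * (C + 1) * \<kappa>"
  have \<Lambda>: "\<Lambda> \<ge> 1" using C \<kappa> by (simp add: \<Lambda>_def)
  define K where "K = \<Lambda> * (1 + C')"
  have K: "K \<ge> 0" "\<Lambda> \<le> K" "C' * \<Lambda> \<le> K" using \<Lambda> C'(1) by (simp_all add: K_def algebra_simps)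
  show thesis
  proof (rule that[OF K(1)])
    fix L :: real and f :: "real ^ 'n \<Rightarrow> complex" and j :: nat and z :: "real ^ 'n"
    assume L: "L > 0" and f: "f \<in> Linf_c"
    let ?Q = "cell L j z"
    define F where "F = localize L f j z"
    define a where "a = local_mean L r f j z"
    have F: "F \<in> Linf_c" unfolding F_def localize_def by (intro Linf_c_restr f cell_ball_lebesgue)
    have a0: "a \<ge> 0" unfolding a_def by (rule local_mean_nonneg[OF r])
    obtain q where q: "emeasure lebesgue ?Q = ennreal q" "q > 0"
      using emeasure_cell_pos[OF L, of j z] emeasure_cell_finite[OF L, of j z] by (cases "emeasure lebesgue ?Q") auto
    have "(\<integral>\<^sup>+x. ennreal (norm (F x) ^ r) \<partial>lebesgue) = (\<integral>\<^sup>+x\<in>cell_ball L 8 j z. ennreal (norm (f x) ^ r) \<partial>lebesgue)"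
      using r by (intro nn_integral_cong) (auto simp: F_def localize_def restr_def indicator_def power_0_left)
    also have "\<dots> = ennreal (a ^ r) * (ennreal \<kappa> * ennreal q)"
      unfolding local_mean_power[OF L f r] a_def emeasure_cell_ball[OF L] \<kappa>_def q(1) ..
    also have "\<dots> = ennreal (a ^ r * \<kappa> * q)" using a0 \<kappa> q by (simp add: ennreal_mult[symmetric] mult.assoc)
    finally have int: "(\<integral>\<^sup>+x. ennreal (norm (F x) ^ r) \<partial>lebesgue) = ennreal (a ^ r * \<kappa> * q)" .
    show "\<exists>J. stopping_cells T K L r f j z J"
    \<comment> \<open>If the local mean is \<open>0\<close>, the localized function vanishes almost everywhere, hence so does \<open>T\<close> of it, and
      the family of subcells is empty; the choice of the exceptional set assumes a positive local mean.\<close>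
    proof (cases "a = 0")
      case True
      then have "AE x in lebesgue. T F x = 0"
        using int r by (intro weak_type_null[OF weak F T_measurable[OF F]]) (simp add: power_0_left)
      then have "stopping_cells T K L r f j z {}"
        using True unfolding stopping_cells_def F_def[symmetric] a_def[symmetric]
        by (auto simp: disjoint_family_on_def elim!: eventually_mono)
      then show ?thesis ..
    next
      case False
      then have a: "a > 0" using a0 by simp
      have weakF: "emeasure lebesgue {x. norm (T F x) > t} \<le> ennreal (C * (a ^ r * \<kappa> * q) / t ^ r)" if "t > 0" for t
      proof -
        have "emeasure lebesgue {x. norm (T F x) > t} \<le> ennreal (C / t ^ r) * ennreal (a ^ r * \<kappa> * q)"
          unfolding int[symmetric] by (rule weak_typeD[OF weak F that])
        also have "\<dots> = ennreal (C * (a ^ r * \<kappa> * q) / t ^ r)" using C a \<kappa> q that by (simp add: ennreal_mult[symmetric])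
        finally show ?thesis .
      qed
      obtain E where E: "open E" "emeasure lebesgue E \<le> ennreal (q / 2)"
        "\<And>x. x \<notin> E \<Longrightarrow> norm (T F x) \<le> \<Lambda> * a"
        "\<And>x. x \<notin> E \<Longrightarrow> maximal lebesgue (\<lambda>x. ennreal (sqrt (norm (T F x)))) x \<le> ennreal (sqrt (\<Lambda> * a))"
        "\<And>x. x \<notin> E \<Longrightarrow> maximal lebesgue (\<lambda>x. ennreal (norm (F x) ^ r)) x \<le> ennreal ((\<Lambda> * a) ^ r)"
      proof (rule exceptional_set[of "\<lambda>x. norm (T F x)" F r a C \<kappa> q \<Lambda>])
        show "(\<lambda>x. norm (T F x)) \<in> borel_measurable lebesgue" "F \<in> borel_measurable lebesgue"
          using T_measurable[OF F] Linf_c_measurable[OF F] by auto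
      qed (use r a C \<kappa> q int weakF in \<open>auto simp: \<Lambda>_def\<close>)
      have "\<not> ?Q \<subseteq> E"
      proof
        assume "?Q \<subseteq> E"
        then have "emeasure lebesgue ?Q \<le> emeasure lebesgue E" using E(1) by (intro emeasure_mono) auto
        also note E(2)
        finally show False using q by (simp add: ennreal_le_iff)
      qed
      from whitney[OF L E(1) this]
      obtain J :: "(nat \<times> (real ^ 'n)) set" where J: "countable J"
        "\<And>k x. (k, x) \<in> J \<Longrightarrow> j < k \<and> x \<in> ?Q \<and> \<not> cell L (k - 1) x \<subseteq> E"
        "disjoint_family_on (\<lambda>(k, x). cell L k x) J"
        "(\<Union>(k, x)\<in>J. cell L k x) = E \<inter> ?Q"
        by metis
      have Aa: "\<Lambda> * a > 0" using \<Lambda> a by simp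
      have "stopping_cells T K L r f j z J"
        unfolding stopping_cells_def F_def[symmetric] a_def[symmetric]
      proof (intro conjI)
        show "countable J" "disjoint_family_on (\<lambda>(k, x). cell L k x) J" by fact+
        show "(\<Union>(k, x)\<in>J. cell L k x) \<subseteq> ?Q" unfolding J(4) by simp
        have "emeasure lebesgue (E \<inter> ?Q) \<le> emeasure lebesgue E" using E(1) by (intro emeasure_mono) auto
        also have "\<dots> \<le> ennreal (1 / 2) * emeasure lebesgue ?Q"
          using E(2) q by (simp add: ennreal_mult[symmetric] del: ennreal_half)
        finally show "emeasure lebesgue (\<Union>(k, x)\<in>J. cell L k x) \<le> ennreal (1 / 2) * emeasure lebesgue ?Q" unfolding J(4) .
        have "norm (T F y) \<le> K * a" if "y \<notin> E" for y
          using E(3)[OF that] K(2) a mult_right_mono[of \<Lambda> K a] by linarith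
        then show "AE y in lebesgue. y \<in> ?Q - (\<Union>(k, x)\<in>J. cell L k x) \<longrightarrow> norm (T F y) \<le> K * a"
          unfolding J(4) by auto
        show "\<forall>(k, x)\<in>J. AE y in lebesgue. y \<in> cell L k x \<longrightarrow> norm (T F y) \<le> norm (T (localize L f k x) y) + K * a"
        proof clarify
          fix k x assume kx: "(k, x) \<in> J"
          have k: "j < k" "x \<in> ?Q" "\<not> cell L (k - 1) x \<subseteq> E" using J(2)[OF kx] by auto
          then obtain y where y: "y \<in> cell L (k - 1) x" "y \<notin> E" by auto
          have "y \<in> cell_ball L 1 k x"
            using parent_subset_cell_ball[OF L, of "k - 1" x] k(1) y by auto
          from C'(2)[OF L F Aa this E(4)[OF y(2)] E(5)[OF y(2)]]
          have "AE w in lebesgue. w \<in> cell_ball L 1 k x \<longrightarrow> norm (T F w) \<le> norm (T (localize L F k x) w) + C' * (\<Lambda> * a)" .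
          moreover have "localize L F k x = localize L f k x"
            using child_cell_ball_subset[OF L k(2,1)] by (auto simp: F_def localize_def restr_def fun_eq_iff)
          moreover have "C' * (\<Lambda> * a) \<le> K * a" using K(3) a mult_right_mono[of "C' * \<Lambda>" K a] by simp
          ultimately show "AE y in lebesgue. y \<in> cell L k x \<longrightarrow> norm (T F y) \<le> norm (T (localize L f k x) y) + K * a"
            using cell_subset_cell_ball[OF L, of k x] by (auto elim!: eventually_mono)
        qed
      qed
      then show ?thesis ..
    qed
  qed
qed

end

lemma nn_set_integral_split:
  assumes [measurable]: "f \<in> borel_measurable M" "A \<in> sets M" "B \<in> sets M" and sub: "A \<subseteq> B"
  shows "(\<integral>\<^sup>+x\<in>B. f x \<partial>M) = (\<integral>\<^sup>+x\<in>A. f x \<partial>M) + (\<integral>\<^sup>+x\<in>B - A. f x \<partial>M)"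
proof -
  have "(\<integral>\<^sup>+x\<in>A. f x \<partial>M) + (\<integral>\<^sup>+x\<in>B - A. f x \<partial>M) = (\<integral>\<^sup>+x. f x * indicator A x + f x * indicator (B - A) x \<partial>M)"
    by (rule nn_integral_add[symmetric]) measurable
  also have "\<dots> = (\<integral>\<^sup>+x\<in>B. f x \<partial>M)"
    using sub by (intro nn_integral_cong) (auto simp: indicator_def)
  finally show ?thesis ..
qed

text \<open>
  By the Borel-Cantelli lemma almost every point lies in only finitely many of the exceptional sets, and
  Fatou's lemma applies.
\<close>
lemma nn_set_integral_le_of_small_exceptions:
  assumes f[measurable]: "f \<in> borel_measurable M" and Q[measurable]: "Q \<in> sets M"
    and W: "\<And>N. W N \<in> sets M" "\<And>N :: nat. emeasure M (W N) \<le> ennreal (q * (1 / 2) ^ N)"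
    and le: "\<And>N. (\<integral>\<^sup>+x\<in>Q - W N. f x \<partial>M) \<le> b"
  shows "(\<integral>\<^sup>+x\<in>Q. f x \<partial>M) \<le> b"
proof -
  note [measurable] = W(1)
  have fin: "emeasure M (W N) < \<infinity>" for N using W(2)[of N] by (rule le_less_trans) simp
  have le_geo: "measure M (W N) \<le> \<bar>q\<bar> * (1 / 2) ^ N" for N
  proof -
    have "emeasure M (W N) \<le> ennreal (\<bar>q\<bar> * (1 / 2) ^ N)"
      using W(2)[of N] by (rule order_trans) (intro ennreal_leI mult_right_mono, auto)
    then show ?thesis unfolding measure_def by (intro enn2real_leI) auto
  qed
  have geo: "summable (\<lambda>N. \<bar>q\<bar> * (1 / 2 :: real) ^ N)" by (intro summable_mult summable_geometric) simp
  have "summable (\<lambda>N. measure M (W N))"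
    by (rule summable_comparison_test'[OF geo, of 0]) (use le_geo in simp)
  then have ev: "AE x in M. eventually (\<lambda>N. x \<in> space M - W N) sequentially"
    by (rule borel_cantelli_AE1[OF W(1) fin])
  have "(\<integral>\<^sup>+x\<in>Q. f x \<partial>M) \<le> (\<integral>\<^sup>+x. liminf (\<lambda>N. f x * indicator (Q - W N) x) \<partial>M)"
  proof (rule nn_integral_mono_AE, use ev in eventually_elim)
    case (elim x)
    then have "eventually (\<lambda>N. f x * indicator Q x \<le> f x * indicator (Q - W N) x) sequentially"
      by eventually_elim (auto simp: indicator_def)
    then show ?case by (rule Liminf_bounded)
  qed
  also have "\<dots> \<le> liminf (\<lambda>N. \<integral>\<^sup>+x\<in>Q - W N. f x \<partial>M)"
    by (intro nn_integral_liminf) measurable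
  also have "\<dots> \<le> limsup (\<lambda>N. \<integral>\<^sup>+x\<in>Q - W N. f x \<partial>M)" by (rule Liminf_le_Limsup) simp
  also have "\<dots> \<le> b" using le by (intro Limsup_bounded) auto
  finally show ?thesis .
qed

text \<open>
  Sparse domination in integrated form. Usually \<open>\<bar>T f\<bar>\<close> is bounded by the sum, over a sparse family of
  cells, of the local means times the indicators of the cells; pairing with \<open>G\<close> gives a sum over the family, which is
  estimated through disjoint large subsets \<open>E\<close> of the cells. Here the last step is built into the hypothesis on
  \<open>\<Theta>\<close>, and the sum over the family becomes an induction on the number of generations: the integral of
  \<open>\<bar>T f\<bar> * G\<close> over a cell, up to a set of relative measure \<open>2 ^ (- N)\<close>, is at most a constant times the integral of
  \<open>\<Theta>\<close>. In the inductive step the contribution of the local mean is charged to the part \<open>E\<close> of the cell outside the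
  chosen subcells, and the subcells are charged to themselves.
\<close>
lemma (in L2_operator) sparse_domination:
  assumes II: "cond_II T" and weak: "weak_type T r C" and C: "C \<ge> 0" and r: "r \<ge> 1"
  obtains K where "K \<ge> 0"
    "\<And>L f G \<Theta> j z. L > 0 \<Longrightarrow> f \<in> Linf_c \<Longrightarrow> G \<in> borel_measurable lebesgue \<Longrightarrow> \<Theta> \<in> borel_measurable lebesgue \<Longrightarrow>
      (\<And>k x E. E \<in> sets lebesgue \<Longrightarrow> E \<subseteq> cell L k x \<Longrightarrow> emeasure lebesgue (cell L k x) \<le> 2 * emeasure lebesgue E \<Longrightarrow>
         ennreal (local_mean L r f k x) * (\<integral>\<^sup>+y\<in>cell L k x. G y \<partial>lebesgue) \<le> (\<integral>\<^sup>+y\<in>E. \<Theta> y \<partial>lebesgue)) \<Longrightarrow>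
      (\<integral>\<^sup>+y\<in>cell L j z. ennreal (norm (T (localize L f j z) y)) * G y \<partial>lebesgue) \<le> ennreal K * (\<integral>\<^sup>+y\<in>cell L j z. \<Theta> y \<partial>lebesgue)"
proof -
  obtain K where K: "K \<ge> 0"
    "\<And>L f j z. L > 0 \<Longrightarrow> f \<in> Linf_c \<Longrightarrow> \<exists>J. stopping_cells T K L r f j z J"
    by (rule sparse_step[OF II weak C r]) blast
  show thesis
  proof (rule that[OF K(1)])
    fix L :: real and f :: "real ^ 'n \<Rightarrow> complex" and G \<Theta> :: "real ^ 'n \<Rightarrow> ennreal" and j :: nat and z :: "real ^ 'n"
    assume L: "L > 0" and f: "f \<in> Linf_c" and G[measurable]: "G \<in> borel_measurable lebesgue"
      and \<Theta>[measurable]: "\<Theta> \<in> borel_measurable lebesgue"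
      and carleson: "\<And>k x E. E \<in> sets lebesgue \<Longrightarrow> E \<subseteq> cell L k x \<Longrightarrow> emeasure lebesgue (cell L k x) \<le> 2 * emeasure lebesgue E \<Longrightarrow>
         ennreal (local_mean L r f k x) * (\<integral>\<^sup>+y\<in>cell L k x. G y \<partial>lebesgue) \<le> (\<integral>\<^sup>+y\<in>E. \<Theta> y \<partial>lebesgue)"
    define u where "u k x = (\<lambda>y. ennreal (norm (T (localize L f k x) y)))" for k x
    have u[measurable]: "u k x \<in> borel_measurable lebesgue" for k x
      unfolding u_def using T_measurable[OF Linf_c_restr[OF f cell_ball_lebesgue]]
      by (simp add: localize_def)
    have claim: "\<exists>W. W \<in> sets lebesgue \<and> W \<subseteq> cell L k x \<and> emeasure lebesgue W \<le> ennreal ((1 / 2) ^ N) * emeasure lebesgue (cell L k x) \<and>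
        (\<integral>\<^sup>+y\<in>cell L k x - W. u k x y * G y \<partial>lebesgue) \<le> ennreal K * (\<integral>\<^sup>+y\<in>cell L k x. \<Theta> y \<partial>lebesgue)" for N k x
    proof (induction N arbitrary: k x)
      case 0
      show ?case by (rule exI[of _ "cell L k x"]) (use L in auto)
    next
      case (Suc N)
      let ?Q = "cell L k x"
      define a where "a = local_mean L r f k x"
      have a: "a \<ge> 0" unfolding a_def by (rule local_mean_nonneg[OF r])
      define P where "P = (\<lambda>(k, x :: real ^ 'n). cell L k x)"
      define v where "v = (\<lambda>(k, x). u k x)"
      obtain J where J0: "stopping_cells T K L r f k x J" using K(2)[OF L f, of k x] ..
      have J: "countable J" "disjoint_family_on P J" "(\<Union>i\<in>J. P i) \<subseteq> ?Q"
        "emeasure lebesgue (\<Union>i\<in>J. P i) \<le> ennreal (1 / 2) * emeasure lebesgue ?Q"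
        "AE y in lebesgue. y \<in> ?Q - (\<Union>i\<in>J. P i) \<longrightarrow> norm (T (localize L f k x) y) \<le> K * a"
        "\<forall>(l, w)\<in>J. AE y in lebesgue. y \<in> cell L l w \<longrightarrow> norm (T (localize L f k x) y) \<le> norm (T (localize L f l w) y) + K * a"
        using J0 unfolding stopping_cells_def P_def a_def by - ((elim conjE; assumption)+)
      have P_sets[measurable]: "P i \<in> sets lebesgue" for i using L by (auto simp: P_def split: prod.split)
      have v[measurable]: "v i \<in> borel_measurable lebesgue" for i by (auto simp: v_def split: prod.split)
      define D where "D = (\<Union>i\<in>J. P i)"
      have D[measurable]: "D \<in> sets lebesgue" using J(1) by (auto simp: D_def)
      have Q[measurable]: "?Q \<in> sets lebesgue" using L by simp
      have "\<exists>W. \<forall>i. W i \<in> sets lebesgue \<and> W i \<subseteq> P i \<and> emeasure lebesgue (W i) \<le> ennreal ((1 / 2) ^ N) * emeasure lebesgue (P i) \<and>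
        (\<integral>\<^sup>+y\<in>P i - W i. v i y * G y \<partial>lebesgue) \<le> ennreal K * (\<integral>\<^sup>+y\<in>P i. \<Theta> y \<partial>lebesgue)"
      proof (rule choice, rule allI)
      fix i
      show "\<exists>W. W \<in> sets lebesgue \<and> W \<subseteq> P i \<and> emeasure lebesgue W \<le> ennreal ((1 / 2) ^ N) * emeasure lebesgue (P i) \<and>
        (\<integral>\<^sup>+y\<in>P i - W. v i y * G y \<partial>lebesgue) \<le> ennreal K * (\<integral>\<^sup>+y\<in>P i. \<Theta> y \<partial>lebesgue)"
        using Suc.IH[of "fst i" "snd i"] unfolding P_def v_def case_prod_beta .
      qed
      then obtain W where W: "\<And>i. W i \<in> sets lebesgue" "\<And>i. W i \<subseteq> P i"
        "\<And>i. emeasure lebesgue (W i) \<le> ennreal ((1 / 2) ^ N) * emeasure lebesgue (P i)"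
        "\<And>i. (\<integral>\<^sup>+y\<in>P i - W i. v i y * G y \<partial>lebesgue) \<le> ennreal K * (\<integral>\<^sup>+y\<in>P i. \<Theta> y \<partial>lebesgue)"
        by blast
      note [measurable] = W(1)
      define V where "V = (\<Union>i\<in>J. W i)"
      have V[measurable]: "V \<in> sets lebesgue" using J(1) W(1) by (auto simp: V_def)
      have VD: "V \<subseteq> D" using W(2) by (auto simp: V_def D_def)
      have disjW: "disjoint_family_on W J" "disjoint_family_on (\<lambda>i. P i - W i) J"
        using J(2) W(2) unfolding disjoint_family_on_def by blast+
      have DV: "D - V = (\<Union>i\<in>J. P i - W i)"
      proof
        show "D - V \<subseteq> (\<Union>i\<in>J. P i - W i)" by (auto simp: D_def V_def)
        show "(\<Union>i\<in>J. P i - W i) \<subseteq> D - V"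
        proof
          fix y assume "y \<in> (\<Union>i\<in>J. P i - W i)"
          then obtain i where i: "i \<in> J" "y \<in> P i" "y \<notin> W i" by blast
          have "y \<notin> W l" if "l \<in> J" for l
          proof
            assume "y \<in> W l"
            then have "y \<in> P l" "l \<noteq> i" using W(2)[of l] i(3) by auto
            then show False using disjoint_family_onD[OF J(2) that i(1)] i(2) by blast
          qed
          then show "y \<in> D - V" using i by (auto simp: D_def V_def)
        qed
      qed
      have "emeasure lebesgue V \<le> ennreal ((1 / 2) ^ Suc N) * emeasure lebesgue ?Q"
      proof -
        have "emeasure lebesgue V = (\<integral>\<^sup>+i. emeasure lebesgue (W i) \<partial>count_space J)"
          unfolding V_def by (intro emeasure_UN_countable W J disjW)
        also have "\<dots> \<le> (\<integral>\<^sup>+i. ennreal ((1 / 2) ^ N) * emeasure lebesgue (P i) \<partial>count_space J)"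
          by (intro nn_integral_mono W)
        also have "\<dots> = ennreal ((1 / 2) ^ N) * (\<integral>\<^sup>+i. emeasure lebesgue (P i) \<partial>count_space J)"
          by (intro nn_integral_cmult) simp
        also have "(\<integral>\<^sup>+i. emeasure lebesgue (P i) \<partial>count_space J) = emeasure lebesgue D"
          unfolding D_def by (intro emeasure_UN_countable[symmetric] P_sets J)
        also have "ennreal ((1 / 2) ^ N) * emeasure lebesgue D \<le> ennreal ((1 / 2) ^ N) * (ennreal (1 / 2) * emeasure lebesgue ?Q)"
          using J(4) by (intro mult_left_mono) (auto simp: D_def)
        also have "\<dots> = ennreal ((1 / 2) ^ Suc N) * emeasure lebesgue ?Q"
          by (simp only: mult.assoc[symmetric] ennreal_mult[symmetric] zero_le_divide_1_iff zero_le_power zero_le_numeral power_Suc2)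
        finally show ?thesis .
      qed
      moreover have "(\<integral>\<^sup>+y\<in>?Q - V. u k x y * G y \<partial>lebesgue) \<le> ennreal K * (\<integral>\<^sup>+y\<in>?Q. \<Theta> y \<partial>lebesgue)"
      proof -
        have DQ: "D \<subseteq> ?Q" using J(3) by (simp add: D_def)
        have half: "emeasure lebesgue ?Q \<le> 2 * emeasure lebesgue (?Q - D)"
        proof -
          obtain q where q: "emeasure lebesgue ?Q = ennreal q" "q > 0"
            using emeasure_cell_pos[OF L, of k x] emeasure_cell_finite[OF L, of k x] by (cases "emeasure lebesgue ?Q") auto
          have "emeasure lebesgue D \<le> ennreal (q / 2)"
            using J(4) q unfolding D_def[symmetric] q(1) by (simp add: ennreal_mult[symmetric] del: ennreal_half)
          then obtain d where d: "emeasure lebesgue D = ennreal d" "0 \<le> d" "d \<le> q / 2"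
            using q by (cases "emeasure lebesgue D") (auto simp: ennreal_le_iff top_unique)
          have "emeasure lebesgue (?Q - D) = ennreal q - ennreal d"
            using DQ d q by (subst emeasure_Diff) auto
          also have "\<dots> = ennreal (q - d)" using d by (simp add: ennreal_minus)
          finally have "2 * emeasure lebesgue (?Q - D) = ennreal (2 * (q - d))"
            using d q by (subst ennreal_mult) auto
          then show ?thesis unfolding q(1) using d by (simp add: ennreal_leI)
        qed
        have out: "(\<integral>\<^sup>+y\<in>?Q - D. u k x y * G y \<partial>lebesgue) \<le> ennreal (K * a) * (\<integral>\<^sup>+y\<in>?Q - D. G y \<partial>lebesgue)"
        proof -
          have "(\<integral>\<^sup>+y\<in>?Q - D. u k x y * G y \<partial>lebesgue) \<le> (\<integral>\<^sup>+y. ennreal (K * a) * (G y * indicator (?Q - D) y) \<partial>lebesgue)"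
            using J(5)[folded D_def]
            by (intro nn_integral_mono_AE, eventually_elim)
              (auto simp: u_def indicator_def intro!: mult_right_mono ennreal_leI)
          then show ?thesis by (simp add: nn_integral_cmult)
        qed
        have child: "(\<integral>\<^sup>+y\<in>P i - W i. u k x y * G y \<partial>lebesgue) \<le> ennreal K * (\<integral>\<^sup>+y\<in>P i. \<Theta> y \<partial>lebesgue) + ennreal (K * a) * (\<integral>\<^sup>+y\<in>P i. G y \<partial>lebesgue)"
          if i: "i \<in> J" for i
        proof -
          have "AE y in lebesgue. y \<in> P i \<longrightarrow> u k x y \<le> v i y + ennreal (K * a)"
            using J(6) i K(1) a unfolding P_def v_def u_def
            by (cases i) (auto elim!: eventually_mono simp: ennreal_plus[symmetric] ennreal_leI simp del: ennreal_plus dest!: bspec)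
          then have "(\<integral>\<^sup>+y\<in>P i - W i. u k x y * G y \<partial>lebesgue) \<le>
             (\<integral>\<^sup>+y. v i y * G y * indicator (P i - W i) y + ennreal (K * a) * (G y * indicator (P i) y) \<partial>lebesgue)"
          proof (intro nn_integral_mono_AE, eventually_elim)
            case (elim y)
            show ?case
            proof (cases "y \<in> P i - W i")
              case True
              then have "u k x y * G y \<le> (v i y + ennreal (K * a)) * G y" using elim by (intro mult_right_mono) auto
              then show ?thesis using True by (simp add: distrib_right mult.assoc)
            qed simp
          qed
          also have "\<dots> = (\<integral>\<^sup>+y\<in>P i - W i. v i y * G y \<partial>lebesgue) + ennreal (K * a) * (\<integral>\<^sup>+y\<in>P i. G y \<partial>lebesgue)"
            by (subst nn_integral_add) (auto simp: nn_integral_cmult)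
          also have "\<dots> \<le> ennreal K * (\<integral>\<^sup>+y\<in>P i. \<Theta> y \<partial>lebesgue) + ennreal (K * a) * (\<integral>\<^sup>+y\<in>P i. G y \<partial>lebesgue)"
            by (intro add_right_mono W)
          finally show ?thesis .
        qed
        have inside: "(\<integral>\<^sup>+y\<in>D - V. u k x y * G y \<partial>lebesgue) \<le> ennreal K * (\<integral>\<^sup>+y\<in>D. \<Theta> y \<partial>lebesgue) + ennreal (K * a) * (\<integral>\<^sup>+y\<in>D. G y \<partial>lebesgue)"
        proof -
          have "(\<integral>\<^sup>+y\<in>D - V. u k x y * G y \<partial>lebesgue) = (\<integral>\<^sup>+i. (\<integral>\<^sup>+y\<in>P i - W i. u k x y * G y \<partial>lebesgue) \<partial>count_space J)"
            unfolding DV by (intro nn_integral_UN_disjoint J disjW) auto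
          also have "\<dots> \<le> (\<integral>\<^sup>+i. ennreal K * (\<integral>\<^sup>+y\<in>P i. \<Theta> y \<partial>lebesgue) + ennreal (K * a) * (\<integral>\<^sup>+y\<in>P i. G y \<partial>lebesgue) \<partial>count_space J)"
            using child by (intro nn_integral_mono) auto
          also have "\<dots> = ennreal K * (\<integral>\<^sup>+i. (\<integral>\<^sup>+y\<in>P i. \<Theta> y \<partial>lebesgue) \<partial>count_space J) + ennreal (K * a) * (\<integral>\<^sup>+i. (\<integral>\<^sup>+y\<in>P i. G y \<partial>lebesgue) \<partial>count_space J)"
            by (subst nn_integral_add) (auto simp: nn_integral_cmult)
          also have "(\<integral>\<^sup>+i. (\<integral>\<^sup>+y\<in>P i. \<Theta> y \<partial>lebesgue) \<partial>count_space J) = (\<integral>\<^sup>+y\<in>D. \<Theta> y \<partial>lebesgue)"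
            unfolding D_def by (intro nn_integral_UN_disjoint[symmetric] J \<Theta> P_sets)
          also have "(\<integral>\<^sup>+i. (\<integral>\<^sup>+y\<in>P i. G y \<partial>lebesgue) \<partial>count_space J) = (\<integral>\<^sup>+y\<in>D. G y \<partial>lebesgue)"
            unfolding D_def by (intro nn_integral_UN_disjoint[symmetric] J G P_sets)
          finally show ?thesis .
        qed
        have split: "?Q - V - (D - V) = ?Q - D" using VD by auto
        have "(\<integral>\<^sup>+y\<in>?Q - V. u k x y * G y \<partial>lebesgue) = (\<integral>\<^sup>+y\<in>D - V. u k x y * G y \<partial>lebesgue) + (\<integral>\<^sup>+y\<in>?Q - D. u k x y * G y \<partial>lebesgue)"
          using DQ by (subst nn_set_integral_split[of _ _ "D - V"]) (auto simp: split)
        also have "\<dots> \<le> (ennreal K * (\<integral>\<^sup>+y\<in>D. \<Theta> y \<partial>lebesgue) + ennreal (K * a) * (\<integral>\<^sup>+y\<in>D. G y \<partial>lebesgue)) + ennreal (K * a) * (\<integral>\<^sup>+y\<in>?Q - D. G y \<partial>lebesgue)"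
          by (intro add_mono inside out)
        also have "\<dots> = ennreal K * (\<integral>\<^sup>+y\<in>D. \<Theta> y \<partial>lebesgue) + ennreal (K * a) * (\<integral>\<^sup>+y\<in>?Q. G y \<partial>lebesgue)"
          by (simp add: nn_set_integral_split[OF G D Q DQ] distrib_left add.assoc)
        also have "\<dots> = ennreal K * ((\<integral>\<^sup>+y\<in>D. \<Theta> y \<partial>lebesgue) + ennreal a * (\<integral>\<^sup>+y\<in>?Q. G y \<partial>lebesgue))"
          using K(1) a by (simp add: ennreal_mult distrib_left mult.assoc)
        also have "\<dots> \<le> ennreal K * ((\<integral>\<^sup>+y\<in>D. \<Theta> y \<partial>lebesgue) + (\<integral>\<^sup>+y\<in>?Q - D. \<Theta> y \<partial>lebesgue))"
          unfolding a_def by (intro mult_left_mono add_left_mono carleson half) auto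
        also have "\<dots> = ennreal K * (\<integral>\<^sup>+y\<in>?Q. \<Theta> y \<partial>lebesgue)"
          by (simp add: nn_set_integral_split[OF \<Theta> D Q DQ])
        finally show ?thesis .
      qed
      ultimately show ?case using VD J(3) by (intro exI[of _ V]) (auto simp: D_def)
    qed
    obtain q where q: "emeasure lebesgue (cell L j z) = ennreal q" "q > 0"
      using emeasure_cell_pos[OF L, of j z] emeasure_cell_finite[OF L, of j z] by (cases "emeasure lebesgue (cell L j z)") auto
    obtain W where W: "\<And>N. W N \<in> sets lebesgue" "\<And>N. emeasure lebesgue (W N) \<le> ennreal ((1 / 2) ^ N) * emeasure lebesgue (cell L j z)"
      "\<And>N. (\<integral>\<^sup>+y\<in>cell L j z - W N. u j z y * G y \<partial>lebesgue) \<le> ennreal K * (\<integral>\<^sup>+y\<in>cell L j z. \<Theta> y \<partial>lebesgue)"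
    proof -
      have "\<exists>W. \<forall>N. W N \<in> sets lebesgue \<and> W N \<subseteq> cell L j z \<and> emeasure lebesgue (W N) \<le> ennreal ((1 / 2) ^ N) * emeasure lebesgue (cell L j z) \<and>
        (\<integral>\<^sup>+y\<in>cell L j z - W N. u j z y * G y \<partial>lebesgue) \<le> ennreal K * (\<integral>\<^sup>+y\<in>cell L j z. \<Theta> y \<partial>lebesgue)"
        by (rule choice, rule allI, rule claim)
      then show thesis using that by blast
    qed
    have "(\<integral>\<^sup>+y\<in>cell L j z. u j z y * G y \<partial>lebesgue) \<le> ennreal K * (\<integral>\<^sup>+y\<in>cell L j z. \<Theta> y \<partial>lebesgue)"
    proof (rule nn_set_integral_le_of_small_exceptions[OF _ _ W(1) _ W(3)])
      show "emeasure lebesgue (W N) \<le> ennreal (q * (1 / 2) ^ N)" for N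
        using W(2)[of N] q by (simp add: q(1) ennreal_mult mult.commute)
    qed (use L in auto)
    then show "(\<integral>\<^sup>+y\<in>cell L j z. ennreal (norm (T (localize L f j z) y)) * G y \<partial>lebesgue) \<le> ennreal K * (\<integral>\<^sup>+y\<in>cell L j z. \<Theta> y \<partial>lebesgue)"
      by (simp add: u_def)
  qed
qed

section \<open>From sparse domination to weighted bounds\<close>

text \<open>
  Young's inequality with a small coefficient, which takes the place of Hoelder's inequality: the term with
  \<open>\<delta>\<close> is absorbed on the left.
\<close>
lemma young_epsilon:
  fixes p q :: real
  assumes pq: "p > 1" "q > 1" "1 / p + 1 / q = 1" and C: "C \<ge> 0" and \<delta>: "\<delta> > 0"
  obtains A where "A \<ge> 0" "\<And>x y. x \<ge> 0 \<Longrightarrow> y \<ge> 0 \<Longrightarrow> C * x * y \<le> A * x powr p + \<delta> * y powr q"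
proof -
  define b where "b = \<delta> powr (1 / q)"
  have b: "b > 0" "b powr q = \<delta>" using \<delta> pq by (simp_all add: b_def powr_powr)
  show thesis
  proof (rule that[of "(C / b) powr p"])
    fix x y :: real assume xy: "x \<ge> 0" "y \<ge> 0"
    have "C * x * y = (C / b * x) * (b * y)" using b by simp
    also have "\<dots> \<le> (C / b * x) powr p / p + (b * y) powr q / q"
      using b C xy by (intro Youngs_inequality pq) auto
    also have "\<dots> \<le> (C / b * x) powr p + (b * y) powr q"
      using pq by (intro add_mono) (auto simp: divide_le_eq mult_le_cancel_left1)
    also have "\<dots> = (C / b) powr p * x powr p + \<delta> * y powr q"
      using b C xy by (simp add: powr_mult del: times_divide_eq_left)
    finally show "C * x * y \<le> (C / b) powr p * x powr p + \<delta> * y powr q" .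
  qed simp
qed

lemma ennreal_absorb_half:
  assumes "X \<le> c + ennreal (1 / 2) * X" "X < \<infinity>" shows "X \<le> 2 * c"
proof (cases "c = \<infinity>")
  case False
  then obtain d x where d: "c = ennreal d" "d \<ge> 0" "X = ennreal x" "x \<ge> 0"
    using assms(2) by (cases c; cases X) auto
  have "ennreal x \<le> ennreal (d + 1 / 2 * x)"
    using assms(1) d by (simp add: ennreal_plus[symmetric] ennreal_mult[symmetric] del: ennreal_plus ennreal_half)
  then have "x \<le> d + 1 / 2 * x" using d by (subst (asm) ennreal_le_iff) auto
  then have "x \<le> 2 * d" by simp
  then have "X \<le> ennreal (2 * d)" using d by (simp add: ennreal_le_iff)
  then show ?thesis using d by (simp add: ennreal_mult)
qed (simp add: ennreal_mult_top)

lemma (in doubling_measure) maximal_finite_AE: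
  assumes g: "g \<in> borel_measurable \<nu>" and fin: "(\<integral>\<^sup>+x. g x \<partial>\<nu>) < \<infinity>"
  shows "AE x in \<nu>. maximal \<nu> g x < \<infinity>"
proof -
  let ?N = "{x. maximal \<nu> g x = \<infinity>}"
  obtain i where i: "ennreal D * (\<integral>\<^sup>+x. g x \<partial>\<nu>) = ennreal i" "i \<ge> 0"
    using fin by (cases "ennreal D * (\<integral>\<^sup>+x. g x \<partial>\<nu>)") (auto simp: ennreal_mult_eq_top_iff)
  have "{x. maximal \<nu> g x = \<infinity>} = (\<Inter>n. {x. of_nat n < maximal \<nu> g x})"
  proof (intro set_eqI iffI)
    fix x assume x: "x \<in> (\<Inter>n. {x. of_nat n < maximal \<nu> g x})"
    show "x \<in> {x. maximal \<nu> g x = \<infinity>}"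
    proof (rule ccontr)
      assume "x \<notin> {x. maximal \<nu> g x = \<infinity>}"
      then have "maximal \<nu> g x < top" by (simp add: less_top[symmetric])
      then obtain n where "maximal \<nu> g x < of_nat n" using ennreal_Ex_less_of_nat by blast
      moreover have "of_nat n < maximal \<nu> g x" using x by blast
      ultimately show False by simp
    qed
  qed (simp add: of_nat_less_top)
  then have N: "?N \<in> sets \<nu>" using open_maximal by (auto intro!: sets.countable_INT' open_sets)
  have le: "of_nat n * emeasure \<nu> ?N \<le> ennreal i" for n
  proof -
    have "of_nat n * emeasure \<nu> ?N \<le> of_nat n * emeasure \<nu> {x. of_nat n < maximal \<nu> g x}"
      by (intro mult_left_mono emeasure_mono open_sets open_maximal) (auto simp: less_top[symmetric] ennreal_of_nat_neq_top)
    also have "\<dots> \<le> ennreal i" unfolding i(1)[symmetric] by (rule maximal_weak_type[OF g])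
    finally show ?thesis .
  qed
  have "emeasure \<nu> ?N = 0"
  proof (rule ccontr)
    assume "emeasure \<nu> ?N \<noteq> 0"
    moreover have "emeasure \<nu> ?N < \<infinity>" using le[of 1] by (auto intro: le_less_trans)
    ultimately obtain e where e: "emeasure \<nu> ?N = ennreal e" "e > 0" by (cases "emeasure \<nu> ?N") auto
    obtain n :: nat where n: "i / e < real n" using reals_Archimedean2 by blast
    have "ennreal (real n * e) \<le> ennreal i" using le[of n] e by (simp add: ennreal_of_nat_eq_real_of_nat ennreal_mult)
    then have "real n * e \<le> i" using i by (simp add: ennreal_le_iff)
    then show False using n e by (simp add: field_simps)
  qed
  then show ?thesis using N by (intro AE_I[of _ _ ?N]) (auto simp: less_top[symmetric])
qed

context L2_operator
begin

text \<open>
  Test with the power \<open>p - 1\<close> of \<open>\<bar>T f\<bar>\<close>, truncated at height \<open>k\<close> and to a cube. The last integral of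
  the hypothesis is then half of the truncated \<open>p\<close>-th power integral, which is finite and can be absorbed. Let \<open>k\<close>
  tend to infinity.
\<close>
lemma Lp_weight_bound_of_duality:
  assumes pq: "p > 1" "q > 1" "1 / p + 1 / q = 1"
    and w[measurable]: "w \<in> borel_measurable lebesgue" and w0: "\<And>x. w x \<ge> 0"
    and wfin: "\<And>R. (\<integral>\<^sup>+x\<in>ball 0 R. ennreal (w x) \<partial>lebesgue) < \<infinity>"
    and A: "A \<ge> 0"
    and dual: "\<And>f L g m. f \<in> Linf_c \<Longrightarrow> L > 0 \<Longrightarrow> localize L f 0 0 = f \<Longrightarrow>
      g \<in> borel_measurable lebesgue \<Longrightarrow> (\<And>x. 0 \<le> g x) \<Longrightarrow> (\<And>x. g x \<le> m) \<Longrightarrow>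
      (\<integral>\<^sup>+x\<in>cell L 0 0. ennreal (norm (T f x)) * ennreal (g x * w x) \<partial>lebesgue) \<le>
        ennreal A * (\<integral>\<^sup>+x. ennreal (norm (f x) powr p * w x) \<partial>lebesgue) +
        ennreal (1 / 2) * (\<integral>\<^sup>+x. ennreal (g x powr q * w x) \<partial>lebesgue)"
  shows "bounded_on_Lp_weight T p w"
  unfolding bounded_on_Lp_weight_def
proof (intro exI ballI)
  fix f :: "real ^ 'n \<Rightarrow> complex" assume f: "f \<in> Linf_c"
  let ?Y = "\<integral>\<^sup>+x. ennreal (norm (f x) powr p * w x) \<partial>lebesgue"
  note [measurable] = T_measurable[OF f]
  obtain R where R: "R > 0" "\<And>x. f x \<noteq> 0 \<Longrightarrow> x \<in> ball 0 R" using Linf_cE[OF f] by metis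
  define L where "L k = R + real k" for k :: nat
  have L: "L k > 0" for k using R by (simp add: L_def)
  have Q[measurable]: "cell (L k) 0 (0 :: real ^ 'n) \<in> sets lebesgue" for k using L by simp
  have card1: "real CARD('n) \<ge> 1" by (simp add: Suc_le_eq)
  have loc: "localize (L k) f 0 0 = f" for k
  proof -
    have "1 * L k \<le> 32 * real CARD('n) * L k" using card1 L[of k] by (intro mult_right_mono) linarith+
    then have "R \<le> 8 * (4 * real CARD('n) * L k / 2 ^ 0)" by (simp add: L_def)
    then have "ball 0 R \<subseteq> cell_ball (L k) 8 0 (0 :: real ^ 'n)" unfolding cell_ball_def by (rule subset_ball)
    then have "f x = 0" if "x \<notin> cell_ball (L k) 8 0 (0 :: real ^ 'n)" for x using R(2)[of x] that by blast
    then show ?thesis by (auto simp: localize_def restr_def fun_eq_iff)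
  qed
  define v where "v k x = (if x \<in> cell (L k) 0 0 then min (norm (T f x)) (real k) else 0)" for k x
  have v[measurable]: "v k \<in> borel_measurable lebesgue" for k
    unfolding v_def by (intro measurable_If_set) auto
  have v0: "v k x \<ge> 0" "v k x \<le> real k" "v k x \<le> norm (T f x)" for k x by (auto simp: v_def)
  have bound: "(\<integral>\<^sup>+x. ennreal (v k x powr p * w x) \<partial>lebesgue) \<le> 2 * (ennreal A * ?Y)" for k
  proof (rule ennreal_absorb_half)
    define g where "g x = v k x powr (p - 1)" for x
    have gq: "g x powr q = v k x powr p" for x
    proof -
      have "(p - 1) * q = p" using pq by (simp add: field_simps)
      then show ?thesis by (simp add: g_def powr_powr)
    qed
    have vp: "v k x powr p = v k x * g x" for x
      using v0(1)[of k x] powr_add[of "v k x" 1 "p - 1"] by (simp add: g_def)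
    have "(\<integral>\<^sup>+x. ennreal (v k x powr p * w x) \<partial>lebesgue) \<le>
        (\<integral>\<^sup>+x\<in>cell (L k) 0 0. ennreal (norm (T f x)) * ennreal (g x * w x) \<partial>lebesgue)"
    proof (intro nn_integral_mono)
      fix x
      show "ennreal (v k x powr p * w x) \<le> ennreal (norm (T f x)) * ennreal (g x * w x) * indicator (cell (L k) 0 0) x"
      proof (cases "x \<in> cell (L k) 0 0")
        case True
        have "v k x * g x * w x \<le> norm (T f x) * (g x * w x)"
          using v0(3)[of k x] w0[of x] mult_right_mono[of "v k x" "norm (T f x)" "g x * w x"] by (simp add: g_def mult.assoc)
        then show ?thesis using True w0[of x] by (simp add: vp ennreal_mult[symmetric] g_def ennreal_leI)
      qed (simp add: v_def)
    qed
    also have "\<dots> \<le> ennreal A * ?Y + ennreal (1 / 2) * (\<integral>\<^sup>+x. ennreal (g x powr q * w x) \<partial>lebesgue)"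
    proof (rule dual[OF f L loc])
      show "g \<in> borel_measurable lebesgue" unfolding g_def by measurable
      show "0 \<le> g x" for x by (simp add: g_def)
      show "g x \<le> real k powr (p - 1)" for x unfolding g_def using v0 pq by (intro powr_mono2) auto
    qed
    finally show "(\<integral>\<^sup>+x. ennreal (v k x powr p * w x) \<partial>lebesgue) \<le>
        ennreal A * ?Y + ennreal (1 / 2) * (\<integral>\<^sup>+x. ennreal (v k x powr p * w x) \<partial>lebesgue)"
      by (simp only: gq)
    let ?B = "ball 0 (real CARD('n) * (2 * L k / 2 ^ 0)) :: (real ^ 'n) set"
    have "(\<integral>\<^sup>+x. ennreal (v k x powr p * w x) \<partial>lebesgue) \<le> (\<integral>\<^sup>+x. ennreal (real k powr p) * (ennreal (w x) * indicator ?B x) \<partial>lebesgue)"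
    proof (intro nn_integral_mono)
      fix x
      show "ennreal (v k x powr p * w x) \<le> ennreal (real k powr p) * (ennreal (w x) * indicator ?B x)"
      proof (cases "x \<in> cell (L k) 0 0")
        case True
        then have "x \<in> ?B" using cell_subset_ball[OF L] by blast
        moreover have "v k x powr p * w x \<le> real k powr p * w x"
          using v0[where k = k and x = x] w0[of x] pq by (intro mult_right_mono powr_mono2) auto
        ultimately show ?thesis using w0[of x] by (simp add: ennreal_mult[symmetric] ennreal_leI)
      qed (simp add: v_def)
    qed
    also have "\<dots> = ennreal (real k powr p) * (\<integral>\<^sup>+x\<in>?B. ennreal (w x) \<partial>lebesgue)"
      by (rule nn_integral_cmult) measurable
    also have "\<dots> < \<infinity>" using wfin by (simp add: ennreal_mult_less_top)
    finally show "(\<integral>\<^sup>+x. ennreal (v k x powr p * w x) \<partial>lebesgue) < \<infinity>" .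
  qed
  have "(\<integral>\<^sup>+x. ennreal (norm (T f x) powr p * w x) \<partial>lebesgue) \<le> (\<integral>\<^sup>+x. liminf (\<lambda>k. ennreal (v k x powr p * w x)) \<partial>lebesgue)"
  proof (intro nn_integral_mono)
    fix x
    obtain k0 :: nat where k0: "norm x + norm (T f x) < real k0" using reals_Archimedean2 by blast
    have "v k x = norm (T f x)" if "k \<ge> k0" for k
    proof -
      have "real k0 \<le> real k" using that by simp
      then have "norm x < L k" "norm (T f x) \<le> real k"
        using k0 R(1) norm_ge_zero[of "T f x"] norm_ge_zero[of x] unfolding L_def by linarith+
      then have "x \<in> cell (L k) 0 0" using ball_subset_cell_0[OF L[of k]] by (auto simp: subset_iff)
      then show ?thesis using \<open>norm (T f x) \<le> real k\<close> by (simp add: v_def)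
    qed
    then have "eventually (\<lambda>k. ennreal (norm (T f x) powr p * w x) \<le> ennreal (v k x powr p * w x)) sequentially"
      by (intro eventually_sequentiallyI[of k0]) simp
    then show "ennreal (norm (T f x) powr p * w x) \<le> liminf (\<lambda>k. ennreal (v k x powr p * w x))"
      by (rule Liminf_bounded)
  qed
  also have "\<dots> \<le> liminf (\<lambda>k. \<integral>\<^sup>+x. ennreal (v k x powr p * w x) \<partial>lebesgue)"
    by (intro nn_integral_liminf) measurable
  also have "\<dots> \<le> limsup (\<lambda>k. \<integral>\<^sup>+x. ennreal (v k x powr p * w x) \<partial>lebesgue)" by (rule Liminf_le_Limsup) simp
  also have "\<dots> \<le> 2 * (ennreal A * ?Y)" using bound by (intro Limsup_bounded) auto
  also have "\<dots> = ennreal (2 * A) * ?Y" using A by (simp add: ennreal_mult mult.assoc)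
  also have "\<dots> \<le> ennreal (2 * A + 1) * ?Y" by (intro mult_right_mono ennreal_leI) auto
  finally show "Lp_norm p w (T f) \<le> ennreal ((2 * A + 1) powr (1 / p)) * Lp_norm p w f"
    unfolding Lp_norm_def using pq A by (intro ennpowr_le_of_le) auto
qed

text \<open>
  The function \<open>\<Theta>\<close> for sparse domination is a multiple of
  \<open>V1 powr (1 / r) * V2 * (\<sigma> powr (1 / p) * w powr (1 / q))\<close>, where \<open>V1\<close> is the maximal function of
  \<open>\<bar>f\<bar> ^ r / \<sigma>\<close> for the measure \<open>\<sigma> dx\<close> and \<open>V2\<close> that of \<open>g\<close> for \<open>w dx\<close>. The testing condition on
  balls is what makes the hypothesis of \<open>sparse_domination\<close> hold. Young's inequality splits the integral of
  \<open>\<Theta>\<close>; the maximal functions are bounded on the \<open>L\<close> spaces of exponents \<open>p / r\<close> and \<open>q\<close> for these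
  measures, and the relation between \<open>w\<close> and \<open>\<sigma>\<close> turns the first resulting integral into that of
  \<open>\<bar>f\<bar> powr p * w\<close>.
\<close>
lemma Lp_weight_bound_of_testing:
  assumes II: "cond_II T" and weak: "weak_type T r C" "C \<ge> 0" "r \<ge> 1"
    and pq: "p > 1" "q > 1" "1 / p + 1 / q = 1" and pr: "p > real r"
    and w[measurable]: "w \<in> borel_measurable lebesgue" and w_pos: "\<And>x. w x > 0"
    and \<sigma>[measurable]: "\<sigma> \<in> borel_measurable lebesgue" and \<sigma>_pos: "\<And>x. \<sigma> x > 0"
    and w_\<sigma>: "\<And>x. w x = \<sigma> x powr (1 - p / r)"
    and dbl_w: "doubling_measure (density lebesgue (\<lambda>x. ennreal (w x))) Dw"
    and dbl_\<sigma>: "doubling_measure (density lebesgue (\<lambda>x. ennreal (\<sigma> x))) D\<sigma>"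
    and K': "K' \<ge> 0"
    and testing: "\<And>c R E. R > 0 \<Longrightarrow> E \<in> sets lebesgue \<Longrightarrow> E \<subseteq> ball c R \<Longrightarrow>
      emeasure lebesgue (ball c R) \<le> ennreal (2 * ball_cell_ratio TYPE('n)) * emeasure lebesgue E \<Longrightarrow>
      ennreal ((enn2real (\<integral>\<^sup>+x\<in>ball c R. ennreal (\<sigma> x) \<partial>lebesgue) / measure lebesgue (ball c R)) powr (1 / r) *
          enn2real (\<integral>\<^sup>+x\<in>ball c R. ennreal (w x) \<partial>lebesgue))
        \<le> ennreal K' * (\<integral>\<^sup>+x\<in>E. ennreal (\<sigma> x powr (1 / p) * w x powr (1 / q)) \<partial>lebesgue)"
  shows "bounded_on_Lp_weight T p w"
proof -
  let ?\<nu>w = "density lebesgue (\<lambda>x. ennreal (w x))" and ?\<nu>\<sigma> = "density lebesgue (\<lambda>x. ennreal (\<sigma> x))"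
  let ?\<omega> = "\<lambda>x. \<sigma> x powr (1 / p) * w x powr (1 / q)"
  interpret W: doubling_measure ?\<nu>w Dw by (rule dbl_w)
  interpret S: doubling_measure ?\<nu>\<sigma> D\<sigma> by (rule dbl_\<sigma>)
  have pr1: "p / r > 1" using pr weak(3) by simp
  have em: "emeasure ?\<nu>w (ball c R) = (\<integral>\<^sup>+x\<in>ball c R. ennreal (w x) \<partial>lebesgue)"
    "emeasure ?\<nu>\<sigma> (ball c R) = (\<integral>\<^sup>+x\<in>ball c R. ennreal (\<sigma> x) \<partial>lebesgue)" for c R
    by (intro emeasure_density; simp)+
  obtain K where K: "K \<ge> 0"
    "\<And>L f G \<Theta> j z. L > 0 \<Longrightarrow> f \<in> Linf_c \<Longrightarrow> G \<in> borel_measurable lebesgue \<Longrightarrow> \<Theta> \<in> borel_measurable lebesgue \<Longrightarrow>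
      (\<And>k x E. E \<in> sets lebesgue \<Longrightarrow> E \<subseteq> cell L k x \<Longrightarrow> emeasure lebesgue (cell L k x) \<le> 2 * emeasure lebesgue E \<Longrightarrow>
         ennreal (local_mean L r f k x) * (\<integral>\<^sup>+y\<in>cell L k x. G y \<partial>lebesgue) \<le> (\<integral>\<^sup>+y\<in>E. \<Theta> y \<partial>lebesgue)) \<Longrightarrow>
      (\<integral>\<^sup>+y\<in>cell L j z. ennreal (norm (T (localize L f j z) y)) * G y \<partial>lebesgue) \<le> ennreal K * (\<integral>\<^sup>+y\<in>cell L j z. \<Theta> y \<partial>lebesgue)"
    by (rule sparse_domination[OF II weak]) blast
  define C1 where "C1 = S.strong_type_constant (p / r)"
  define C2 where "C2 = W.strong_type_constant q"
  have C12: "C1 \<ge> 0" "C2 \<ge> 0"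
    unfolding C1_def C2_def by (rule S.strong_type_constant_nonneg[OF pr1], rule W.strong_type_constant_nonneg[OF pq(2)])
  define \<delta> where "\<delta> = 1 / (2 * (K * C2 + 1))"
  have \<delta>: "\<delta> > 0" "K * \<delta> * C2 \<le> 1 / 2"
  proof -
    have "K * C2 \<ge> 0" using K(1) C12 by simp
    then show "\<delta> > 0" "K * \<delta> * C2 \<le> 1 / 2" by (simp_all add: \<delta>_def divide_simps)
  qed
  obtain A where A: "A \<ge> 0" "\<And>x y. x \<ge> 0 \<Longrightarrow> y \<ge> 0 \<Longrightarrow> K' * x * y \<le> A * x powr p + \<delta> * y powr q"
    using young_epsilon[OF pq K' \<delta>(1)] by blast
  show ?thesis
  proof (rule Lp_weight_bound_of_duality[OF pq w])
    show "0 \<le> w x" for x using w_pos[of x] by simp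
    show "(\<integral>\<^sup>+x\<in>ball 0 R. ennreal (w x) \<partial>lebesgue) < \<infinity>" for R unfolding em(1)[symmetric] by (rule W.fin)
    show "0 \<le> K * (A * C1)" using K A C12 by simp
    fix f :: "real ^ 'n \<Rightarrow> complex" and L mg :: real and g :: "real ^ 'n \<Rightarrow> real"
    assume f: "f \<in> Linf_c" and L: "L > 0" and loc: "localize L f 0 0 = f"
      and g[measurable]: "g \<in> borel_measurable lebesgue" and g0: "\<And>x. 0 \<le> g x" and mg: "\<And>x. g x \<le> mg"
    let ?Y = "\<integral>\<^sup>+x. ennreal (norm (f x) powr p * w x) \<partial>lebesgue" and ?Z = "\<integral>\<^sup>+x. ennreal (g x powr q * w x) \<partial>lebesgue"
    note [measurable] = Linf_c_measurable[OF f]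
    define \<phi> where "\<phi> x = norm (f x) ^ r / \<sigma> x" for x
    have \<phi>[measurable]: "\<phi> \<in> borel_measurable lebesgue" unfolding \<phi>_def by measurable
    have \<phi>0: "\<phi> x \<ge> 0" for x using \<sigma>_pos[of x] by (simp add: \<phi>_def)
    have \<phi>\<sigma>: "ennreal (\<sigma> x) * ennreal (\<phi> x) = ennreal (norm (f x) ^ r)" for x
      using \<sigma>_pos[of x] by (simp add: \<phi>_def ennreal_mult[symmetric])
    define M1 where "M1 = maximal ?\<nu>\<sigma> (\<lambda>x. ennreal (\<phi> x))"
    define M2 where "M2 = maximal ?\<nu>w (\<lambda>x. ennreal (g x))"
    have [measurable]: "M1 \<in> borel_measurable lebesgue" "M2 \<in> borel_measurable lebesgue"
      unfolding M1_def M2_def using S.maximal_measurable W.maximal_measurable by (auto intro: measurable_completion)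
    have M1fin: "AE x in lebesgue. M1 x < \<infinity>"
    proof -
      have "(\<integral>\<^sup>+x. ennreal (\<phi> x) \<partial>?\<nu>\<sigma>) = (\<integral>\<^sup>+x. ennreal (norm (f x) ^ r) \<partial>lebesgue)"
        by (subst nn_integral_density) (auto simp: \<phi>\<sigma>)
      then have "(\<integral>\<^sup>+x. ennreal (\<phi> x) \<partial>?\<nu>\<sigma>) < \<infinity>" using Linf_c_power_finite[OF f weak(3)] by simp
      then have "AE x in ?\<nu>\<sigma>. M1 x < \<infinity>" unfolding M1_def by (intro S.maximal_finite_AE) auto
      then show ?thesis using \<sigma>_pos by (subst (asm) AE_density) auto
    qed
    have "M2 x \<le> ennreal mg" for x
      unfolding M2_def using mg by (intro W.maximal_le_bound ennreal_leI) auto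
    then have M2fin: "M2 x < \<infinity>" for x by (rule le_less_trans) simp
    define V1 where "V1 x = enn2real (M1 x)" for x
    define V2 where "V2 x = enn2real (M2 x)" for x
    have V: "V1 x \<ge> 0" "V2 x \<ge> 0" "ennreal (V1 x) \<le> M1 x" "ennreal (V2 x) = M2 x" for x
      using M2fin[of x] by (auto simp: V1_def V2_def ennreal_enn2real_if)
    have V1_eq: "ennreal (V1 x) = M1 x" if "M1 x < \<infinity>" for x using that by (simp add: V1_def)
    have [measurable]: "V1 \<in> borel_measurable lebesgue" "V2 \<in> borel_measurable lebesgue"
      unfolding V1_def V2_def by measurable
    define \<Theta> where "\<Theta> x = ennreal (K' * V1 x powr (1 / r) * V2 x * ?\<omega> x)" for x
    have \<Theta>_meas: "\<Theta> \<in> borel_measurable lebesgue" unfolding \<Theta>_def by measurable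
    have carleson: "ennreal m * (\<integral>\<^sup>+x\<in>ball c R. ennreal (g x * w x) \<partial>lebesgue) \<le> (\<integral>\<^sup>+x\<in>E. \<Theta> x \<partial>lebesgue)"
      if R: "R > 0" and E[measurable]: "E \<in> sets lebesgue" and EB: "E \<subseteq> ball c R"
        and vol: "emeasure lebesgue (ball c R) \<le> ennreal (2 * ball_cell_ratio TYPE('n)) * emeasure lebesgue E"
        and m: "m \<ge> 0" "(\<integral>\<^sup>+x\<in>ball c R. ennreal (norm (f x) ^ r) \<partial>lebesgue) = ennreal (m ^ r) * emeasure lebesgue (ball c R)"
      for c R E m
    proof -
      obtain b where b: "emeasure lebesgue (ball c R) = ennreal b" "b > 0"
        using lebesgue.pos[OF R, of c] lebesgue.fin[of c R] by (cases "emeasure lebesgue (ball c R)") auto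
      obtain M where M: "emeasure ?\<nu>w (ball c R) = ennreal M" "M > 0"
        using W.pos[OF R, of c] W.fin[of c R] by (cases "emeasure ?\<nu>w (ball c R)") auto
      obtain s where s: "emeasure ?\<nu>\<sigma> (ball c R) = ennreal s" "s > 0"
        using S.pos[OF R, of c] S.fin[of c R] by (cases "emeasure ?\<nu>\<sigma> (ball c R)") auto
      have mb: "measure lebesgue (ball c R) = b" using b by (simp add: measure_def del: emeasure_completion measure_completion)
      define S where "S = (s / b) powr (1 / r) * M"
      have S: "S > 0" using s M b by (simp add: S_def)
      have SK: "ennreal S \<le> ennreal K' * (\<integral>\<^sup>+x\<in>E. ennreal (?\<omega> x) \<partial>lebesgue)"
        using testing[OF R E EB vol] M s unfolding em[symmetric] mb M(1) s(1) by (simp add: S_def)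
      have gw: "(\<integral>\<^sup>+x\<in>ball c R. ennreal (g x * w x) \<partial>lebesgue) = (\<integral>\<^sup>+x\<in>ball c R. ennreal (g x) \<partial>?\<nu>w)"
        using g0 w_pos
        by (subst nn_integral_density) (auto simp: ennreal_mult less_imp_le ac_simps intro!: nn_integral_cong)
      have f\<sigma>: "(\<integral>\<^sup>+x\<in>ball c R. ennreal (norm (f x) ^ r) \<partial>lebesgue) = (\<integral>\<^sup>+x\<in>ball c R. ennreal (\<phi> x) \<partial>?\<nu>\<sigma>)"
        by (subst nn_integral_density) (auto simp: \<phi>\<sigma>[symmetric] ac_simps intro!: nn_integral_cong)
      let ?J = "ennreal m * (\<integral>\<^sup>+x\<in>ball c R. ennreal (g x * w x) \<partial>lebesgue)"
      have pt: "?J \<le> ennreal (V1 y powr (1 / r) * V2 y * S)" if y: "y \<in> ball c R" and fin: "M1 y < \<infinity>" for y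
      proof -
        have "ennreal (m ^ r) * ennreal b \<le> M1 y * ennreal s"
          using m(2) S.average_le_maximal[OF y, of "\<lambda>x. ennreal (\<phi> x)"]
          unfolding b(1) s(1) M1_def f\<sigma>[symmetric] by simp
        then have "m ^ r * b \<le> V1 y * s"
          unfolding V1_eq[OF fin, symmetric] using V(1)[of y] s m b
          by (simp add: ennreal_mult[symmetric] ennreal_le_iff)
        then have "m ^ r \<le> V1 y * (s / b)" using b by (simp add: pos_le_divide_eq)
        then have "(m ^ r) powr (1 / r) \<le> (V1 y * (s / b)) powr (1 / r)" using m weak(3) by (intro powr_mono2) auto
        moreover have "(m ^ r) powr (1 / r) = m"
          using m weak(3) by (simp add: powr_realpow'[symmetric] powr_powr)
        moreover have "(V1 y * (s / b)) powr (1 / r) = V1 y powr (1 / r) * (s / b) powr (1 / r)"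
          using V(1)[of y] s b by (simp add: powr_mult del: times_divide_eq_right)
        ultimately have "m \<le> V1 y powr (1 / r) * (s / b) powr (1 / r)" by (simp only:)
        then have "ennreal m \<le> ennreal (V1 y powr (1 / r) * (s / b) powr (1 / r))" by (rule ennreal_leI)
        moreover have "(\<integral>\<^sup>+x\<in>ball c R. ennreal (g x * w x) \<partial>lebesgue) \<le> ennreal (V2 y) * ennreal M"
          using W.average_le_maximal[OF y, of "\<lambda>x. ennreal (g x)"] unfolding gw M(1) V(4) M2_def .
        ultimately have "?J \<le> ennreal (V1 y powr (1 / r) * (s / b) powr (1 / r)) * (ennreal (V2 y) * ennreal M)"
          by (intro mult_mono) auto
        also have "\<dots> = ennreal (V1 y powr (1 / r) * V2 y * S)"
          using V(2)[of y] M by (simp add: S_def ennreal_mult[symmetric] ac_simps)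
        finally show ?thesis .
      qed
      have "?J = ?J * ennreal (1 / S) * ennreal S" using S by (simp add: mult.assoc ennreal_mult[symmetric])
      also have "\<dots> \<le> ?J * ennreal (1 / S) * (ennreal K' * (\<integral>\<^sup>+x\<in>E. ennreal (?\<omega> x) \<partial>lebesgue))"
        by (intro mult_left_mono SK) auto
      also have "\<dots> = (\<integral>\<^sup>+x. ?J * ennreal (1 / S) * (ennreal K' * (ennreal (?\<omega> x) * indicator E x)) \<partial>lebesgue)"
        by (simp add: nn_integral_cmult)
      also have "\<dots> \<le> (\<integral>\<^sup>+x\<in>E. \<Theta> x \<partial>lebesgue)"
      proof (rule nn_integral_mono_AE, use M1fin in eventually_elim)
        case (elim y)
        show ?case
        proof (cases "y \<in> E")
          case True
          then have "?J * ennreal (1 / S) \<le> ennreal (V1 y powr (1 / r) * V2 y * S) * ennreal (1 / S)"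
            using EB elim by (intro mult_right_mono pt) auto
          also have "\<dots> = ennreal (V1 y powr (1 / r) * V2 y)" using S V(2)[of y] by (simp add: ennreal_mult[symmetric])
          finally have "?J * ennreal (1 / S) * (ennreal K' * ennreal (?\<omega> y)) \<le> ennreal (V1 y powr (1 / r) * V2 y) * (ennreal K' * ennreal (?\<omega> y))"
            by (rule mult_right_mono) simp
          also have "\<dots> = \<Theta> y"
            unfolding \<Theta>_def using V(2)[of y] K' by (simp add: ennreal_mult[symmetric] ac_simps)
          finally show ?thesis using True by simp
        qed simp
      qed
      finally show ?thesis .
    qed
    have i1: "(\<integral>\<^sup>+x. ennreal (V1 x powr (p / r) * \<sigma> x) \<partial>lebesgue) \<le> ennreal C1 * ?Y"
    proof -
      have "(\<integral>\<^sup>+x. ennreal (V1 x powr (p / r) * \<sigma> x) \<partial>lebesgue) = (\<integral>\<^sup>+x. ennreal (V1 x powr (p / r)) \<partial>?\<nu>\<sigma>)"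
        using \<sigma>_pos by (subst nn_integral_density) (auto simp: ennreal_mult[symmetric] less_imp_le mult.commute)
      also have "\<dots> \<le> ennreal C1 * (\<integral>\<^sup>+x. ennreal (\<phi> x powr (p / r)) \<partial>?\<nu>\<sigma>)"
        unfolding C1_def using V(1,3) \<phi>0 by (intro S.maximal_strong_type pr1) (auto simp: M1_def)
      also have "(\<integral>\<^sup>+x. ennreal (\<phi> x powr (p / r)) \<partial>?\<nu>\<sigma>) = ?Y"
      proof -
        have "ennreal (\<sigma> x) * ennreal (\<phi> x powr (p / r)) = ennreal (norm (f x) powr p * w x)" for x
        proof -
          have "(norm (f x) ^ r) powr (p / r) = norm (f x) powr p"
            using weak(3) by (simp add: powr_realpow'[symmetric] powr_powr)
          then have "\<phi> x powr (p / r) = norm (f x) powr p / \<sigma> x powr (p / r)"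
            using \<sigma>_pos[of x] by (simp add: \<phi>_def powr_divide)
          then have "\<sigma> x * \<phi> x powr (p / r) = norm (f x) powr p * w x"
            using \<sigma>_pos[of x] by (simp add: w_\<sigma> powr_diff)
          then show ?thesis using \<sigma>_pos[of x] by (simp add: ennreal_mult[symmetric])
        qed
        then show ?thesis by (subst nn_integral_density) auto
      qed
      finally show ?thesis .
    qed
    have i2: "(\<integral>\<^sup>+x. ennreal (V2 x powr q * w x) \<partial>lebesgue) \<le> ennreal C2 * ?Z"
    proof -
      have dens: "(\<integral>\<^sup>+x. ennreal (h x powr q * w x) \<partial>lebesgue) = (\<integral>\<^sup>+x. ennreal (h x powr q) \<partial>?\<nu>w)"
        if "h \<in> borel_measurable lebesgue" for h :: "real ^ 'n \<Rightarrow> real"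
        using w_pos that by (subst nn_integral_density) (auto simp: ennreal_mult[symmetric] less_imp_le mult.commute)
      show ?thesis
        unfolding C2_def dens[OF g] dens[OF \<open>V2 \<in> borel_measurable lebesgue\<close>]
        using V(2) g0 eq_refl[OF V(4)] by (intro W.maximal_strong_type pq) (auto simp: M2_def)
    qed
    have "(\<integral>\<^sup>+y\<in>cell L 0 0. ennreal (norm (T (localize L f 0 0) y)) * ennreal (g y * w y) \<partial>lebesgue) \<le> ennreal K * (\<integral>\<^sup>+y\<in>cell L 0 0. \<Theta> y \<partial>lebesgue)"
    proof (rule K(2)[OF L f _ \<Theta>_meas])
      show "(\<lambda>y. ennreal (g y * w y)) \<in> borel_measurable lebesgue" by measurable
      fix k and x :: "real ^ 'n" and E
      assume E: "E \<in> sets lebesgue" "E \<subseteq> cell L k x" "emeasure lebesgue (cell L k x) \<le> 2 * emeasure lebesgue E"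
      define R where "R = 8 * (4 * real CARD('n) * L / 2 ^ k)"
      have R: "R > 0" using L by (simp add: R_def)
      have B: "cell_ball L 8 k x = ball x R" by (simp add: cell_ball_def R_def)
      have cB: "cell L k x \<subseteq> ball x R"
        using cell_subset_cell_ball[OF L, of k x] cell_ball_mono[OF L, of 1 8 k x] by (auto simp: B)
      have "emeasure lebesgue (ball x R) \<le> ennreal (ball_cell_ratio TYPE('n)) * (2 * emeasure lebesgue E)"
        unfolding B[symmetric] emeasure_cell_ball[OF L] by (intro mult_left_mono E) auto
      also have "\<dots> = ennreal (2 * ball_cell_ratio TYPE('n)) * emeasure lebesgue E"
        by (simp add: ennreal_mult ac_simps)
      finally have vol: "emeasure lebesgue (ball x R) \<le> ennreal (2 * ball_cell_ratio TYPE('n)) * emeasure lebesgue E" .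
      have "ennreal (local_mean L r f k x) * (\<integral>\<^sup>+y\<in>cell L k x. ennreal (g y * w y) \<partial>lebesgue) \<le>
          ennreal (local_mean L r f k x) * (\<integral>\<^sup>+y\<in>ball x R. ennreal (g y * w y) \<partial>lebesgue)"
        using cB by (intro mult_left_mono nn_integral_mono) (auto simp: indicator_def)
      also have "\<dots> \<le> (\<integral>\<^sup>+y\<in>E. \<Theta> y \<partial>lebesgue)"
        using E(2) cB local_mean_power[OF L f weak(3)]
        by (intro carleson[OF R E(1) _ vol local_mean_nonneg[OF weak(3)]]) (auto simp only: B[symmetric])
      finally show "ennreal (local_mean L r f k x) * (\<integral>\<^sup>+y\<in>cell L k x. ennreal (g y * w y) \<partial>lebesgue) \<le> (\<integral>\<^sup>+y\<in>E. \<Theta> y \<partial>lebesgue)" .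
    qed
    also have "\<dots> \<le> ennreal K * (\<integral>\<^sup>+x. ennreal A * ennreal (V1 x powr (p / r) * \<sigma> x) + ennreal \<delta> * ennreal (V2 x powr q * w x) \<partial>lebesgue)"
    proof (intro mult_left_mono nn_integral_mono)
      fix x
      have "K' * V1 x powr (1 / r) * V2 x * ?\<omega> x = K' * (V1 x powr (1 / r) * \<sigma> x powr (1 / p)) * (V2 x * w x powr (1 / q))"
        by simp
      also have "\<dots> \<le> A * (V1 x powr (1 / r) * \<sigma> x powr (1 / p)) powr p + \<delta> * (V2 x * w x powr (1 / q)) powr q"
        using V(2)[of x] by (intro A(2)) auto
      also have "\<dots> = A * (V1 x powr (p / r) * \<sigma> x) + \<delta> * (V2 x powr q * w x)"
        using V(1,2)[of x] \<sigma>_pos[of x] w_pos[of x] pq by (simp add: powr_mult powr_powr)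
      finally have "\<Theta> x \<le> ennreal (A * (V1 x powr (p / r) * \<sigma> x) + \<delta> * (V2 x powr q * w x))"
        unfolding \<Theta>_def by (rule ennreal_leI)
      also have "\<dots> = ennreal A * ennreal (V1 x powr (p / r) * \<sigma> x) + ennreal \<delta> * ennreal (V2 x powr q * w x)"
        using A(1) \<delta> \<sigma>_pos[of x] w_pos[of x] by (subst ennreal_plus) (auto simp: ennreal_mult[symmetric] less_imp_le)
      finally show "\<Theta> x * indicator (cell L 0 0) x \<le> ennreal A * ennreal (V1 x powr (p / r) * \<sigma> x) + ennreal \<delta> * ennreal (V2 x powr q * w x)"
        by (auto simp: indicator_def)
    qed simp
    also have "\<dots> = ennreal K * (ennreal A * (\<integral>\<^sup>+x. ennreal (V1 x powr (p / r) * \<sigma> x) \<partial>lebesgue) + ennreal \<delta> * (\<integral>\<^sup>+x. ennreal (V2 x powr q * w x) \<partial>lebesgue))"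
      by (subst nn_integral_add) (auto simp: nn_integral_cmult)
    also have "\<dots> \<le> ennreal K * (ennreal A * (ennreal C1 * ?Y) + ennreal \<delta> * (ennreal C2 * ?Z))"
      by (intro add_mono mult_left_mono i1 i2) auto
    also have "\<dots> = ennreal (K * (A * C1)) * ?Y + ennreal (K * \<delta> * C2) * ?Z"
      using K(1) A(1) C12 \<delta> by (simp add: distrib_left ennreal_mult mult.assoc)
    also have "\<dots> \<le> ennreal (K * (A * C1)) * ?Y + ennreal (1 / 2) * ?Z"
      by (intro add_left_mono mult_right_mono ennreal_leI \<delta>) auto
    finally show "(\<integral>\<^sup>+x\<in>cell L 0 0. ennreal (norm (T f x)) * ennreal (g x * w x) \<partial>lebesgue) \<le> ennreal (K * (A * C1)) * ?Y + ennreal (1 / 2) * ?Z"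
      unfolding loc .
  qed
qed

end

text \<open>
  Weak type \<open>(2, 2)\<close> and both weights equal to \<open>1\<close>; the testing condition only compares the measures of \<open>E\<close>
  and of the ball.
\<close>
lemma (in L2_operator) Lp_bounded_above_2:
  assumes II: "cond_II T" and p: "p > 2"
  shows "bounded_on_Lp T p"
proof -
  obtain C where C: "C \<ge> 0" "weak_type T 2 C" by (rule weak_type_2)
  have pq: "p > 1" "p / (p - 1) > 1" "1 / p + 1 / (p / (p - 1)) = 1" using p by (auto simp: field_simps)
  have dbl: "doubling_measure (density lebesgue (\<lambda>x :: real ^ 'n. ennreal 1)) (5 ^ CARD('n))"
    using doubling_lebesgue by (simp add: density_1)
  show ?thesis
  proof (rule Lp_weight_bound_of_testing[OF II C(2,1) _ pq _ _ _ _ _ _ dbl dbl])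
    fix c :: "real ^ 'n" and R :: real and E
    assume R: "R > 0" and E: "E \<in> sets lebesgue"
      and vol: "emeasure lebesgue (ball c R) \<le> ennreal (2 * ball_cell_ratio TYPE('n)) * emeasure lebesgue E"
    have b: "emeasure lebesgue (ball c R) = ennreal (measure lebesgue (ball c R))"
      using lebesgue.fin[of c R] by (intro emeasure_eq_ennreal_measure) auto
    have "measure lebesgue (ball c R) > 0" using lebesgue.pos[OF R, of c] unfolding b by simp
    then show "ennreal ((enn2real (\<integral>\<^sup>+x\<in>ball c R. ennreal 1 \<partial>lebesgue) / measure lebesgue (ball c R)) powr (1 / real 2) *
          enn2real (\<integral>\<^sup>+x\<in>ball c R. ennreal 1 \<partial>lebesgue))
        \<le> ennreal (2 * ball_cell_ratio TYPE('n)) * (\<integral>\<^sup>+x\<in>E. ennreal (1 powr (1 / p) * 1 powr (1 / (p / (p - 1)))) \<partial>lebesgue)"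
      using vol E by (simp add: b del: emeasure_completion measure_completion)
  qed (use p in auto)
qed

section \<open>Muckenhoupt weights\<close>
text \<open>
  Hoelder's inequality with exponents \<open>1 / \<theta>\<close> and \<open>1 / (1 - \<theta>)\<close>, including the trivial case
  \<open>\<theta> = 1\<close>, which occurs below for \<open>p = 2\<close>.
\<close>
lemma holder_interpolation:
  fixes f g :: "'a \<Rightarrow> real"
  assumes [measurable]: "f \<in> borel_measurable M" "g \<in> borel_measurable M" "E \<in> sets M"
    and pos: "\<And>x. f x > 0" "\<And>x. g x > 0" and \<theta>: "0 < \<theta>" "\<theta> \<le> 1" and FG: "F > 0" "G > 0"
    and F: "(\<integral>\<^sup>+x\<in>E. ennreal (f x) \<partial>M) \<le> ennreal F" and G: "(\<integral>\<^sup>+x\<in>E. ennreal (g x) \<partial>M) \<le> ennreal G"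
  shows "(\<integral>\<^sup>+x\<in>E. ennreal (f x powr \<theta> * g x powr (1 - \<theta>)) \<partial>M) \<le> ennreal (F powr \<theta> * G powr (1 - \<theta>))"
proof -
  let ?H = "F powr \<theta> * G powr (1 - \<theta>)"
  have pt: "f x powr \<theta> * g x powr (1 - \<theta>) \<le> ?H * (\<theta> / F) * f x + ?H * ((1 - \<theta>) / G) * g x" for x
  proof -
    have "(f x / F) powr \<theta> * (g x / G) powr (1 - \<theta>) \<le> \<theta> * (f x / F) + (1 - \<theta>) * (g x / G)"
      using \<theta> pos FG by (intro Youngs_inequality_0) auto
    then have "?H * ((f x / F) powr \<theta> * (g x / G) powr (1 - \<theta>)) \<le> ?H * (\<theta> * (f x / F) + (1 - \<theta>) * (g x / G))"
      by (intro mult_left_mono) auto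
    moreover have "?H * ((f x / F) powr \<theta> * (g x / G) powr (1 - \<theta>)) = f x powr \<theta> * g x powr (1 - \<theta>)"
      using FG pos[of x] by (simp add: powr_divide)
    ultimately show ?thesis by (simp add: algebra_simps)
  qed
  have "(\<integral>\<^sup>+x\<in>E. ennreal (f x powr \<theta> * g x powr (1 - \<theta>)) \<partial>M) \<le>
     (\<integral>\<^sup>+x. ennreal (?H * (\<theta> / F)) * (ennreal (f x) * indicator E x) + ennreal (?H * ((1 - \<theta>) / G)) * (ennreal (g x) * indicator E x) \<partial>M)"
  proof (intro nn_integral_mono)
    fix x
    have "ennreal (f x powr \<theta> * g x powr (1 - \<theta>)) \<le> ennreal (?H * (\<theta> / F) * f x + ?H * ((1 - \<theta>) / G) * g x)"
      by (rule ennreal_leI[OF pt])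
    also have "\<dots> = ennreal (?H * (\<theta> / F)) * ennreal (f x) + ennreal (?H * ((1 - \<theta>) / G)) * ennreal (g x)"
      using \<theta> FG pos[of x] by (subst ennreal_plus) (auto simp: ennreal_mult[symmetric])
    finally show "ennreal (f x powr \<theta> * g x powr (1 - \<theta>)) * indicator E x \<le>
       ennreal (?H * (\<theta> / F)) * (ennreal (f x) * indicator E x) + ennreal (?H * ((1 - \<theta>) / G)) * (ennreal (g x) * indicator E x)"
      by (auto simp: indicator_def)
  qed
  also have "\<dots> = ennreal (?H * (\<theta> / F)) * (\<integral>\<^sup>+x\<in>E. ennreal (f x) \<partial>M) + ennreal (?H * ((1 - \<theta>) / G)) * (\<integral>\<^sup>+x\<in>E. ennreal (g x) \<partial>M)"
    by (subst nn_integral_add) (auto simp: nn_integral_cmult)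
  also have "\<dots> \<le> ennreal (?H * (\<theta> / F)) * ennreal F + ennreal (?H * ((1 - \<theta>) / G)) * ennreal G"
    by (intro add_mono mult_left_mono F G) auto
  also have "\<dots> = ennreal (?H * (\<theta> / F) * F + ?H * ((1 - \<theta>) / G) * G)"
    using \<theta> FG by (simp add: ennreal_mult[symmetric] ennreal_plus[symmetric] del: ennreal_plus)
  also have "?H * (\<theta> / F) * F + ?H * ((1 - \<theta>) / G) * G = ?H" using FG by (simp add: field_simps)
  finally show ?thesis .
qed

text \<open>
  The \<open>A\<^sub>p\<close> condition in a form that is symmetric under the exchange of \<open>(p, w)\<close> and \<open>(q, \<sigma>)\<close>: the second
  weight is \<open>\<sigma> = w powr (1 - q)\<close>, encoded by the identity \<open>w powr (1 / p) * \<sigma> powr (1 / q) = 1\<close>. By symmetry every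
  statement about \<open>w\<close> holds for \<open>\<sigma>\<close>.
\<close>
locale dual_weights =
  fixes p q K :: real and w \<sigma> :: "real ^ 'n \<Rightarrow> real"
  assumes pq: "p > 1" "q > 1" "1 / p + 1 / q = 1"
    and w_meas: "w \<in> borel_measurable lebesgue" and \<sigma>_meas: "\<sigma> \<in> borel_measurable lebesgue"
    and w_pos: "\<And>x. w x > 0" and \<sigma>_pos: "\<And>x. \<sigma> x > 0"
    and dual: "\<And>x. w x powr (1 / p) * \<sigma> x powr (1 / q) = 1"
    and w_fin: "\<And>c R. (\<integral>\<^sup>+x\<in>ball c R. ennreal (w x) \<partial>lebesgue) < \<infinity>"
    and \<sigma>_fin: "\<And>c R. (\<integral>\<^sup>+x\<in>ball c R. ennreal (\<sigma> x) \<partial>lebesgue) < \<infinity>"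
    and A_p: "\<And>c R. R > 0 \<Longrightarrow>
      enn2real (\<integral>\<^sup>+x\<in>ball c R. ennreal (w x) \<partial>lebesgue) powr (1 / p) *
      enn2real (\<integral>\<^sup>+x\<in>ball c R. ennreal (\<sigma> x) \<partial>lebesgue) powr (1 / q) \<le> K * measure lebesgue (ball c R)"
begin

lemma swap: "dual_weights q p K \<sigma> w"
  using pq w_meas \<sigma>_meas w_pos \<sigma>_pos dual w_fin \<sigma>_fin A_p
  by unfold_locales (auto simp: mult.commute add.commute)

definition mass :: "real ^ 'n \<Rightarrow> real \<Rightarrow> real" where
  "mass c R = enn2real (\<integral>\<^sup>+x\<in>ball c R. ennreal (w x) \<partial>lebesgue)"

lemma set_integral_pos:
  assumes E: "E \<in> sets lebesgue" "emeasure lebesgue E > 0"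
  shows "(\<integral>\<^sup>+x\<in>E. ennreal (w x) \<partial>lebesgue) > 0"
proof (rule ccontr)
  note [measurable] = w_meas E(1)
  assume "\<not> ?thesis"
  then have "(\<integral>\<^sup>+x\<in>E. ennreal (w x) \<partial>lebesgue) = 0" by (simp add: zero_less_iff_neq_zero)
  then have "AE x in lebesgue. ennreal (w x) * indicator E x = 0"
    by (subst (asm) nn_integral_0_iff_AE) auto
  then have "AE x in lebesgue. x \<notin> E"
  proof eventually_elim
    case (elim x)
    have "ennreal (w x) > 0" using w_pos[of x] by simp
    then show ?case using elim by (auto simp: indicator_def)
  qed
  then have "emeasure lebesgue E = 0" using E(1) by (simp add: AE_iff_measurable[OF E(1)])
  then show False using E(2) by simp
qed

lemma mass_eq:
  assumes "R > 0"
  shows "(\<integral>\<^sup>+x\<in>ball c R. ennreal (w x) \<partial>lebesgue) = ennreal (mass c R)" "mass c R > 0"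
proof -
  have "(\<integral>\<^sup>+x\<in>ball c R. ennreal (w x) \<partial>lebesgue) > 0"
    using lebesgue.pos[OF assms] by (intro set_integral_pos) auto
  then show "(\<integral>\<^sup>+x\<in>ball c R. ennreal (w x) \<partial>lebesgue) = ennreal (mass c R)" "mass c R > 0"
    unfolding mass_def using w_fin[of c R] by (auto simp: enn2real_positive_iff less_top[symmetric])
qed

end

sublocale dual_weights \<subseteq> other: dual_weights q p K \<sigma> w
  by (rule swap)

context dual_weights
begin

lemma A_p_mass: "R > 0 \<Longrightarrow> mass c R powr (1 / p) * other.mass c R powr (1 / q) \<le> K * measure lebesgue (ball c R)"
  using A_p by (simp add: mass_def other.mass_def)

lemma measure_ball_pos: "R > 0 \<Longrightarrow> measure lebesgue (ball (c :: real ^ 'n) R) > 0"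
  and emeasure_ball_eq: "emeasure lebesgue (ball (c :: real ^ 'n) R) = ennreal (measure lebesgue (ball c R))"
proof -
  show *: "emeasure lebesgue (ball c R) = ennreal (measure lebesgue (ball c R))" for c :: "real ^ 'n" and R
    using lebesgue.fin[of c R] by (intro emeasure_eq_ennreal_measure) auto
  assume "R > 0"
  then show "measure lebesgue (ball c R) > 0"
    using lebesgue.pos[of R c] unfolding * by (simp del: emeasure_completion measure_completion)
qed

lemma K_pos: "K > 0"
proof -
  have "0 < mass 0 1 powr (1 / p) * other.mass 0 1 powr (1 / q)"
    using mass_eq(2)[of 1 0] other.mass_eq(2)[of 1 0] by simp
  also have "\<dots> \<le> K * measure lebesgue (ball (0 :: real ^ 'n) 1)" by (rule A_p_mass) simp
  finally show ?thesis using measure_ball_pos[of 1 0] by (simp add: zero_less_mult_iff)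
qed

lemma exponents: "1 - 1 / p = 1 / q" "p / q = p - 1" "q / p = q - 1"
  using pq by (auto simp: field_simps)

text \<open>
  A subset that is not too small carries a fixed proportion of the weight of the ball: by Hoelder's
  inequality the measure \<open>e\<close> of the subset is at most the product of the powers \<open>1 / p\<close> of its \<open>w\<close>-mass and
  \<open>1 / q\<close> of the \<open>\<sigma>\<close>-mass of the ball, and the latter is controlled by the \<open>A\<^sub>p\<close> condition.
\<close>
lemma mass_le_subset:
  assumes R: "R > 0" and E: "E \<in> sets lebesgue" "E \<subseteq> ball c R"
    and e: "emeasure lebesgue E = ennreal e" "e > 0" and i: "(\<integral>\<^sup>+x\<in>E. ennreal (w x) \<partial>lebesgue) = ennreal i"
  shows "mass c R \<le> (K * measure lebesgue (ball c R) / e) powr p * i"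
proof -
  let ?b = "measure lebesgue (ball c R)"
  have "0 < (\<integral>\<^sup>+x\<in>E. ennreal (w x) \<partial>lebesgue)" using e by (intro set_integral_pos E) simp
  then have i0: "i > 0" by (simp add: i)
  have s: "other.mass c R > 0" by (rule other.mass_eq(2)[OF R])
  have "ennreal e = (\<integral>\<^sup>+x\<in>E. ennreal (w x powr (1 / p) * \<sigma> x powr (1 - 1 / p)) \<partial>lebesgue)"
    using E(1) by (simp add: exponents dual e(1)[symmetric] del: emeasure_completion)
  also have "\<dots> \<le> ennreal (i powr (1 / p) * other.mass c R powr (1 - 1 / p))"
  proof (rule holder_interpolation[OF w_meas \<sigma>_meas E(1) w_pos \<sigma>_pos _ _ i0 s])
    have "(\<integral>\<^sup>+x\<in>E. ennreal (\<sigma> x) \<partial>lebesgue) \<le> (\<integral>\<^sup>+x\<in>ball c R. ennreal (\<sigma> x) \<partial>lebesgue)"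
      using E(2) by (intro nn_integral_mono) (auto simp: indicator_def)
    then show "(\<integral>\<^sup>+x\<in>E. ennreal (\<sigma> x) \<partial>lebesgue) \<le> ennreal (other.mass c R)" by (simp add: other.mass_eq(1)[OF R])
  qed (use pq i in auto)
  finally have e_le: "e \<le> i powr (1 / p) * other.mass c R powr (1 / q)"
    by (simp add: exponents ennreal_le_iff)
  have m: "mass c R > 0" by (rule mass_eq(2)[OF R])
  have "mass c R powr (1 / p) * e \<le> mass c R powr (1 / p) * (i powr (1 / p) * other.mass c R powr (1 / q))"
    by (intro mult_left_mono e_le) simp
  also have "\<dots> = (mass c R powr (1 / p) * other.mass c R powr (1 / q)) * i powr (1 / p)" by simp
  also have "\<dots> \<le> (K * ?b) * i powr (1 / p)" by (intro mult_right_mono A_p_mass R) simp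
  finally have "mass c R powr (1 / p) \<le> K * ?b / e * i powr (1 / p)" using e(2) by (simp add: field_simps)
  then have "(mass c R powr (1 / p)) powr p \<le> (K * ?b / e * i powr (1 / p)) powr p"
    using pq by (intro powr_mono2) auto
  moreover have "(K * ?b / e * i powr (1 / p)) powr p = (K * ?b / e) powr p * i"
  proof -
    have "K * ?b / e \<ge> 0" using K_pos e by simp
    moreover have "(i powr (1 / p)) powr p = i" using pq i0 by (simp add: powr_powr)
    ultimately show ?thesis by (simp add: powr_mult del: times_divide_eq_left measure_completion)
  qed
  ultimately show ?thesis using pq m by (simp add: powr_powr)
qed

lemma emeasure_density_ball: "emeasure (density lebesgue (\<lambda>x. ennreal (w x))) (ball c R) = (\<integral>\<^sup>+x\<in>ball c R. ennreal (w x) \<partial>lebesgue)"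
  using w_meas by (intro emeasure_density) auto

lemma doubling: "doubling_measure (density lebesgue (\<lambda>x. ennreal (w x))) ((K * 5 ^ CARD('n)) powr p)"
proof
  show "sets (density lebesgue (\<lambda>x. ennreal (w x))) = sets lebesgue" by simp
  show "0 < emeasure (density lebesgue (\<lambda>x. ennreal (w x))) (ball c r)" if "r > 0" for c r
    unfolding emeasure_density_ball mass_eq(1)[OF that] using mass_eq(2)[OF that] by simp
  show "emeasure (density lebesgue (\<lambda>x. ennreal (w x))) (ball c r) < \<infinity>" for c r
    unfolding emeasure_density_ball by (rule w_fin)
  fix c :: "real ^ 'n" and r :: real assume r: "r > 0"
  have b: "measure lebesgue (ball c (5 * r)) = 5 ^ CARD('n) * measure lebesgue (ball c r)"
    using emeasure_lebesgue_ball_scale[of 5 r c c] r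
    unfolding emeasure_ball_eq by (simp add: ennreal_mult[symmetric] del: measure_completion)
  have "mass c (5 * r) \<le> (K * measure lebesgue (ball c (5 * r)) / measure lebesgue (ball c r)) powr p * mass c r"
  proof (rule mass_le_subset)
    show "emeasure lebesgue (ball c r) = ennreal (measure lebesgue (ball c r))" by (rule emeasure_ball_eq)
    show "measure lebesgue (ball c r) > 0" by (rule measure_ball_pos[OF r])
    show "(\<integral>\<^sup>+x\<in>ball c r. ennreal (w x) \<partial>lebesgue) = ennreal (mass c r)" by (rule mass_eq(1)[OF r])
  qed (use r in \<open>auto simp: subset_ball simp del: mem_ball\<close>)
  also have "K * measure lebesgue (ball c (5 * r)) / measure lebesgue (ball c r) = K * 5 ^ CARD('n)"
    unfolding b using measure_ball_pos[OF r, of c] by (simp del: measure_completion)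
  finally have "ennreal (mass c (5 * r)) \<le> ennreal ((K * 5 ^ CARD('n)) powr p) * ennreal (mass c r)"
    using mass_eq(2)[OF r, of c] by (simp add: ennreal_mult[symmetric] ennreal_leI)
  then show "emeasure (density lebesgue (\<lambda>x. ennreal (w x))) (ball c (5 * r)) \<le> ennreal ((K * 5 ^ CARD('n)) powr p) * emeasure (density lebesgue (\<lambda>x. ennreal (w x))) (ball c r)"
    unfolding emeasure_density_ball using mass_eq(1)[of r c] mass_eq(1)[of "5 * r" c] r by simp
qed

text \<open>
  The testing condition for the pair \<open>(w, \<sigma>)\<close>, where \<open>\<sigma> powr (1 / p) * w powr (1 / q) = \<sigma> * w\<close>. With
  \<open>\<theta> = 1 / (p - 1)\<close> one has \<open>(\<sigma> * w) powr \<theta> * \<sigma> powr (1 - \<theta>) = 1\<close>, so Hoelder's inequality bounds the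
  measure of \<open>E\<close> by the integral of \<open>\<sigma> * w\<close> over \<open>E\<close> and the \<open>\<sigma>\<close>-mass of the ball. This needs \<open>\<theta> \<le> 1\<close>; for
  \<open>p < 2\<close> the two weights change roles.
\<close>
lemma mass_product_le_of_ge_2:
  assumes p2: "p \<ge> 2" and R: "R > 0" and E: "E \<in> sets lebesgue" "E \<subseteq> ball c R" and \<eta>: "\<eta> > 0"
    and vol: "emeasure lebesgue (ball c R) \<le> ennreal \<eta> * emeasure lebesgue E"
  shows "ennreal (mass c R * other.mass c R) \<le>
    ennreal (K powr p * \<eta> powr (p - 1) * measure lebesgue (ball c R)) * (\<integral>\<^sup>+x\<in>E. ennreal (\<sigma> x * w x) \<partial>lebesgue)"
proof -
  note [measurable] = w_meas \<sigma>_meas E(1)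
  let ?b = "measure lebesgue (ball c R)" and ?m = "mass c R" and ?s = "other.mass c R"
  let ?I = "\<integral>\<^sup>+x\<in>E. ennreal (\<sigma> x * w x) \<partial>lebesgue"
  have b: "?b > 0" by (rule measure_ball_pos[OF R])
  have ms: "?m > 0" "?s > 0" by (rule mass_eq(2)[OF R], rule other.mass_eq(2)[OF R])
  have cpos: "K powr p * \<eta> powr (p - 1) * ?b > 0" using K_pos \<eta> b by (simp del: measure_completion)
  show ?thesis
  proof (cases "?I = \<infinity>")
    case True
    moreover have "ennreal X * \<infinity> = \<infinity>" if "X > 0" for X using that by (simp add: ennreal_mult_top)
    ultimately show ?thesis using cpos by (simp only: infinity_ennreal_def top_greatest)
  next
    case False
    then obtain i where i: "?I = ennreal i" "i \<ge> 0" by (cases ?I) auto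
    have "emeasure lebesgue E \<le> emeasure lebesgue (ball c R)" using E(2) by (intro emeasure_mono) auto
    then have "emeasure lebesgue E < \<infinity>" using lebesgue.fin[of c R] by (rule le_less_trans)
    then obtain e where e: "emeasure lebesgue E = ennreal e" "e \<ge> 0" by (cases "emeasure lebesgue E") auto
    have be: "?b \<le> \<eta> * e"
      using vol \<eta> e unfolding emeasure_ball_eq e(1) by (simp add: ennreal_mult[symmetric] ennreal_le_iff del: measure_completion)
    then have e0: "e > 0" using b \<eta> e(2) by (metis less_eq_real_def linorder_not_less mult_zero_right)
    have "?I \<noteq> 0"
    proof
      assume "?I = 0"
      then have "AE x in lebesgue. ennreal (\<sigma> x * w x) * indicator E x = 0"
        by (subst (asm) nn_integral_0_iff_AE) auto
      then have "AE x in lebesgue. x \<notin> E"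
      proof eventually_elim
        case (elim x)
        have "ennreal (\<sigma> x * w x) > 0" using w_pos[of x] \<sigma>_pos[of x] by simp
        then show ?case using elim by (auto simp: indicator_def)
      qed
      then have "emeasure lebesgue E = 0" by (simp add: AE_iff_measurable[OF E(1)])
      then show False using e0 e by simp
    qed
    then have i0: "i > 0" using i by (simp add: less_le)
    define \<theta> where "\<theta> = 1 / (p - 1)"
    have \<theta>: "0 < \<theta>" "\<theta> \<le> 1" "\<theta> * (p - 1) = 1" "(1 - \<theta>) * (p - 1) = p - 2" using p2 by (auto simp: \<theta>_def field_simps)
    have one: "(\<sigma> x * w x) powr \<theta> * \<sigma> x powr (1 - \<theta>) = 1" for x
    proof -
      have "q / p = \<theta>" using pq exponents(2) by (simp add: \<theta>_def field_simps)
      then have "1 / p * q = \<theta>" by simp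
      have "(\<sigma> x * w x) powr \<theta> * \<sigma> x powr (1 - \<theta>) = w x powr \<theta> * (\<sigma> x powr \<theta> * \<sigma> x powr (1 - \<theta>))"
        using w_pos[of x] \<sigma>_pos[of x] by (simp add: powr_mult)
      also have "\<sigma> x powr \<theta> * \<sigma> x powr (1 - \<theta>) = \<sigma> x" using \<sigma>_pos[of x] by (simp add: powr_add[symmetric])
      also have "w x powr \<theta> * \<sigma> x = (w x powr (1 / p) * \<sigma> x powr (1 / q)) powr q"
        using w_pos[of x] \<sigma>_pos[of x] pq by (simp add: powr_mult powr_powr \<open>q / p = \<theta>\<close>)
      finally show ?thesis by (simp add: dual)
    qed
    have "ennreal e = (\<integral>\<^sup>+x\<in>E. ennreal ((\<sigma> x * w x) powr \<theta> * \<sigma> x powr (1 - \<theta>)) \<partial>lebesgue)"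
      by (simp add: one e(1)[symmetric] del: emeasure_completion)
    also have "\<dots> \<le> ennreal (i powr \<theta> * ?s powr (1 - \<theta>))"
    proof (rule holder_interpolation)
      have "(\<integral>\<^sup>+x\<in>E. ennreal (\<sigma> x) \<partial>lebesgue) \<le> (\<integral>\<^sup>+x\<in>ball c R. ennreal (\<sigma> x) \<partial>lebesgue)"
        using E(2) by (intro nn_integral_mono) (auto simp: indicator_def)
      then show "(\<integral>\<^sup>+x\<in>E. ennreal (\<sigma> x) \<partial>lebesgue) \<le> ennreal ?s" by (simp add: other.mass_eq(1)[OF R])
    qed (use i i0 ms \<theta> w_pos \<sigma>_pos in auto)
    finally have "e \<le> i powr \<theta> * ?s powr (1 - \<theta>)" by (simp add: ennreal_le_iff)
    then have "e powr (p - 1) \<le> (i powr \<theta> * ?s powr (1 - \<theta>)) powr (p - 1)" using p2 e0 by (intro powr_mono2) auto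
    then have e_le: "e powr (p - 1) \<le> i * ?s powr (p - 2)"
      using i0 ms by (simp add: powr_mult powr_powr \<theta>)
    have "(?m powr (1 / p) * ?s powr (1 / q)) powr p \<le> (K * ?b) powr p"
      using A_p_mass[OF R] pq by (intro powr_mono2) auto
    then have "?m * ?s powr (p - 1) \<le> K powr p * ?b powr p"
      using pq ms K_pos b by (simp add: powr_mult powr_powr exponents del: measure_completion)
    also have "?b powr p = ?b * ?b powr (p - 1)" using b powr_add[of ?b 1 "p - 1"] by (simp del: measure_completion)
    also have "?b powr (p - 1) \<le> (\<eta> * e) powr (p - 1)" using be b pq by (intro powr_mono2) (auto simp del: measure_completion)
    also have "(\<eta> * e) powr (p - 1) = \<eta> powr (p - 1) * e powr (p - 1)" using \<eta> e0 by (simp add: powr_mult)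
    also have "e powr (p - 1) \<le> i * ?s powr (p - 2)" by (rule e_le)
    finally have "?m * ?s powr (p - 1) \<le> K powr p * (?b * (\<eta> powr (p - 1) * (i * ?s powr (p - 2))))"
      using b \<eta> by (simp add: mult_left_mono del: measure_completion)
    moreover have "?s powr (p - 1) = ?s * ?s powr (p - 2)" using ms powr_add[of ?s 1 "p - 2"] by simp
    ultimately have "(?m * ?s) * ?s powr (p - 2) \<le> (K powr p * \<eta> powr (p - 1) * ?b * i) * ?s powr (p - 2)"
      by (simp add: mult.assoc mult.left_commute del: measure_completion)
    then have "?m * ?s \<le> K powr p * \<eta> powr (p - 1) * ?b * i" using ms by (simp del: measure_completion)
    then have "ennreal (?m * ?s) \<le> ennreal (K powr p * \<eta> powr (p - 1) * ?b * i)" by (rule ennreal_leI)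
    also have "\<dots> = ennreal (K powr p * \<eta> powr (p - 1) * ?b) * ?I" unfolding i(1) using i0 cpos by (intro ennreal_mult) auto
    finally show ?thesis .
  qed
qed

end

context dual_weights
begin

lemma mass_product_le:
  assumes \<eta>: "\<eta> > 0"
  obtains K' where "K' > 0"
    "\<And>c R E. R > 0 \<Longrightarrow> E \<in> sets lebesgue \<Longrightarrow> E \<subseteq> ball c R \<Longrightarrow>
      emeasure lebesgue (ball c R) \<le> ennreal \<eta> * emeasure lebesgue E \<Longrightarrow>
      ennreal (mass c R * other.mass c R) \<le> ennreal (K' * measure lebesgue (ball c R)) * (\<integral>\<^sup>+x\<in>E. ennreal (\<sigma> x * w x) \<partial>lebesgue)"
proof (cases "p \<ge> 2")
  case True
  show thesis
    by (rule that[of "K powr p * \<eta> powr (p - 1)"]) (use K_pos \<eta> mass_product_le_of_ge_2[OF True _ _ _ \<eta>] in auto)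
next
  case False
  then have "1 / p > 1 / 2" using pq(1) by (intro divide_strict_left_mono) auto
  then have "1 / q < 1 / 2" using pq(3) by linarith
  then have "q \<ge> 2" using pq(2) by (simp add: field_simps)
  show thesis
    by (rule that[of "K powr q * \<eta> powr (q - 1)"])
      (use K_pos \<eta> other.mass_product_le_of_ge_2[OF \<open>q \<ge> 2\<close> _ _ _ \<eta>] in \<open>auto simp: mult.commute\<close>)
qed

end

text \<open>
  The sparse bound at \<open>r = 1\<close>, which rests on weak type \<open>(1, 1)\<close>. Both weights are doubling by
  \<open>mass_le_subset\<close>, and the testing condition is \<open>mass_product_le\<close>.
\<close>
lemma (in L2_operator) Lp_bounded_dual_weights:
  assumes II: "cond_II T" and weak: "weak_type T 1 C" "C \<ge> 0" and dw: "dual_weights p q K w \<sigma>"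
  shows "bounded_on_Lp_weight T p w"
proof -
  interpret dual_weights p q K w \<sigma> by (rule dw)
  define \<eta> where "\<eta> = 2 * ball_cell_ratio TYPE('n) + 1"
  have \<eta>: "\<eta> > 0" by (simp add: \<eta>_def add_nonneg_pos)
  obtain K' where K': "K' > 0"
    "\<And>c R E. R > 0 \<Longrightarrow> E \<in> sets lebesgue \<Longrightarrow> E \<subseteq> ball c R \<Longrightarrow>
      emeasure lebesgue (ball c R) \<le> ennreal \<eta> * emeasure lebesgue E \<Longrightarrow>
      ennreal (mass c R * other.mass c R) \<le> ennreal (K' * measure lebesgue (ball c R)) * (\<integral>\<^sup>+x\<in>E. ennreal (\<sigma> x * w x) \<partial>lebesgue)"
    by (rule mass_product_le[OF \<eta>]) blast
  have product: "\<sigma> x powr (1 / p) * w x powr (1 / q) = \<sigma> x * w x" for x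
  proof -
    have "\<sigma> x = \<sigma> x powr (1 / p) * \<sigma> x powr (1 / q)" "w x = w x powr (1 / p) * w x powr (1 / q)"
      using \<sigma>_pos[of x] w_pos[of x] pq by (simp_all add: powr_add[symmetric])
    then have "\<sigma> x * w x = (w x powr (1 / p) * \<sigma> x powr (1 / q)) * (\<sigma> x powr (1 / p) * w x powr (1 / q))"
      by (metis mult.assoc mult.left_commute)
    then show ?thesis by (simp add: dual)
  qed
  show ?thesis
  proof (rule Lp_weight_bound_of_testing[OF II weak _ pq _ w_meas w_pos \<sigma>_meas \<sigma>_pos _ doubling other.doubling])
    show "w x = \<sigma> x powr (1 - p / real 1)" for x
    proof -
      have "(w x powr (1 / p) * \<sigma> x powr (1 / q)) powr p = w x * \<sigma> x powr (p - 1)"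
        using \<sigma>_pos[of x] w_pos[of x] pq by (simp add: powr_mult powr_powr exponents)
      then have "w x * \<sigma> x powr (p - 1) = 1" by (simp add: dual)
      then show ?thesis using \<sigma>_pos[of x] by (simp add: powr_diff field_simps)
    qed
    fix c :: "real ^ 'n" and R :: real and E
    assume R: "R > 0" and E: "E \<in> sets lebesgue" "E \<subseteq> ball c R"
      and vol: "emeasure lebesgue (ball c R) \<le> ennreal (2 * ball_cell_ratio TYPE('n)) * emeasure lebesgue E"
    let ?b = "measure lebesgue (ball c R)" and ?I = "\<integral>\<^sup>+x\<in>E. ennreal (\<sigma> x * w x) \<partial>lebesgue"
    have b: "?b > 0" by (rule measure_ball_pos[OF R])
    have ms: "mass c R > 0" "other.mass c R > 0" by (rule mass_eq(2)[OF R], rule other.mass_eq(2)[OF R])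
    have vol': "emeasure lebesgue (ball c R) \<le> ennreal \<eta> * emeasure lebesgue E"
      by (rule order_trans[OF vol]) (intro mult_right_mono ennreal_leI, auto simp: \<eta>_def)
    have "ennreal ((other.mass c R / ?b) powr (1 / real 1) * mass c R) = ennreal (1 / ?b) * ennreal (mass c R * other.mass c R)"
      using ms b by (simp add: ennreal_mult[symmetric] ac_simps del: measure_completion)
    also have "\<dots> \<le> ennreal (1 / ?b) * (ennreal (K' * ?b) * ?I)"
      by (intro mult_left_mono K'(2) R E vol') auto
    also have "\<dots> = ennreal K' * ?I"
      using K'(1) b by (simp add: mult.assoc[symmetric] ennreal_mult[symmetric] del: measure_completion)
    finally show "ennreal ((enn2real (\<integral>\<^sup>+x\<in>ball c R. ennreal (\<sigma> x) \<partial>lebesgue) / ?b) powr (1 / real 1) *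
          enn2real (\<integral>\<^sup>+x\<in>ball c R. ennreal (w x) \<partial>lebesgue))
        \<le> ennreal K' * (\<integral>\<^sup>+x\<in>E. ennreal (\<sigma> x powr (1 / p) * w x powr (1 / q)) \<partial>lebesgue)"
      unfolding product mass_def other.mass_def .
  qed (use pq K' in auto)
qed

lemma weight_measurable:
  fixes w :: "real ^ 'n \<Rightarrow> real"
  assumes "weight w" shows "w \<in> borel_measurable lebesgue"
proof (rule borel_measurable_LIMSEQ_real)
  show "(\<lambda>x. indicator (cball 0 (real k)) x *\<^sub>R w x) \<in> borel_measurable lebesgue" for k
    using assms unfolding weight_def set_integrable_def by (meson borel_measurable_integrable compact_cball)
  fix x :: "real ^ 'n"
  obtain k0 :: nat where "norm x \<le> real k0" using real_arch_simple by blast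
  then have "eventually (\<lambda>k. indicator (cball 0 (real k)) x *\<^sub>R w x = w x) sequentially"
    by (intro eventually_sequentiallyI[of k0]) (auto simp: indicator_def)
  then show "(\<lambda>k. indicator (cball 0 (real k)) x *\<^sub>R w x) \<longlonglongrightarrow> w x" by (rule tendsto_eventually)
qed

lemma weight_ball_finite:
  assumes "weight w" shows "(\<integral>\<^sup>+x\<in>ball c R. ennreal (w x) \<partial>lebesgue) < \<infinity>"
proof -
  have "integrable lebesgue (\<lambda>x. indicator (cball c R) x *\<^sub>R w x)"
    using assms compact_cball unfolding weight_def set_integrable_def by blast
  then have "(\<integral>\<^sup>+x. ennreal (norm (indicator (cball c R) x *\<^sub>R w x)) \<partial>lebesgue) < \<infinity>"
    by (simp add: integrable_iff_bounded)
  moreover have "(\<integral>\<^sup>+x\<in>ball c R. ennreal (w x) \<partial>lebesgue) \<le> (\<integral>\<^sup>+x. ennreal (norm (indicator (cball c R) x *\<^sub>R w x)) \<partial>lebesgue)"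
    by (intro nn_integral_mono) (auto simp: indicator_def intro!: ennreal_leI)
  ultimately show ?thesis by (rule le_less_trans[rotated])
qed

lemma ennpowr_measurable: "a \<noteq> 0 \<Longrightarrow> (\<lambda>x. x ennpowr a) \<in> borel_measurable borel"
  unfolding ennpowr_def by measurable

text \<open>
  If the weight has positive mass on some ball, the \<open>A\<^sub>p\<close> condition on larger balls forces the dual weight,
  which is infinite where \<open>w\<close> vanishes, to be integrable.
\<close>
lemma A_class_positive:
  fixes w :: "real ^ 'n \<Rightarrow> real"
  assumes w: "w \<in> A_class p" and p: "p > 1" and nz: "\<not> (AE x in lebesgue. w x = 0)"
  shows "AE x in lebesgue. w x > 0"
    and "(\<integral>\<^sup>+x\<in>ball c R. ennreal (w x) ennpowr (1 - p / (p - 1)) \<partial>lebesgue) < \<infinity>"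
proof -
  have wt: "weight w" using w by (simp add: A_class_def)
  obtain C where C: "\<And>c r. r > 0 \<Longrightarrow> avg (ball c r) (\<lambda>x. ennreal (w x))
         * avg (ball c r) (\<lambda>x. ennreal (w x) ennpowr (1 - p / (p - 1))) ennpowr (p - 1) \<le> ennreal C"
    using w by (auto simp: A_class_def)
  note [measurable] = weight_measurable[OF wt]
  let ?s = "\<lambda>x. ennreal (w x) ennpowr (1 - p / (p - 1))"
  have neg: "1 - p / (p - 1) < 0" using p by (simp add: field_simps)
  have [measurable]: "?s \<in> borel_measurable lebesgue"
    using ennpowr_measurable[of "1 - p / (p - 1)"] neg by measurable
  have "\<exists>k :: nat. (\<integral>\<^sup>+x\<in>ball 0 (real k). ennreal (w x) \<partial>lebesgue) \<noteq> 0"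
  proof (rule ccontr)
    assume "\<not> ?thesis"
    then have "AE x in lebesgue. ennreal (w x) * indicator (ball 0 (real k)) x = 0" for k
      by (subst nn_integral_0_iff_AE[symmetric]) auto
    then have "AE x in lebesgue. \<forall>k. ennreal (w x) * indicator (ball 0 (real k)) x = 0"
      by (subst AE_all_countable) auto
    then have "AE x in lebesgue. w x = 0"
    proof eventually_elim
      case (elim x)
      obtain k :: nat where "norm x < real k" using reals_Archimedean2 by blast
      then have "ennreal (w x) = 0" using elim[rule_format, of k] by simp
      then show ?case using wt by (auto simp: weight_def ennreal_eq_0_iff intro: antisym)
    qed
    then show False using nz by simp
  qed
  then obtain k0 :: nat where k0: "(\<integral>\<^sup>+x\<in>ball 0 (real k0). ennreal (w x) \<partial>lebesgue) \<noteq> 0" ..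
  have fin: "(\<integral>\<^sup>+x\<in>ball 0 r. ?s x \<partial>lebesgue) < \<infinity>" if r: "r > 0" "real k0 \<le> r" for r
  proof (rule ccontr)
    assume "\<not> ?thesis"
    then have "(\<integral>\<^sup>+x\<in>ball 0 r. ?s x \<partial>lebesgue) = \<infinity>" by (simp add: less_top[symmetric])
    moreover have B: "0 < emeasure lebesgue (ball (0 :: real ^ 'n) r)" "emeasure lebesgue (ball (0 :: real ^ 'n) r) < \<infinity>"
      by (rule lebesgue.pos[OF r(1)], rule lebesgue.fin)
    ultimately have "avg (ball 0 r) ?s = \<infinity>" by (simp add: avg_def ennreal_top_divide less_top del: emeasure_completion)
    then have "avg (ball 0 r) ?s ennpowr (p - 1) = \<infinity>" using p by (simp add: ennpowr_def)
    moreover have "avg (ball 0 r) (\<lambda>x. ennreal (w x)) \<noteq> 0"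
    proof -
      have "(\<integral>\<^sup>+x\<in>ball 0 (real k0). ennreal (w x) \<partial>lebesgue) \<le> (\<integral>\<^sup>+x\<in>ball 0 r. ennreal (w x) \<partial>lebesgue)"
        using subset_ball[OF r(2), of "0 :: real ^ 'n"] by (intro nn_integral_mono) (auto simp: indicator_def)
      then have "(\<integral>\<^sup>+x\<in>ball 0 r. ennreal (w x) \<partial>lebesgue) \<noteq> 0" using k0 by auto
      then show ?thesis using B by (simp add: avg_def divide_ennreal_def ennreal_inverse_eq_0_iff less_top del: emeasure_completion)
    qed
    ultimately have "avg (ball 0 r) (\<lambda>x. ennreal (w x)) * avg (ball 0 r) ?s ennpowr (p - 1) = \<infinity>"
      by (simp add: ennreal_mult_top)
    then show False using C[OF r(1), of 0] by (simp add: top_unique)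
  qed
  show 2: "(\<integral>\<^sup>+x\<in>ball c R. ?s x \<partial>lebesgue) < \<infinity>" for c R
  proof -
    let ?r = "norm c + \<bar>R\<bar> + real k0 + 1"
    have "R \<le> \<bar>R\<bar> + (real k0 + 1)" using abs_ge_self[of R] by linarith
    then have "ball c R \<subseteq> ball 0 ?r" by (simp add: ball_subset_ball_iff)
    then have "(\<integral>\<^sup>+x\<in>ball c R. ?s x \<partial>lebesgue) \<le> (\<integral>\<^sup>+x\<in>ball 0 ?r. ?s x \<partial>lebesgue)"
      by (intro nn_integral_mono) (auto simp: indicator_def)
    also have "\<dots> < \<infinity>" by (rule fin) (auto simp: add_nonneg_pos)
    finally show ?thesis .
  qed
  have "AE x in lebesgue. ?s x * indicator (ball 0 (real k)) x \<noteq> \<infinity>" for k :: nat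
    using 2[of 0 "real k"] by (intro nn_integral_PInf_AE) (auto simp: less_top)
  then have "AE x in lebesgue. \<forall>k :: nat. ?s x * indicator (ball 0 (real k)) x \<noteq> \<infinity>"
    by (subst AE_all_countable) auto
  then show "AE x in lebesgue. w x > 0"
  proof eventually_elim
    case (elim x)
    obtain k :: nat where "norm x < real k" using reals_Archimedean2 by blast
    then have "?s x \<noteq> \<infinity>" using elim[rule_format, of k] by simp
    then have "ennreal (w x) \<noteq> 0" using neg by (auto simp: ennpowr_def)
    then show ?case by (simp add: ennreal_eq_0_iff not_le)
  qed
qed

text \<open>
  The weight is changed on a null set so as to be positive everywhere.
\<close>
lemma A_class_dual_weights:
  fixes w :: "real ^ 'n \<Rightarrow> real"
  assumes w: "w \<in> A_class p" and p: "p > 1" and nz: "\<not> (AE x in lebesgue. w x = 0)"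
  obtains w' \<sigma> K where "AE x in lebesgue. w' x = w x" "dual_weights p (p / (p - 1)) K w' \<sigma>"
proof -
  have wt: "weight w" using w by (simp add: A_class_def)
  obtain C where C: "\<And>c r. r > 0 \<Longrightarrow> avg (ball c r) (\<lambda>x. ennreal (w x))
         * avg (ball c r) (\<lambda>x. ennreal (w x) ennpowr (1 - p / (p - 1))) ennpowr (p - 1) \<le> ennreal C"
    using w by (auto simp: A_class_def)
  note [measurable] = weight_measurable[OF wt]
  let ?s = "\<lambda>x. ennreal (w x) ennpowr (1 - p / (p - 1))"
  let ?q = "p / (p - 1)"
  have q: "?q > 1" "1 / p + 1 / ?q = 1" "1 / ?q * (p - 1) = (p - 1) * (1 / ?q)" using p by (auto simp: field_simps)
  have neg: "1 - ?q < 0" using q by simp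
  have wpos: "AE x in lebesgue. w x > 0" by (rule A_class_positive[OF w p nz])
  define w' where "w' x = (if w x > 0 then w x else 1)" for x
  define \<sigma> where "\<sigma> x = w' x powr (1 - ?q)" for x
  have w'pos: "w' x > 0" for x by (simp add: w'_def)
  have \<sigma>pos: "\<sigma> x > 0" for x using w'pos[of x] by (simp add: \<sigma>_def)
  have [measurable]: "w' \<in> borel_measurable lebesgue" unfolding w'_def by measurable
  then have [measurable]: "\<sigma> \<in> borel_measurable lebesgue" unfolding \<sigma>_def by measurable
  have eq: "AE x in lebesgue. w' x = w x" using wpos by eventually_elim (simp add: w'_def)
  have \<sigma>eq: "AE x in lebesgue. ennreal (\<sigma> x) = ?s x"
    using wpos by eventually_elim (use neg in \<open>simp add: \<sigma>_def w'_def ennpowr_def\<close>)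
  have int_w: "(\<integral>\<^sup>+x\<in>ball c R. ennreal (w' x) \<partial>lebesgue) = (\<integral>\<^sup>+x\<in>ball c R. ennreal (w x) \<partial>lebesgue)" for c R
    using eq by (intro nn_integral_cong_AE) (auto elim: eventually_mono)
  have int_\<sigma>: "(\<integral>\<^sup>+x\<in>ball c R. ennreal (\<sigma> x) \<partial>lebesgue) = (\<integral>\<^sup>+x\<in>ball c R. ?s x \<partial>lebesgue)" for c R
    using \<sigma>eq by (intro nn_integral_cong_AE) (auto elim: eventually_mono)
  have "dual_weights p ?q (\<bar>C\<bar> powr (1 / p)) w' \<sigma>"
  proof
    show "w' x powr (1 / p) * \<sigma> x powr (1 / ?q) = 1" for x
    proof -
      have "1 / p + (1 - ?q) * (1 / ?q) = 0" using p by (simp add: field_simps)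
      then show ?thesis using w'pos[of x] by (simp only: \<sigma>_def powr_powr powr_add[symmetric]) simp
    qed
    show "(\<integral>\<^sup>+x\<in>ball c R. ennreal (w' x) \<partial>lebesgue) < \<infinity>" for c R
      unfolding int_w by (rule weight_ball_finite[OF wt])
    show "(\<integral>\<^sup>+x\<in>ball c R. ennreal (\<sigma> x) \<partial>lebesgue) < \<infinity>" for c R
      unfolding int_\<sigma> by (rule A_class_positive[OF w p nz])
    fix c :: "real ^ 'n" and R :: real assume R: "R > 0"
    obtain a where a: "(\<integral>\<^sup>+x\<in>ball c R. ennreal (w x) \<partial>lebesgue) = ennreal a" "a \<ge> 0"
      using weight_ball_finite[OF wt, of c R] by (cases "\<integral>\<^sup>+x\<in>ball c R. ennreal (w x) \<partial>lebesgue") auto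
    obtain s where s: "(\<integral>\<^sup>+x\<in>ball c R. ?s x \<partial>lebesgue) = ennreal s" "s \<ge> 0"
      using A_class_positive(2)[OF w p nz, of c R] by (cases "\<integral>\<^sup>+x\<in>ball c R. ?s x \<partial>lebesgue") auto
    obtain b where b: "emeasure lebesgue (ball c R) = ennreal b" "b > 0"
      using lebesgue.pos[OF R, of c] lebesgue.fin[of c R] by (cases "emeasure lebesgue (ball c R)") auto
    have mb: "measure lebesgue (ball c R) = b" using b by (simp add: measure_def del: emeasure_completion measure_completion)
    have "avg (ball c R) (\<lambda>x. ennreal (w x)) = ennreal (a / b)" "avg (ball c R) ?s = ennreal (s / b)"
      unfolding avg_def a(1) s(1) b(1) using a s b by (simp_all add: divide_ennreal)
    then have "ennreal (a / b * (s / b) powr (p - 1)) \<le> ennreal C"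
      using C[OF R, of c] a s b p by (simp add: ennpowr_ennreal ennreal_mult[symmetric])
    also have "\<dots> \<le> ennreal \<bar>C\<bar>" by (intro ennreal_leI) simp
    finally have "a / b * (s / b) powr (p - 1) \<le> \<bar>C\<bar>" by (simp add: ennreal_le_iff)
    then have "(a / b * (s / b) powr (p - 1)) powr (1 / p) \<le> \<bar>C\<bar> powr (1 / p)"
      using a s b p by (intro powr_mono2) auto
    moreover have "(a / b * (s / b) powr (p - 1)) powr (1 / p) = a powr (1 / p) * s powr (1 / ?q) / b"
    proof -
      have e: "(p - 1) * (1 / p) = 1 / ?q" by simp
      have "(a / b * (s / b) powr (p - 1)) powr (1 / p) = (a / b) powr (1 / p) * (s / b) powr (1 / ?q)"
        using a s b by (simp only: powr_mult powr_powr e)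
      also have "\<dots> = a powr (1 / p) * s powr (1 / ?q) / (b powr (1 / p) * b powr (1 / ?q))"
        using a s b by (simp only: powr_divide) simp
      also have "b powr (1 / p) * b powr (1 / ?q) = b"
        using b q(2) by (simp only: powr_add[symmetric]) simp
      finally show ?thesis .
    qed
    ultimately have "a powr (1 / p) * s powr (1 / ?q) \<le> \<bar>C\<bar> powr (1 / p) * b" using b by (simp add: pos_divide_le_eq)
    then show "enn2real (\<integral>\<^sup>+x\<in>ball c R. ennreal (w' x) \<partial>lebesgue) powr (1 / p) *
      enn2real (\<integral>\<^sup>+x\<in>ball c R. ennreal (\<sigma> x) \<partial>lebesgue) powr (1 / ?q) \<le> \<bar>C\<bar> powr (1 / p) * measure lebesgue (ball c R)"
      unfolding int_w int_\<sigma> a(1) s(1) mb using a s by (simp only: enn2real_ennreal)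
  qed (use p q w'pos \<sigma>pos in auto)
  with eq show thesis by (rule that)
qed

lemma Lp_norm_cong_weight:
  assumes "AE x in lebesgue. w' x = w x" shows "Lp_norm p w' f = Lp_norm p w f"
  unfolding Lp_norm_def using assms
  by (intro arg_cong2[where f = "(ennpowr)"] nn_integral_cong_AE refl) (auto elim!: eventually_mono)

theorem corollary3p3:
  fixes T :: "(real ^ 'n \<Rightarrow> complex) \<Rightarrow> (real ^ 'n \<Rightarrow> complex)"
  assumes "sublinear_operator T"
    and "bounded_on_L2 T"
  shows "(cond_I T \<longrightarrow> weak_type_1_1 T \<and> (\<forall>p. 1 < p \<and> p < 2 \<longrightarrow> bounded_on_Lp T p)) \<and>
         (cond_II T \<longrightarrow> (\<forall>p. 2 < p \<longrightarrow> bounded_on_Lp T p)) \<and>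
         (cond_I T \<and> cond_II T \<longrightarrow>
            (\<forall>p > 1. \<forall>w \<in> A_class p. bounded_on_Lp_weight T p w))"
proof -
  interpret L2_operator T using assms by unfold_locales
  show ?thesis
  proof (intro conjI impI allI ballI)
    assume "cond_I T"
    then obtain C where C: "C \<ge> 0" "weak_type T 1 C" by (rule weak_type_1)
    show "weak_type_1_1 T"
      unfolding weak_type_1_1_def
    proof (intro exI[of _ C] allI impI ballI)
      fix t :: real and f :: "real ^ 'n \<Rightarrow> complex" assume t: "t > 0" and f: "f \<in> Linf_c"
      have "ennreal t * emeasure lebesgue {x. norm (T f x) > t} \<le> ennreal t * (ennreal (C / t ^ 1) * (\<integral>\<^sup>+x. ennreal (norm (f x) ^ 1) \<partial>lebesgue))"
        by (intro mult_left_mono weak_typeD[OF C(2) f t]) simp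
      also have "\<dots> = ennreal C * (\<integral>\<^sup>+x. ennreal (norm (f x)) \<partial>lebesgue)"
        using t C(1) by (simp add: mult.assoc[symmetric] ennreal_mult[symmetric])
      finally show "ennreal t * emeasure lebesgue {x. norm (T f x) > t} \<le> ennreal C * (\<integral>\<^sup>+x. ennreal (norm (f x)) \<partial>lebesgue)" .
    qed
    show "bounded_on_Lp T p" if "1 < p \<and> p < 2" for p
      using Lp_bounded_between_1_2[OF C(2,1)] that by blast
  next
    show "bounded_on_Lp T p" if "cond_II T" "2 < p" for p
      using that by (rule Lp_bounded_above_2)
  next
    fix p :: real and w :: "real ^ 'n \<Rightarrow> real"
    assume I_II: "cond_I T \<and> cond_II T" and p: "p > 1" and w: "w \<in> A_class p"
    obtain C where C: "C \<ge> 0" "weak_type T 1 C" by (rule weak_type_1[OF conjunct1[OF I_II]])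
    show "bounded_on_Lp_weight T p w"
    \<comment> \<open>A weight that vanishes almost everywhere belongs to \<open>A\<^sub>p\<close>, because the product \<open>0 * \<infinity>\<close> is \<open>0\<close>; all norms
      are then \<open>0\<close>.\<close>
    proof (cases "AE x in lebesgue. w x = 0")
      case True
      then have "(\<integral>\<^sup>+x. ennreal (norm (h x) powr p * w x) \<partial>lebesgue) = (\<integral>\<^sup>+x. 0 \<partial>(lebesgue :: (real ^ 'n) measure))" for h :: "real ^ 'n \<Rightarrow> complex"
        by (intro nn_integral_cong_AE) (auto elim: eventually_mono)
      then have "Lp_norm p w h = 0" for h using p by (simp add: Lp_norm_def ennpowr_def)
      then show ?thesis by (simp add: bounded_on_Lp_weight_def)
    next
      case False
      obtain w' \<sigma> K where w': "AE x in lebesgue. w' x = w x" "dual_weights p (p / (p - 1)) K w' \<sigma>"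
        by (rule A_class_dual_weights[OF w p False])
      have "bounded_on_Lp_weight T p w'"
        by (rule Lp_bounded_dual_weights[OF conjunct2[OF I_II] C(2,1) w'(2)])
      then show ?thesis by (simp add: bounded_on_Lp_weight_def Lp_norm_cong_weight[OF w'(1)])
    qed
  qed
qed

end
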